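(* Let $\mathbb K$ be a field of characteristic zero. The algebras $U(W)$, $U(W_+)$, and $U(Vir)$ all satisfy the ascending chain condition for completely prime ideals.
   Context: Let $\mathbb K$ be a field of characteristic zero. The Witt algebra $W$ is the Lie algebra over $\mathbb K$ with basis $\{e_n : n\in\mathbb Z\}$ and bracket $[e_i,e_j]=(j-i)e_{i+j}$. The positive Witt algebra $W_+$ is the Lie subalgebra of $W$ spanned by $\{e_n : n\ge 1\}$. The Virasoro algebra $Vir$ is the Lie algebra with basis $\{e_n : n\in\mathbb Z\}\cup\{c\}$ and bracket $[e_i,e_j]=(j-i)e_{i+j}+\frac{i^3-i}{12}\delta_{i+j,0}\,c$, with $c$ central. $U(\cdot)$ denotes the universal enveloping algebra. A two-sided ideal $P$ of a ring $R$ is completely prime if $R/P$ is a (not necessarily commutative) domain. *)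

theory Defs
  imports HOL.Vector_Spaces "HOL-Algebra.QuotRing" "HOL-Library.Poly_Mapping"
begin

section \<open>Lie algebras\<close>

locale lie_algebra = vector_space scale
  for scale :: "'k::field \<Rightarrow> 'l::ab_group_add \<Rightarrow> 'l" +
  fixes bracket :: "'l \<Rightarrow> 'l \<Rightarrow> 'l"
  assumes bracket_add_left: "bracket (x + y) z = bracket x z + bracket y z"
    and bracket_add_right: "bracket x (y + z) = bracket x y + bracket x z"
    and bracket_scale_left: "bracket (scale a x) y = scale a (bracket x y)"
    and bracket_scale_right: "bracket x (scale a y) = scale a (bracket x y)"
    and bracket_self: "bracket x x = 0"
    and jacobi: "bracket x (bracket y z) + bracket y (bracket z x) + bracket z (bracket x y) = 0"
begin

definition lie_subalgebra :: "'l set \<Rightarrow> bool"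
  where "lie_subalgebra L \<longleftrightarrow> subspace L \<and> (\<forall>x\<in>L. \<forall>y\<in>L. bracket x y \<in> L)"

end


section \<open>Universal enveloping algebras\<close>

text \<open>The free monoid: lists under concatenation, so that \<open>'a free_monoid \<Rightarrow>\<^sub>0 'k\<close>
  with the convolution product is the free associative unital algebra on \<open>'a\<close>.\<close>

datatype 'a free_monoid = Word (letters: "'a list")

instantiation free_monoid :: (type) monoid_add
begin

definition zero_free_monoid :: "'a free_monoid"
  where "0 = Word []"

definition plus_free_monoid :: "'a free_monoid \<Rightarrow> 'a free_monoid \<Rightarrow> 'a free_monoid"
  where "u + v = Word (letters u @ letters v)"

instance
  by standard (auto simp: zero_free_monoid_def plus_free_monoid_def)

end

lemma letters_zero [simp]: "letters 0 = []"
  by (simp add: zero_free_monoid_def)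

lemma letters_plus [simp]: "letters (u + v) = letters u @ letters v"
  by (simp add: plus_free_monoid_def)

definition free_algebra :: "'a set \<Rightarrow> ('a free_monoid \<Rightarrow>\<^sub>0 'k::field) ring"
  where "free_algebra A =
    \<lparr>carrier = {p. \<forall>w\<in>Poly_Mapping.keys p. set (letters w) \<subseteq> A},
     mult = (*), one = 1, zero = 0, add = (+)\<rparr>"

definition gen :: "'a \<Rightarrow> 'a free_monoid \<Rightarrow>\<^sub>0 'k::field"
  where "gen x = Poly_Mapping.single (Word [x]) 1"

text \<open>The generators are all elements of \<open>L\<close>, not a basis. The first two families of relations
  make \<open>gen\<close> linear and so cut the free algebra on the set \<open>L\<close> down to the tensor algebra of the
  vector space \<open>L\<close>; the third imposes \<open>x y - y x = [x, y]\<close>. A scalar \<open>a\<close> is embedded as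
  \<open>single 0 a\<close>, supported on the empty word.\<close>

definition enveloping_relations ::
    "('k::field \<Rightarrow> 'l::ab_group_add \<Rightarrow> 'l) \<Rightarrow> ('l \<Rightarrow> 'l \<Rightarrow> 'l) \<Rightarrow> 'l set \<Rightarrow> ('l free_monoid \<Rightarrow>\<^sub>0 'k) set"
  where "enveloping_relations scale bracket L =
      {gen (x + y) - (gen x + gen y) | x y. x \<in> L \<and> y \<in> L}
    \<union> {gen (scale a x) - Poly_Mapping.single 0 a * gen x | a x. x \<in> L}
    \<union> {gen x * gen y - gen y * gen x - gen (bracket x y) | x y. x \<in> L \<and> y \<in> L}"

text \<open>The enveloping algebra of the Lie subalgebra \<open>L\<close> of the Lie algebra given by \<open>scale\<close> and
  \<open>bracket\<close>.\<close>

definition enveloping_algebra ::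
    "('k::field \<Rightarrow> 'l::ab_group_add \<Rightarrow> 'l) \<Rightarrow> ('l \<Rightarrow> 'l \<Rightarrow> 'l) \<Rightarrow> 'l set \<Rightarrow> ('l free_monoid \<Rightarrow>\<^sub>0 'k) set ring"
  where "enveloping_algebra scale bracket L =
    free_algebra L Quot (genideal (free_algebra L) (enveloping_relations scale bracket L))"

lemma free_algebra_ring: "ring (free_algebra A :: ('a free_monoid \<Rightarrow>\<^sub>0 'k::field) ring)"
proof -
  define Cr where "Cr = {p :: 'a free_monoid \<Rightarrow>\<^sub>0 'k. \<forall>w\<in>Poly_Mapping.keys p. set (letters w) \<subseteq> A}"
  have eq: "free_algebra A = \<lparr>carrier = Cr, mult = (*), one = 1, zero = 0, add = (+)\<rparr>"
    by (simp add: free_algebra_def Cr_def)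
  have zero: "0 \<in> Cr" and one: "1 \<in> Cr"
    by (auto simp: Cr_def)
  have add: "p + q \<in> Cr" if "p \<in> Cr" "q \<in> Cr" for p q
    using that keys_add[of p q] by (auto simp: Cr_def)
  have neg: "- p \<in> Cr" if "p \<in> Cr" for p
    using that by (auto simp: Cr_def in_keys_iff)
  have mult: "p * q \<in> Cr" if "p \<in> Cr" "q \<in> Cr" for p q
    unfolding Cr_def
  proof (rule CollectI, rule ballI)
    fix w assume "w \<in> Poly_Mapping.keys (p * q)"
    then obtain u v where "w = u + v" "u \<in> Poly_Mapping.keys p" "v \<in> Poly_Mapping.keys q"
      using keys_mult[of p q] by blast
    with that show "set (letters w) \<subseteq> A"
      by (auto simp: Cr_def)
  qed
  show ?thesis
    unfolding eq
  proof (rule ringI, goal_cases)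
    case 1
    show ?case
      by (rule abelian_groupI)
        (auto simp: zero add add.assoc add.commute intro!: bexI[OF _ neg])
  next
    case 2
    show ?case
      by unfold_locales (auto simp: one mult mult.assoc)
  qed (auto simp: distrib_left distrib_right)
qed

lemma gen_in_free_algebra: "x \<in> A \<Longrightarrow> gen x \<in> carrier (free_algebra A)"
  by (auto simp: gen_def free_algebra_def)

lemma (in lie_algebra) enveloping_relations_subset:
  assumes "lie_subalgebra L"
  shows "enveloping_relations scale bracket L \<subseteq> carrier (free_algebra L)"
proof -
  interpret F: ring "free_algebra L :: ('l free_monoid \<Rightarrow>\<^sub>0 'k) ring"
    by (rule free_algebra_ring)
  let ?C = "carrier (free_algebra L :: ('l free_monoid \<Rightarrow>\<^sub>0 'k) ring)"
  have uminus: "- q \<in> ?C" if "q \<in> ?C" for q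
    using that by (auto simp: free_algebra_def in_keys_iff)
  have add: "p + q \<in> ?C" if "p \<in> ?C" "q \<in> ?C" for p q
    using F.add.m_closed[OF that] by (simp add: free_algebra_def)
  have minus: "p - q \<in> ?C" if "p \<in> ?C" "q \<in> ?C" for p q
    using add[OF that(1) uminus[OF that(2)]] by simp
  have mult: "p * q \<in> ?C" if "p \<in> ?C" "q \<in> ?C" for p q
    using F.m_closed[OF that] by (simp add: free_algebra_def)
  have scalar: "Poly_Mapping.single 0 a \<in> ?C" for a
    by (auto simp: free_algebra_def)
  have "x + y \<in> L" "scale a x \<in> L" "bracket x y \<in> L" if "x \<in> L" "y \<in> L" for x y a
    using assms that by (auto simp: lie_subalgebra_def subspace_def)
  then show ?thesis
    unfolding enveloping_relations_def
    by (auto intro!: minus add mult scalar gen_in_free_algebra)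
qed

lemma (in lie_algebra) enveloping_algebra_ring:
  assumes "lie_subalgebra L"
  shows "ring (enveloping_algebra scale bracket L)"
  unfolding enveloping_algebra_def
  by (intro ideal.quotient_is_ring ring.genideal_ideal free_algebra_ring
      enveloping_relations_subset assms)


section \<open>Completely prime ideals\<close>

text \<open>HOL-Algebra's \<^locale>\<open>domain\<close> is commutative; its \<^locale>\<open>ideal\<close> is two-sided over an arbitrary
  ring.\<close>

locale noncomm_domain = ring +
  assumes one_not_zero: "\<one> \<noteq> \<zero>"
    and integral: "\<lbrakk>a \<otimes> b = \<zero>; a \<in> carrier R; b \<in> carrier R\<rbrakk> \<Longrightarrow> a = \<zero> \<or> b = \<zero>"

locale completely_prime_ideal = ideal P R for P and R (structure) +
  assumes quotient_domain: "noncomm_domain (R Quot P)"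

definition acc_completely_prime :: "('a, 'b) ring_scheme \<Rightarrow> bool"
  where "acc_completely_prime R \<longleftrightarrow>
    (\<forall>P :: nat \<Rightarrow> 'a set.
      (\<forall>n. completely_prime_ideal (P n) R) \<and> (\<forall>n. P n \<subseteq> P (Suc n)) \<longrightarrow>
      (\<exists>N. \<forall>n\<ge>N. P n = P N))"


section \<open>Lie algebras given by a basis\<close>

text \<open>The vector space with basis \<open>'i\<close> is \<open>'i \<Rightarrow>\<^sub>0 'k\<close>, with basis vectors \<open>single i 1\<close>; a bracket is
  the bilinear extension of its values on basis vectors.\<close>

definition scale_fun :: "'k::field \<Rightarrow> ('i \<Rightarrow>\<^sub>0 'k) \<Rightarrow> ('i \<Rightarrow>\<^sub>0 'k)"
  where "scale_fun a f = Poly_Mapping.map ((*) a) f"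

definition bilinear_ext :: "('i \<Rightarrow> 'i \<Rightarrow> 'i \<Rightarrow>\<^sub>0 'k::field) \<Rightarrow> ('i \<Rightarrow>\<^sub>0 'k) \<Rightarrow> ('i \<Rightarrow>\<^sub>0 'k) \<Rightarrow> ('i \<Rightarrow>\<^sub>0 'k)"
  where "bilinear_ext \<beta> f g =
    (\<Sum>i\<in>Poly_Mapping.keys f. \<Sum>j\<in>Poly_Mapping.keys g.
      scale_fun (Poly_Mapping.lookup f i * Poly_Mapping.lookup g j) (\<beta> i j))"

lemma lookup_scale_fun [simp]: "Poly_Mapping.lookup (scale_fun a f) i = a * Poly_Mapping.lookup f i"
  by (simp add: scale_fun_def Poly_Mapping.map.rep_eq when_def)

lemma vector_space_scale_fun: "vector_space (scale_fun :: 'k::field \<Rightarrow> ('i \<Rightarrow>\<^sub>0 'k) \<Rightarrow> _)"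
  by unfold_locales (auto intro!: poly_mapping_eqI simp: lookup_add algebra_simps)

lemma bilinear_ext_superset:
  assumes "finite A" "Poly_Mapping.keys f \<subseteq> A" "finite B" "Poly_Mapping.keys g \<subseteq> B"
  shows "bilinear_ext \<beta> f g = (\<Sum>i\<in>A. \<Sum>j\<in>B. scale_fun (Poly_Mapping.lookup f i * Poly_Mapping.lookup g j) (\<beta> i j))"
proof -
  interpret vector_space "scale_fun :: 'b \<Rightarrow> ('a \<Rightarrow>\<^sub>0 'b) \<Rightarrow> _"
    by (rule vector_space_scale_fun)
  have "(\<Sum>j\<in>Poly_Mapping.keys g. scale_fun (Poly_Mapping.lookup f i * Poly_Mapping.lookup g j) (\<beta> i j)) =
      (\<Sum>j\<in>B. scale_fun (Poly_Mapping.lookup f i * Poly_Mapping.lookup g j) (\<beta> i j))" for i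
    using assms by (intro sum.mono_neutral_left) (auto simp: in_keys_iff)
  moreover have "(\<Sum>i\<in>Poly_Mapping.keys f. \<Sum>j\<in>B. scale_fun (Poly_Mapping.lookup f i * Poly_Mapping.lookup g j) (\<beta> i j)) =
      (\<Sum>i\<in>A. \<Sum>j\<in>B. scale_fun (Poly_Mapping.lookup f i * Poly_Mapping.lookup g j) (\<beta> i j))"
    using assms by (intro sum.mono_neutral_left) (auto simp: in_keys_iff)
  ultimately show ?thesis
    by (simp add: bilinear_ext_def)
qed

lemma bilinear_ext_single:
  "bilinear_ext \<beta> (Poly_Mapping.single i a) (Poly_Mapping.single j b) = scale_fun (a * b) (\<beta> i j)"
  by (subst bilinear_ext_superset[of "{i}" _ "{j}"]) (auto simp: lookup_single)

lemma bilinear_ext_add_left: "bilinear_ext \<beta> (f + g) h = bilinear_ext \<beta> f h + bilinear_ext \<beta> g h"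
proof -
  interpret vector_space "scale_fun :: 'b \<Rightarrow> ('a \<Rightarrow>\<^sub>0 'b) \<Rightarrow> _"
    by (rule vector_space_scale_fun)
  let ?A = "Poly_Mapping.keys f \<union> Poly_Mapping.keys g"
  have "Poly_Mapping.keys (f + g) \<subseteq> ?A"
    by (rule keys_add)
  then show ?thesis
    by (simp add: bilinear_ext_superset[of ?A _ "Poly_Mapping.keys h"] lookup_add
        scale_left_distrib distrib_right sum.distrib)
qed

lemma bilinear_ext_add_right: "bilinear_ext \<beta> h (f + g) = bilinear_ext \<beta> h f + bilinear_ext \<beta> h g"
proof -
  interpret vector_space "scale_fun :: 'b \<Rightarrow> ('a \<Rightarrow>\<^sub>0 'b) \<Rightarrow> _"
    by (rule vector_space_scale_fun)
  let ?A = "Poly_Mapping.keys f \<union> Poly_Mapping.keys g"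
  have "Poly_Mapping.keys (f + g) \<subseteq> ?A"
    by (rule keys_add)
  then show ?thesis
    by (simp add: bilinear_ext_superset[of "Poly_Mapping.keys h" _ ?A] lookup_add
        scale_left_distrib distrib_left sum.distrib)
qed

lemma keys_scale_fun: "Poly_Mapping.keys (scale_fun a f) \<subseteq> Poly_Mapping.keys f"
  by (auto simp: in_keys_iff)

lemma bilinear_ext_scale_left: "bilinear_ext \<beta> (scale_fun a f) g = scale_fun a (bilinear_ext \<beta> f g)"
proof -
  interpret vector_space "scale_fun :: 'b \<Rightarrow> ('a \<Rightarrow>\<^sub>0 'b) \<Rightarrow> _"
    by (rule vector_space_scale_fun)
  show ?thesis
    by (simp add: bilinear_ext_superset[of "Poly_Mapping.keys f" _ "Poly_Mapping.keys g"]
        keys_scale_fun scale_sum_right mult.assoc)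
qed

lemma bilinear_ext_scale_right: "bilinear_ext \<beta> f (scale_fun a g) = scale_fun a (bilinear_ext \<beta> f g)"
proof -
  interpret vector_space "scale_fun :: 'b \<Rightarrow> ('a \<Rightarrow>\<^sub>0 'b) \<Rightarrow> _"
    by (rule vector_space_scale_fun)
  show ?thesis
    by (simp add: bilinear_ext_superset[of "Poly_Mapping.keys f" _ "Poly_Mapping.keys g"]
        keys_scale_fun scale_sum_right mult_ac)
qed

lemma single_add_induct:
  fixes f :: "'i \<Rightarrow>\<^sub>0 'k::comm_monoid_add"
  assumes single: "\<And>i a. P (Poly_Mapping.single i a)"
    and add: "\<And>f g. P f \<Longrightarrow> P g \<Longrightarrow> P (f + g)"
  shows "P f"
proof -
  have "P (\<Sum>i\<in>A. Poly_Mapping.single i (Poly_Mapping.lookup f i))" if "finite A" for A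
    using that
  proof induction
    case empty
    then show ?case
      using single[of undefined 0] by simp
  qed (use assms in auto)
  moreover have "f = (\<Sum>i\<in>Poly_Mapping.keys f. Poly_Mapping.single i (Poly_Mapping.lookup f i))"
    by (rule poly_mapping_eqI) (auto simp: lookup_sum lookup_single when_def in_keys_iff)
  ultimately show ?thesis
    by (metis finite_keys)
qed

lemma lie_algebra_bilinear_ext:
  fixes \<beta> :: "'i \<Rightarrow> 'i \<Rightarrow> 'i \<Rightarrow>\<^sub>0 'k::field"
  assumes self: "\<And>i. \<beta> i i = 0"
    and antisym: "\<And>i j. \<beta> i j = - \<beta> j i"
    and jacobi: "\<And>i j k. bilinear_ext \<beta> (Poly_Mapping.single i 1) (\<beta> j k) +
        bilinear_ext \<beta> (Poly_Mapping.single j 1) (\<beta> k i) +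
        bilinear_ext \<beta> (Poly_Mapping.single k 1) (\<beta> i j) = 0"
  shows "lie_algebra scale_fun (bilinear_ext \<beta>)"
proof -
  interpret vector_space "scale_fun :: 'k \<Rightarrow> ('i \<Rightarrow>\<^sub>0 'k) \<Rightarrow> _"
    by (rule vector_space_scale_fun)
  note lin = bilinear_ext_add_left bilinear_ext_add_right
    bilinear_ext_scale_left bilinear_ext_scale_right
  have anti: "bilinear_ext \<beta> f g + bilinear_ext \<beta> g f = 0" for f g
  proof (induction f rule: single_add_induct)
    case (1 i a)
    show ?case
    proof (induction g rule: single_add_induct)
      case (1 j b)
      show ?case
        using antisym[of i j] by (simp add: bilinear_ext_single mult.commute)
    next
      case (2 f g)
      then show ?case
        by (simp add: lin) (metis (no_types, lifting) add.assoc add.left_commute add_0)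
    qed
  next
    case (2 f g)
    then show ?case
      by (simp add: lin) (metis (no_types, lifting) add.assoc add.left_commute add_0)
  qed
  have alt: "bilinear_ext \<beta> f f = 0" for f
  proof (induction f rule: single_add_induct)
    case (1 i a)
    then show ?case
      by (simp add: bilinear_ext_single self)
  next
    case (2 f g)
    then show ?case
      using anti[of f g] by (simp add: lin add.commute)
  qed
  let ?J = "\<lambda>f g h. bilinear_ext \<beta> f (bilinear_ext \<beta> g h) + bilinear_ext \<beta> g (bilinear_ext \<beta> h f) +
      bilinear_ext \<beta> h (bilinear_ext \<beta> f g)"
  have J_add: "?J (f + f') g h = ?J f g h + ?J f' g h" "?J f (g + g') h = ?J f g h + ?J f g' h"
    "?J f g (h + h') = ?J f g h + ?J f g h'" for f f' g g' h h'
    by (simp_all add: lin ac_simps)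
  have single_conv: "Poly_Mapping.single i a = scale_fun a (Poly_Mapping.single i 1)" for i and a :: 'k
    by (rule poly_mapping_eqI) (simp add: lookup_single when_def)
  have J: "?J f g h = 0" for f g h
  proof (induction f rule: single_add_induct)
    case (1 i a)
    show ?case
    proof (induction g rule: single_add_induct)
      case (1 j b)
      show ?case
      proof (induction h rule: single_add_induct)
        case (1 k c)
        have "?J (Poly_Mapping.single i a) (Poly_Mapping.single j b) (Poly_Mapping.single k c) =
            scale_fun (a * b * c) (bilinear_ext \<beta> (Poly_Mapping.single i 1) (\<beta> j k) +
            bilinear_ext \<beta> (Poly_Mapping.single j 1) (\<beta> k i) +
            bilinear_ext \<beta> (Poly_Mapping.single k 1) (\<beta> i j))"
          by (subst (1 2 3 4 5 6 7 8 9) single_conv)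
            (simp only: lin bilinear_ext_single scale_scale scale_right_distrib mult_ac mult_1_left
              mult_1_right)
        then show ?case
          by (simp add: jacobi)
      next
        case (2 f g)
        then show ?case
          by (simp only: J_add) simp
      qed
    next
      case (2 f g)
      then show ?case
        by (simp only: J_add) simp
    qed
  next
    case (2 f g)
    then show ?case
      by (simp only: J_add) simp
  qed
  show ?thesis
    by unfold_locales (simp_all add: lin alt J)
qed


section \<open>Witt and Virasoro algebras\<close>

definition witt_bracket :: "(int \<Rightarrow>\<^sub>0 'k::field_char_0) \<Rightarrow> (int \<Rightarrow>\<^sub>0 'k) \<Rightarrow> (int \<Rightarrow>\<^sub>0 'k)"
  where "witt_bracket = bilinear_ext (\<lambda>i j. Poly_Mapping.single (i + j) (of_int (j - i)))"

definition positive_witt :: "(int \<Rightarrow>\<^sub>0 'k::field_char_0) set"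
  where "positive_witt = module.span scale_fun {Poly_Mapping.single n 1 | n. n \<ge> 1}"

datatype virasoro_index = Vir_e int | Vir_c

fun virasoro_basis_bracket ::
    "virasoro_index \<Rightarrow> virasoro_index \<Rightarrow> virasoro_index \<Rightarrow>\<^sub>0 'k::field_char_0"
  where
    "virasoro_basis_bracket (Vir_e i) (Vir_e j) =
      Poly_Mapping.single (Vir_e (i + j)) (of_int (j - i)) +
      (if i + j = 0 then Poly_Mapping.single Vir_c (of_int (i ^ 3 - i) / 12) else 0)"
  | "virasoro_basis_bracket Vir_c _ = 0"
  | "virasoro_basis_bracket _ Vir_c = 0"

definition virasoro_bracket ::
    "(virasoro_index \<Rightarrow>\<^sub>0 'k::field_char_0) \<Rightarrow> (virasoro_index \<Rightarrow>\<^sub>0 'k) \<Rightarrow> (virasoro_index \<Rightarrow>\<^sub>0 'k)"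
  where "virasoro_bracket = bilinear_ext virasoro_basis_bracket"

lemma scale_fun_single [simp]:
  "scale_fun a (Poly_Mapping.single i b) = Poly_Mapping.single i (a * b)"
  by (rule poly_mapping_eqI) (simp add: lookup_single when_def)

lemma lie_algebra_witt:
  "lie_algebra (scale_fun :: 'k::field_char_0 \<Rightarrow> (int \<Rightarrow>\<^sub>0 'k) \<Rightarrow> _) witt_bracket"
  unfolding witt_bracket_def
proof (rule lie_algebra_bilinear_ext, goal_cases)
  case (2 i j)
  show ?case
    by (simp add: add.commute flip: single_uminus)
next
  case (3 i j k)
  show ?case
    by (simp add: bilinear_ext_single ac_simps flip: single_add) (simp add: algebra_simps)
qed simp

lemma lie_algebra_virasoro:
  "lie_algebra (scale_fun :: 'k::field_char_0 \<Rightarrow> (virasoro_index \<Rightarrow>\<^sub>0 'k) \<Rightarrow> _) virasoro_bracket"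
  unfolding virasoro_bracket_def
proof (rule lie_algebra_bilinear_ext, goal_cases)
  case (1 i)
  show ?case
    by (cases i) auto
next
  case (2 i j)
  show ?case
  proof (cases i; cases j)
    fix m n assume "i = Vir_e m" "j = Vir_e n"
    then show ?thesis
      by (intro poly_mapping_eqI)
        (auto simp: lookup_add lookup_minus lookup_single when_def eq_neg_iff_add_eq_0[symmetric]
          field_simps)
  qed auto
next
  case (3 i j k)
  interpret vector_space "scale_fun :: 'k \<Rightarrow> (virasoro_index \<Rightarrow>\<^sub>0 'k) \<Rightarrow> _"
    by (rule vector_space_scale_fun)
  have zero: "bilinear_ext virasoro_basis_bracket f (0 :: virasoro_index \<Rightarrow>\<^sub>0 'k) = 0" for f
    by (simp add: bilinear_ext_def)
  have CE: "bilinear_ext virasoro_basis_bracket (Poly_Mapping.single Vir_c a) f = 0"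
    for f :: "virasoro_index \<Rightarrow>\<^sub>0 'k" and a
    by (simp add: bilinear_ext_superset[of "{Vir_c}" _ "Poly_Mapping.keys f"])
  have basis_C: "virasoro_basis_bracket x Vir_c = (0 :: virasoro_index \<Rightarrow>\<^sub>0 'k)" for x
    by (cases x) auto
  show ?case
  proof (cases "i = Vir_c \<or> j = Vir_c \<or> k = Vir_c")
    case True
    then show ?thesis
      by (auto simp: zero CE basis_C)
  next
    case False
    then obtain l m n where ijk: "i = Vir_e l" "j = Vir_e m" "k = Vir_e n"
      by (metis virasoro_index.exhaust)
    have EE: "bilinear_ext virasoro_basis_bracket (Poly_Mapping.single (Vir_e x) 1)
        (virasoro_basis_bracket (Vir_e y) (Vir_e z)) =
      Poly_Mapping.single (Vir_e (x + y + z)) (of_int ((z - y) * (y + z - x)) :: 'k) +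
      (if x + y + z = 0 then Poly_Mapping.single Vir_c (of_int ((z - y) * (x ^ 3 - x)) / 12) else 0)"
      for x y z
      by (auto simp: bilinear_ext_add_right bilinear_ext_single zero basis_C scale_right_distrib
          add.assoc)
    have perm: "m + n + l = l + m + n" "n + l + m = l + m + n"
      by auto
    show ?thesis
    proof (cases "l + m + n = 0")
      case True
      then have n: "n = - l - m"
        by simp
      have "(n - m) * (m + n - l) + (l - n) * (n + l - m) + (m - l) * (l + m - n) = 0"
        "(n - m) * (l ^ 3 - l) + (l - n) * (m ^ 3 - m) + (m - l) * (n ^ 3 - n) = 0"
        unfolding n by (simp_all add: power3_eq_cube algebra_simps)
      then have "(of_int ((n - m) * (m + n - l)) + of_int ((l - n) * (n + l - m)) +
            of_int ((m - l) * (l + m - n)) :: 'k) = 0"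
        "(of_int ((n - m) * (l ^ 3 - l)) / 12 + of_int ((l - n) * (m ^ 3 - m)) / 12 +
            of_int ((m - l) * (n ^ 3 - n)) / 12 :: 'k) = 0"
        by (simp_all only: of_int_add[symmetric] add_divide_distrib[symmetric] of_int_0 div_0)
      with True show ?thesis
        unfolding ijk EE perm
        by (intro poly_mapping_eqI)
          (simp add: lookup_add lookup_single when_def del: of_int_mult of_int_diff of_int_add)
    next
      case False
      have "(n - m) * (m + n - l) + (l - n) * (n + l - m) + (m - l) * (l + m - n) = 0"
        by (simp add: algebra_simps)
      then have "(of_int ((n - m) * (m + n - l)) + of_int ((l - n) * (n + l - m)) +
            of_int ((m - l) * (l + m - n)) :: 'k) = 0"
        by (simp only: of_int_add[symmetric] of_int_0)
      with False show ?thesis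
        unfolding ijk EE perm
        by (intro poly_mapping_eqI)
          (simp add: lookup_add lookup_single when_def del: of_int_mult of_int_diff of_int_add)
    qed
  qed
qed

lemma positive_witt_iff: "f \<in> positive_witt \<longleftrightarrow> Poly_Mapping.keys f \<subseteq> {1..}"
proof -
  interpret vector_space "scale_fun :: 'a \<Rightarrow> (int \<Rightarrow>\<^sub>0 'a) \<Rightarrow> _"
    by (rule vector_space_scale_fun)
  let ?B = "{Poly_Mapping.single n (1::'a) | n :: int. n \<ge> 1}"
  have "f = (\<Sum>i\<in>Poly_Mapping.keys f. scale_fun (Poly_Mapping.lookup f i) (Poly_Mapping.single i 1))"
    by (rule poly_mapping_eqI) (auto simp: lookup_sum lookup_single when_def in_keys_iff)
  moreover have "(\<Sum>i\<in>Poly_Mapping.keys f. scale_fun (Poly_Mapping.lookup f i) (Poly_Mapping.single i 1)) \<in> span ?B"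
    if "Poly_Mapping.keys f \<subseteq> {1..}"
    using that by (intro span_sum span_scale span_base) auto
  moreover have "span ?B \<subseteq> {f. Poly_Mapping.keys f \<subseteq> {1..}}"
  proof (rule span_minimal)
    show "subspace {f :: int \<Rightarrow>\<^sub>0 'a. Poly_Mapping.keys f \<subseteq> {1..}}"
      using keys_scale_fun keys_add by (fastforce simp: subspace_def)
  qed auto
  ultimately show ?thesis
    unfolding positive_witt_def by auto
qed

lemma lie_subalgebra_positive_witt:
  "lie_algebra.lie_subalgebra scale_fun witt_bracket (positive_witt :: (int \<Rightarrow>\<^sub>0 'k::field_char_0) set)"
proof -
  interpret lie_algebra "scale_fun :: 'k \<Rightarrow> (int \<Rightarrow>\<^sub>0 'k) \<Rightarrow> _" witt_bracket
    by (rule lie_algebra_witt)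
  have sub: "subspace (positive_witt :: (int \<Rightarrow>\<^sub>0 'k) set)"
    unfolding positive_witt_def by (rule subspace_span)
  have "witt_bracket f g \<in> positive_witt" if "f \<in> positive_witt" "g \<in> positive_witt"
    for f g :: "int \<Rightarrow>\<^sub>0 'k"
    unfolding witt_bracket_def bilinear_ext_def
    using that by (intro subspace_sum[OF sub]) (fastforce simp: positive_witt_iff)
  with sub show ?thesis
    by (simp add: lie_subalgebra_def)
qed

end

theory Submission
  imports Defs "HOL-Library.List_Lexorder" "HOL-Computational_Algebra.Polynomial"
begin

text \<open>
  The proof bounds the length of a strictly ascending chain above its first step by a growth
  count, in the spirit of Gelfand--Kirillov dimension, and it does so for all three algebras at
  once: each is generated by elements \<open>e\<^sub>i\<close>, with \<open>i\<close> in \<open>\<int>\<close> or in \<open>{1, 2, \<dots>}\<close>, over a central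
  subring \<open>Z\<close>, subject to \<open>[e\<^sub>i, e\<^sub>j] = (j - i) e\<^sub>i\<^sub>+\<^sub>j + \<omega>\<^sub>i\<^sub>j\<close> with \<open>\<omega>\<^sub>i\<^sub>j\<close> in \<open>Z\<close>.

  \<^item> A long chain forces fast growth (\<open>independent_chain\<close>). Let \<open>Q\<^sub>0 \<subset> Q\<^sub>1 \<subset> \<dots> \<subset> Q\<^sub>d\<close> be completely
    prime ideals that meet \<open>Z\<close> in the same prime, and pick \<open>a\<^sub>i\<close> in \<open>Q\<^sub>i\<^sub>+\<^sub>1\<close> outside \<open>Q\<^sub>i\<close>. Then the ordered
    monomials in \<open>a\<^sub>0, \<dots>, a\<^sub>d\<^sub>-\<^sub>1\<close> are independent over \<open>Z\<close> modulo \<open>Q\<^sub>0\<close>: a relation, read modulo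
    \<open>Q\<^sub>1\<close>, loses all terms divisible by \<open>a\<^sub>0\<close>, so the other coefficients vanish by induction, and
    \<open>a\<^sub>0\<close> can be cancelled from what is left. Hence there are \<open>n\<^sup>d\<close> independent elements whose
    size is linear in \<open>n\<close>.

  \<^item> A proper quotient grows polynomially (\<open>leading_word\<close>, \<open>card_normal_words\<close>).
    Let \<open>f\<close> lie in \<open>Q\<^sub>1\<close> but not in \<open>Q\<^sub>0\<close>, written as a combination of words of length at most \<open>k\<close>
    with letters in \<open>[-R, R]\<close>. Commuting \<open>f\<close> with \<open>e\<^bsub>n\<^sub>1\<^esub>, \<dots>, e\<^bsub>n\<^sub>k\<^esub>\<close> for large \<open>n\<^sub>i\<close> polarizes it: each
    letter of a longest word absorbs one shift, and the terms in which some letter absorbs none are of lower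
    order. For a suitable order the leading term is \<open>e\<^bsub>a\<^sub>1 + n\<^sub>1\<^esub> \<dots> e\<^bsub>a\<^sub>k + n\<^sub>k\<^esub>\<close> with
    \<open>(a\<^sub>1, \<dots>, a\<^sub>k)\<close> depending on \<open>f\<close> alone; its coefficient is a nonzero integer multiple of a
    coefficient of \<open>f\<close>, which is where characteristic zero enters. As the \<open>n\<^sub>i\<close> vary, every product of
    \<open>k\<close> letters \<open>\<ge> 3R + 1\<close> is a leading term, and by the symmetry \<open>e\<^sub>i \<mapsto> -e\<^sub>-\<^sub>i\<close> so is every product of
    \<open>k\<close> letters \<open>\<le> -(3R + 1)\<close>. So modulo \<open>Q\<^sub>1\<close> everything reduces, up to nonzero factors in \<open>Z\<close>,
    to sorted words with fewer than \<open>k\<close> large letters of either sign. There are only polynomially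
    many of these of size at most \<open>N\<close>, with a degree \<open>D\<close> that depends on \<open>k\<close> and \<open>R\<close>.

  A chain with \<open>D + 1\<close> further steps above \<open>Q\<^sub>1\<close> contradicts these two counts
  (\<open>no_strict_chain\<close>). For \<open>Vir\<close> the ring \<open>Z\<close> is \<open>K[c]\<close>; the traces of the \<open>Q\<^sub>n\<close> on it are an ascending
  chain of ideals of a principal ideal domain, hence eventually constant, and working up to torsion over
  \<open>K[c]\<close> treats a transcendental and an algebraic \<open>c\<close> alike.
\<close>

section \<open>Two-sided and completely prime ideals as subsets\<close>

text \<open>The chain argument runs in a ring given by a type class, where arithmetic is convenient; ideals
  are subsets of the type, and complete primeness is stated elementwise.\<close>

definition two_sided :: "'a::ring_1 set \<Rightarrow> bool"
  where "two_sided I \<longleftrightarrow>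
    0 \<in> I \<and> (\<forall>x\<in>I. \<forall>y\<in>I. x + y \<in> I) \<and> (\<forall>x\<in>I. \<forall>a. a * x \<in> I \<and> x * a \<in> I)"

definition completely_prime :: "'a::ring_1 set \<Rightarrow> bool"
  where "completely_prime I \<longleftrightarrow> two_sided I \<and> 1 \<notin> I \<and> (\<forall>x y. x * y \<in> I \<longrightarrow> x \<in> I \<or> y \<in> I)"

lemma completely_prime_two_sided: "completely_prime I \<Longrightarrow> two_sided I"
  by (simp add: completely_prime_def)

lemma completely_prime_mult_iff: "completely_prime I \<Longrightarrow> x * y \<in> I \<longleftrightarrow> x \<in> I \<or> y \<in> I"
  by (auto simp: completely_prime_def two_sided_def)

lemma two_sided_zero: "two_sided I \<Longrightarrow> 0 \<in> I"
  and two_sided_add: "two_sided I \<Longrightarrow> x \<in> I \<Longrightarrow> y \<in> I \<Longrightarrow> x + y \<in> I"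
  and two_sided_mult_left: "two_sided I \<Longrightarrow> x \<in> I \<Longrightarrow> a * x \<in> I"
  and two_sided_mult_right: "two_sided I \<Longrightarrow> x \<in> I \<Longrightarrow> x * a \<in> I"
  by (auto simp: two_sided_def)

lemma two_sided_uminus: "two_sided I \<Longrightarrow> x \<in> I \<Longrightarrow> - x \<in> I"
  using two_sided_mult_left[of I x "-1"] by simp

lemma two_sided_diff: "two_sided I \<Longrightarrow> x \<in> I \<Longrightarrow> y \<in> I \<Longrightarrow> x - y \<in> I"
  using two_sided_add[of I x "- y"] two_sided_uminus[of I y] by simp

lemma two_sided_sum: "two_sided I \<Longrightarrow> (\<And>i. i \<in> A \<Longrightarrow> f i \<in> I) \<Longrightarrow> sum f A \<in> I"
  by (induction A rule: infinite_finite_induct) (auto intro: two_sided_zero two_sided_add)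

lemma two_sided_cong:
  assumes "two_sided I" "x - y \<in> I"
  shows "x \<in> I \<longleftrightarrow> y \<in> I"
  using two_sided_add[OF assms(1), of "x - y" y] two_sided_diff[OF assms(1), of x "x - y"] assms(2)
  by auto

section \<open>Combinations with central coefficients modulo an ideal\<close>

text \<open>The scalars form a commutative ring rather than a field because the central element of the Virasoro
  algebra may be transcendental modulo every ideal of the chain. All counting has to be done over
  the ring that it generates.\<close>

locale central_scalars =
  fixes \<kappa> :: "'z::comm_ring_1 \<Rightarrow> 'a::ring_1"
  assumes \<kappa>_add: "\<kappa> (x + y) = \<kappa> x + \<kappa> y"
    and \<kappa>_mult: "\<kappa> (x * y) = \<kappa> x * \<kappa> y"
    and \<kappa>_one: "\<kappa> 1 = 1"
    and \<kappa>_central: "\<kappa> x * a = a * \<kappa> x"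
begin

lemma \<kappa>_zero [simp]: "\<kappa> 0 = 0"
  using \<kappa>_add[of 0 0] by simp

lemma \<kappa>_uminus: "\<kappa> (- x) = - \<kappa> x"
  using \<kappa>_add[of x "- x"] by (simp add: eq_neg_iff_add_eq_0 add.commute)

lemma \<kappa>_diff: "\<kappa> (x - y) = \<kappa> x - \<kappa> y"
  using \<kappa>_add[of x "- y"] by (simp add: \<kappa>_uminus)

lemma \<kappa>_of_nat: "\<kappa> (of_nat n) = of_nat n"
  by (induction n) (simp_all add: \<kappa>_add \<kappa>_one)

lemma \<kappa>_of_int: "\<kappa> (of_int n) = of_int n"
  by (cases n) (simp_all add: \<kappa>_of_nat \<kappa>_diff \<kappa>_one \<kappa>_uminus \<kappa>_add)

lemma \<kappa>_sum: "\<kappa> (sum f A) = (\<Sum>i\<in>A. \<kappa> (f i))"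
  by (induction A rule: infinite_finite_induct) (simp_all add: \<kappa>_add)

lemma \<kappa>_left: "a * (\<kappa> x * b) = \<kappa> x * (a * b)"
  by (metis \<kappa>_central mult.assoc)

text \<open>Starting from the ideal instead of from zero makes \<open>x \<in> lspan I B\<close> say that
  \<open>x\<close> is congruent to a combination of \<open>B\<close> modulo \<open>I\<close>, so
  that a whole reduction can be carried out without naming the error terms.\<close>

inductive_set lspan :: "'a set \<Rightarrow> 'a set \<Rightarrow> 'a set" for I B where
  ideal: "x \<in> I \<Longrightarrow> x \<in> lspan I B"
| add: "x \<in> lspan I B \<Longrightarrow> b \<in> B \<Longrightarrow> x + \<kappa> z * b \<in> lspan I B"

lemma lspan_mono: "x \<in> lspan I B \<Longrightarrow> I \<subseteq> J \<Longrightarrow> B \<subseteq> C \<Longrightarrow> x \<in> lspan J C"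
  by (induction rule: lspan.induct) (auto intro: lspan.intros)

context
  fixes I :: "'a set"
  assumes I: "two_sided I"
begin

lemma lspan_zero: "0 \<in> lspan I B"
  by (simp add: lspan.ideal I two_sided_zero)

lemma lspan_base: "b \<in> B \<Longrightarrow> \<kappa> z * b \<in> lspan I B"
  using lspan.add[OF lspan_zero] by simp

lemma lspan_base1: "b \<in> B \<Longrightarrow> b \<in> lspan I B"
  using lspan_base[of b B 1] by (simp add: \<kappa>_one)

lemma lspan_add: "x \<in> lspan I B \<Longrightarrow> y \<in> lspan I B \<Longrightarrow> x + y \<in> lspan I B"
proof (induction rule: lspan.induct)
  case (ideal x)
  show ?case
    using ideal(2)
  proof (induction rule: lspan.induct)
    case (ideal y)
    then show ?case
      using \<open>x \<in> I\<close> by (simp add: lspan.ideal two_sided_add[OF I])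
  next
    case (add y b z)
    then show ?case
      using lspan.add[of "x + y" I B b z] by (simp add: add.assoc)
  qed
next
  case (add x b z)
  then show ?case
    using lspan.add[of "x + y" I B b z] by (simp add: algebra_simps)
qed

lemma lspan_scale: "x \<in> lspan I B \<Longrightarrow> \<kappa> z * x \<in> lspan I B"
proof (induction rule: lspan.induct)
  case (add x b z')
  then show ?case
    using lspan.add[of "\<kappa> z * x" I B b "z * z'"] by (simp add: algebra_simps \<kappa>_mult)
qed (auto intro: lspan.ideal two_sided_mult_left[OF I])

lemma lspan_uminus: "x \<in> lspan I B \<Longrightarrow> - x \<in> lspan I B"
  using lspan_scale[of x B "-1"] by (simp add: \<kappa>_uminus \<kappa>_one)

lemma lspan_diff: "x \<in> lspan I B \<Longrightarrow> y \<in> lspan I B \<Longrightarrow> x - y \<in> lspan I B"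
  using lspan_add[of x B "- y"] lspan_uminus by simp

lemma lspan_sum: "(\<And>i. i \<in> A \<Longrightarrow> f i \<in> lspan I B) \<Longrightarrow> sum f A \<in> lspan I B"
  by (induction A rule: infinite_finite_induct) (auto intro: lspan_zero lspan_add)

lemma lspan_sum_list: "(\<And>i. i \<in> set A \<Longrightarrow> f i \<in> lspan I B) \<Longrightarrow> (\<Sum>i\<leftarrow>A. f i) \<in> lspan I B"
  by (induction A) (auto intro: lspan_zero lspan_add)

lemma lspan_bind:
  assumes "x \<in> lspan I B" "\<And>b. b \<in> B \<Longrightarrow> b \<in> lspan I C"
  shows "x \<in> lspan I C"
  using assms(1) by induction (auto intro: lspan.ideal lspan_add lspan_scale assms(2))

lemma lspan_additive_image:
  assumes "x \<in> lspan I B"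
    and "\<And>x. x \<in> I \<Longrightarrow> h x \<in> lspan I C"
    and "\<And>x y. h (x + y) = h x + h y" "\<And>z x. h (\<kappa> z * x) = \<kappa> z * h x"
    and "\<And>b. b \<in> B \<Longrightarrow> h b \<in> lspan I C"
  shows "h x \<in> lspan I C"
  using assms(1) by induction (auto simp: assms(3,4) intro: lspan_add lspan_scale assms(2,5))

lemma lspan_mult:
  assumes "x \<in> lspan I B" "y \<in> lspan I C"
    and BC: "\<And>b c. b \<in> B \<Longrightarrow> c \<in> C \<Longrightarrow> b * c \<in> lspan I D"
  shows "x * y \<in> lspan I D"
  using assms(1)
proof (rule lspan_additive_image)
  fix b assume b: "b \<in> B"
  show "b * y \<in> lspan I D"
    using assms(2) by (rule lspan_additive_image)
      (auto simp: distrib_left \<kappa>_left BC b intro: lspan.ideal two_sided_mult_left[OF I])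
qed (auto simp: distrib_right mult.assoc intro: lspan.ideal two_sided_mult_right[OF I])

lemma lspan_insert_cases:
  assumes "x \<in> lspan I (insert b B)"
  shows "\<exists>t. x - \<kappa> t * b \<in> lspan I B"
  using assms
proof induction
  case (ideal x)
  then show ?case
    by (intro exI[of _ 0]) (simp add: lspan.ideal)
next
  case (add x b' z)
  then obtain t where t: "x - \<kappa> t * b \<in> lspan I B"
    by blast
  show ?case
  proof (cases "b' = b")
    case True
    then show ?thesis
      using t by (intro exI[of _ "t + z"]) (simp add: \<kappa>_add algebra_simps)
  next
    case False
    then show ?thesis
      using lspan.add[OF t, of b' z] add(2)
      by (intro exI[of _ t]) (simp add: algebra_simps)
  qed
qed

lemma lspan_empty: "lspan I {} = I"
proof (intro equalityI subsetI)
  show "x \<in> I" if "x \<in> lspan I {}" for x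
    using that by induction auto
qed (rule lspan.ideal)

text \<open>The coefficients are indexed by \<open>G\<close> and not by the values \<open>h g\<close>: distinct
  words may have equal values, while a leading word has to be singled out among the words
  themselves.\<close>

lemma lspan_finite_sum:
  assumes "x \<in> lspan I (h ` G)"
  shows "\<exists>\<Gamma> z. finite \<Gamma> \<and> \<Gamma> \<subseteq> G \<and> x - (\<Sum>g\<in>\<Gamma>. \<kappa> (z g) * h g) \<in> I"
  using assms
proof induction
  case (ideal x)
  then show ?case
    by (intro exI[of _ "{}"]) auto
next
  case (add x b z')
  then obtain \<Gamma> z where \<Gamma>: "finite \<Gamma>" "\<Gamma> \<subseteq> G" "x - (\<Sum>g\<in>\<Gamma>. \<kappa> (z g) * h g) \<in> I"
    by blast
  obtain g where g: "g \<in> G" "b = h g"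
    using add by auto
  define y where "y = (\<lambda>i. (if i \<in> \<Gamma> then z i else 0) + (if i = g then z' else 0))"
  have "(\<Sum>i\<in>insert g \<Gamma>. \<kappa> (y i) * h i) =
      (\<Sum>i\<in>insert g \<Gamma>. if i \<in> \<Gamma> then \<kappa> (z i) * h i else 0) +
      (\<Sum>i\<in>insert g \<Gamma>. if i = g then \<kappa> z' * h i else 0)"
    unfolding sum.distrib[symmetric]
    by (intro sum.cong) (auto simp: y_def \<kappa>_add distrib_right)
  also have "(\<Sum>i\<in>insert g \<Gamma>. if i \<in> \<Gamma> then \<kappa> (z i) * h i else 0) = (\<Sum>i\<in>\<Gamma>. \<kappa> (z i) * h i)"
    using \<Gamma>(1) by (intro sum.mono_neutral_cong_right) auto
  also have "(\<Sum>i\<in>insert g \<Gamma>. if i = g then \<kappa> z' * h i else 0) = \<kappa> z' * b"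
    using \<Gamma>(1) g by (subst sum.delta) auto
  finally have "x + \<kappa> z' * b - (\<Sum>i\<in>insert g \<Gamma>. \<kappa> (y i) * h i) = x - (\<Sum>g\<in>\<Gamma>. \<kappa> (z g) * h g)"
    by simp
  then show ?case
    using \<Gamma> g(1) by (metis finite.insertI insert_subset)
qed

end

section \<open>Rank up to torsion\<close>

text \<open>Leading coefficients lie outside the ideal but need not be invertible, so reductions only determine
  elements up to such a factor. This is the span after passing to the fraction field of the image of
  the scalars, without leaving the ring.\<close>

definition tspan :: "'a set \<Rightarrow> 'a set \<Rightarrow> 'a set"
  where "tspan I B = {x. \<exists>s. \<kappa> s \<notin> I \<and> \<kappa> s * x \<in> lspan I B}"

context
  fixes I :: "'a set"
  assumes I: "completely_prime I"
begin

lemma scalar_notin_mult: "\<kappa> s \<notin> I \<Longrightarrow> \<kappa> t \<notin> I \<Longrightarrow> \<kappa> (s * t) \<notin> I"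
  using I by (auto simp: \<kappa>_mult completely_prime_def)

lemma scalar_one_notin: "\<kappa> 1 \<notin> I"
  using I by (simp add: \<kappa>_one completely_prime_def)

lemma tspan_lspan: "x \<in> lspan I B \<Longrightarrow> x \<in> tspan I B"
  using scalar_one_notin by (auto simp: tspan_def \<kappa>_one intro!: exI[of _ 1])

lemma tspan_scale: "x \<in> tspan I B \<Longrightarrow> \<kappa> z * x \<in> tspan I B"
  unfolding tspan_def using lspan_scale[OF completely_prime_two_sided[OF I]]
  by (auto simp: \<kappa>_left[of "\<kappa> _" z])

lemma tspan_add:
  assumes "x \<in> tspan I B" "y \<in> tspan I B"
  shows "x + y \<in> tspan I B"
proof -
  obtain s t where st: "\<kappa> s \<notin> I" "\<kappa> s * x \<in> lspan I B" "\<kappa> t \<notin> I" "\<kappa> t * y \<in> lspan I B"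
    using assms by (auto simp: tspan_def)
  have "\<kappa> (s * t) * (x + y) = \<kappa> t * (\<kappa> s * x) + \<kappa> s * (\<kappa> t * y)"
    by (simp add: distrib_left mult.commute[of t s] flip: mult.assoc \<kappa>_mult)
  then show ?thesis
    unfolding tspan_def using scalar_notin_mult[OF st(1,3)]
      lspan_add[OF _ lspan_scale[OF _ st(2)] lspan_scale[OF _ st(4)]] completely_prime_two_sided[OF I]
    by auto
qed

lemma tspan_bind:
  assumes "x \<in> lspan I B" "\<And>b. b \<in> B \<Longrightarrow> b \<in> tspan I C"
  shows "x \<in> tspan I C"
  using assms(1)
  by induction (simp_all add: tspan_lspan lspan.ideal tspan_add tspan_scale assms(2))

lemma tspan_cancel: "\<kappa> s \<notin> I \<Longrightarrow> \<kappa> s * x \<in> tspan I B \<Longrightarrow> x \<in> tspan I B"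
proof -
  assume s: "\<kappa> s \<notin> I" "\<kappa> s * x \<in> tspan I B"
  then obtain t where t: "\<kappa> t \<notin> I" "\<kappa> t * (\<kappa> s * x) \<in> lspan I B"
    by (auto simp: tspan_def)
  then have "\<kappa> (t * s) * x \<in> lspan I B" "\<kappa> (t * s) \<notin> I"
    using s scalar_notin_mult by (simp_all add: \<kappa>_mult mult.assoc)
  then show ?thesis
    by (auto simp: tspan_def)
qed

text \<open>Dependence of more vectors than generators, by fraction-free elimination: solve one vector with a
  nonzero coordinate along \<open>b\<close>, cross-multiply to clear that coordinate from the
  others, and recurse on the remaining generators.\<close>

lemma rank_bound:
  assumes "finite B" "finite J" "card B < card J" "\<And>j. j \<in> J \<Longrightarrow> v j \<in> tspan I B"
  shows "\<exists>\<mu>. (\<exists>j\<in>J. \<kappa> (\<mu> j) \<notin> I) \<and> (\<Sum>j\<in>J. \<kappa> (\<mu> j) * v j) \<in> I"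
  using assms
proof (induction B arbitrary: J v rule: finite_induct)
  case empty
  have "J \<noteq> {}"
    using empty(2) by auto
  then obtain j where j: "j \<in> J"
    by blast
  obtain s where s: "\<kappa> s \<notin> I" "\<kappa> s * v j \<in> I"
    using empty(3)[OF j] unfolding tspan_def lspan_empty[OF completely_prime_two_sided[OF I]] by blast
  define \<mu> where "\<mu> = (\<lambda>i. if i = j then s else 0)"
  have "(\<Sum>i\<in>J. \<kappa> (\<mu> i) * v i) = (\<Sum>i\<in>J. if i = j then \<kappa> s * v i else 0)"
    by (intro sum.cong) (auto simp: \<mu>_def)
  also have "\<dots> = \<kappa> s * v j"
    using j empty(1) by (subst sum.delta) auto
  finally show ?case
    using j s by (intro exI[of _ \<mu>]) (auto simp: \<mu>_def)
next
  case (insert b B)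
  note I2 = completely_prime_two_sided[OF I]
  have "\<exists>s t. \<kappa> s \<notin> I \<and> \<kappa> s * v j - \<kappa> t * b \<in> lspan I B" if j: "j \<in> J" for j
  proof -
    obtain s where s: "\<kappa> s \<notin> I" "\<kappa> s * v j \<in> lspan I (insert b B)"
      using insert.prems(3)[OF j] unfolding tspan_def by blast
    then show ?thesis
      using lspan_insert_cases[OF I2 s(2)] by blast
  qed
  then obtain s t where st: "\<And>j. j \<in> J \<Longrightarrow> \<kappa> (s j) \<notin> I"
    "\<And>j. j \<in> J \<Longrightarrow> \<kappa> (s j) * v j - \<kappa> (t j) * b \<in> lspan I B"
    by metis
  show ?case
  proof (cases "\<forall>j\<in>J. \<kappa> (t j) \<in> I")
    case True
    have "v j \<in> tspan I B" if j: "j \<in> J" for j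
    proof -
      have "\<kappa> (t j) * b \<in> I"
        using True j two_sided_mult_right[OF I2] by blast
      then have "\<kappa> (s j) * v j \<in> lspan I B"
        using lspan_add[OF I2 st(2)[OF j] lspan.ideal] by fastforce
      then show ?thesis
        using st(1)[OF j] by (auto simp: tspan_def)
    qed
    moreover have "card B < card J"
      using insert.prems(2) insert.hyps by simp
    ultimately show ?thesis
      using insert.IH[OF insert.prems(1)] by blast
  next
    case False
    then obtain j0 where j0: "j0 \<in> J" "\<kappa> (t j0) \<notin> I"
      by blast
    \<comment> \<open>Cross-multiplication with the pivot \<open>j0\<close>.\<close>
    define w where "w j = \<kappa> (t j0 * s j) * v j - \<kappa> (t j * s j0) * v j0" for j
    have "w j \<in> lspan I B" if "j \<in> J" for j
    proof -
      have "w j = \<kappa> (t j0) * (\<kappa> (s j) * v j - \<kappa> (t j) * b) - \<kappa> (t j) * (\<kappa> (s j0) * v j0 - \<kappa> (t j0) * b)"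
        by (simp add: w_def right_diff_distrib mult.commute[of "t j" "t j0"]
            flip: mult.assoc \<kappa>_mult)
      then show ?thesis
        using st(2)[OF that] st(2)[OF j0(1)] by (metis lspan_diff[OF I2] lspan_scale[OF I2])
    qed
    moreover have "card B < card (J - {j0})"
      using insert.prems(1,2) insert.hyps j0 by simp
    ultimately obtain \<mu> where \<mu>: "\<exists>j\<in>J-{j0}. \<kappa> (\<mu> j) \<notin> I" "(\<Sum>j\<in>J-{j0}. \<kappa> (\<mu> j) * w j) \<in> I"
      using insert.IH[of "J - {j0}" w] insert.prems(1) tspan_lspan by blast
    define \<nu> where "\<nu> j = (if j = j0 then - (\<Sum>j\<in>J-{j0}. \<mu> j * (t j * s j0)) else \<mu> j * (t j0 * s j))" for j
    have "(\<Sum>j\<in>J. \<kappa> (\<nu> j) * v j) = \<kappa> (\<nu> j0) * v j0 + (\<Sum>j\<in>J-{j0}. \<kappa> (\<nu> j) * v j)"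
      using j0 insert.prems(1) by (simp add: sum.remove)
    also have "(\<Sum>j\<in>J-{j0}. \<kappa> (\<nu> j) * v j) = (\<Sum>j\<in>J-{j0}. \<kappa> (\<mu> j) * w j + \<kappa> (\<mu> j * (t j * s j0)) * v j0)"
      by (intro sum.cong) (simp_all add: \<nu>_def w_def right_diff_distrib flip: mult.assoc \<kappa>_mult)
    also have "\<dots> = (\<Sum>j\<in>J-{j0}. \<kappa> (\<mu> j) * w j) + (\<Sum>j\<in>J-{j0}. \<kappa> (\<mu> j * (t j * s j0))) * v j0"
      by (simp add: sum.distrib sum_distrib_right)
    also have "(\<Sum>j\<in>J-{j0}. \<kappa> (\<mu> j * (t j * s j0))) = \<kappa> (\<Sum>j\<in>J-{j0}. \<mu> j * (t j * s j0))"
      by (simp add: \<kappa>_sum)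
    finally have "(\<Sum>j\<in>J. \<kappa> (\<nu> j) * v j) \<in> I"
      using \<mu>(2) by (simp add: \<nu>_def \<kappa>_uminus)
    moreover obtain j where "j \<in> J" "j \<noteq> j0" "\<kappa> (\<mu> j) \<notin> I"
      using \<mu> by blast
    then have "\<kappa> (\<nu> j) \<notin> I"
      using scalar_notin_mult[OF _ scalar_notin_mult[OF j0(2) st(1)]] by (simp add: \<nu>_def)
    ultimately show ?thesis
      using \<open>j \<in> J\<close> by blast
  qed
qed

end

section \<open>Independent monomials from a chain of ideals\<close>

text \<open>The first element stands on the right, where it can be cancelled from a relation after the terms
  without it are known to vanish.\<close>

fun monomial :: "'a list \<Rightarrow> nat list \<Rightarrow> 'a" where
  "monomial (a # as) (k # ks) = monomial as ks * a ^ k"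
| "monomial _ _ = 1"

definition exponents :: "nat \<Rightarrow> nat \<Rightarrow> nat list set"
  where "exponents n d = {ks. set ks \<subseteq> {..<n} \<and> length ks = d}"

lemma finite_exponents: "finite (exponents n d)"
  unfolding exponents_def by (rule finite_lists_length_eq) simp

lemma card_exponents: "card (exponents n d) = n ^ d"
  unfolding exponents_def by (subst card_lists_length_eq) simp_all

lemma sum_exponents_Suc:
  "(\<Sum>ks\<in>exponents n (Suc d). f ks) = (\<Sum>k<n. \<Sum>ks\<in>exponents n d. f (k # ks))"
proof -
  have eq: "exponents n (Suc d) = (\<lambda>(k, ks). k # ks) ` ({..<n} \<times> exponents n d)"
    by (auto simp: exponents_def length_Suc_conv image_iff)
  have "(\<Sum>ks\<in>exponents n (Suc d). f ks) = (\<Sum>(k, ks)\<in>{..<n} \<times> exponents n d. f (k # ks))"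
    unfolding eq by (subst sum.reindex) (auto simp: inj_on_def case_prod_unfold)
  then show ?thesis
    by (simp add: sum.cartesian_product)
qed

definition independent :: "'a set \<Rightarrow> nat \<Rightarrow> 'a list \<Rightarrow> bool"
  where "independent I n as \<longleftrightarrow> (\<forall>\<mu>. (\<Sum>ks\<in>exponents n (length as). \<kappa> (\<mu> ks) * monomial as ks) \<in> I \<longrightarrow>
    (\<forall>ks\<in>exponents n (length as). \<kappa> (\<mu> ks) \<in> I))"

text \<open>Modulo \<open>J\<close> only the constant term of \<open>\<Sum> X\<^sub>k a\<^sup>k\<close>
  survives, so it lies in \<open>J\<close>, and then in \<open>I\<close> by the assumption on the
  coefficients. What remains is a multiple of \<open>a\<close>, which may be cancelled because
  \<open>I\<close> is completely prime and \<open>a \<notin> I\<close>.\<close>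

lemma power_sum_in_prime:
  assumes I: "completely_prime I" and J: "two_sided J" "I \<subseteq> J" and a: "a \<in> J" "a \<notin> I"
    and X: "\<And>k. k < n \<Longrightarrow> X k \<in> J \<Longrightarrow> X k \<in> I"
    and sum: "(\<Sum>k<n. X k * a ^ k) \<in> I"
  shows "\<forall>k<n. X k \<in> I"
  using X sum
proof (induction n arbitrary: X)
  case (Suc n)
  have split: "(\<Sum>k<Suc n. X k * a ^ k) = X 0 + (\<Sum>k<n. X (Suc k) * a ^ k) * a"
    by (simp add: sum.lessThan_Suc_shift sum_distrib_right power_commutes mult.assoc del: sum.lessThan_Suc)
  have "X 0 + (\<Sum>k<n. X (Suc k) * a ^ k) * a \<in> J"
    using Suc.prems(2) J(2) unfolding split by blast
  then have "X 0 \<in> J"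
    using two_sided_diff[OF J(1) _ two_sided_mult_left[OF J(1) a(1), of "\<Sum>k<n. X (Suc k) * a ^ k"]]
    by fastforce
  then have X0: "X 0 \<in> I"
    using Suc.prems(1)[of 0] by blast
  have "(\<Sum>k<n. X (Suc k) * a ^ k) * a \<in> I"
    using Suc.prems(2) two_sided_diff[OF completely_prime_two_sided[OF I] _ X0] unfolding split by fastforce
  then have "(\<Sum>k<n. X (Suc k) * a ^ k) \<in> I"
    using completely_prime_mult_iff[OF I] a(2) by blast
  then have "\<forall>k<n. X (Suc k) \<in> I"
    using Suc.IH[of "\<lambda>k. X (Suc k)"] Suc.prems(1) by blast
  with X0 show ?case
    using less_Suc_eq_0_disj by auto
qed simp

lemma independent_Cons:
  assumes I: "completely_prime I" and J: "two_sided J" "I \<subseteq> J" and a: "a \<in> J" "a \<notin> I"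
    and scalars: "\<And>s. \<kappa> s \<in> J \<Longrightarrow> \<kappa> s \<in> I"
    and ind: "independent J n as"
  shows "independent I n (a # as)"
  unfolding independent_def
proof (intro allI impI)
  fix \<mu> assume sum: "(\<Sum>ks\<in>exponents n (length (a # as)). \<kappa> (\<mu> ks) * monomial (a # as) ks) \<in> I"
  define X where "X k = (\<Sum>ks\<in>exponents n (length as). \<kappa> (\<mu> (k # ks)) * monomial as ks)" for k
  have zero: "\<forall>ks\<in>exponents n (length as). \<kappa> (\<mu> (k # ks)) \<in> I" if "X k \<in> J" for k
    using ind[unfolded independent_def, rule_format, of "\<lambda>ks. \<mu> (k # ks)"] that scalars
    unfolding X_def by blast
  have "\<forall>k<n. X k \<in> I"
  proof (rule power_sum_in_prime[OF I J a])
    show "X k \<in> I" if "X k \<in> J" for k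
      unfolding X_def using zero[OF that]
      by (intro two_sided_sum completely_prime_two_sided[OF I] two_sided_mult_right[OF completely_prime_two_sided[OF I]]) blast
    show "(\<Sum>k<n. X k * a ^ k) \<in> I"
      using sum by (simp add: sum_exponents_Suc X_def sum_distrib_right mult.assoc)
  qed
  then have "\<forall>k<n. \<forall>ks\<in>exponents n (length as). \<kappa> (\<mu> (k # ks)) \<in> I"
    using zero J(2) by blast
  then show "\<forall>ks\<in>exponents n (length (a # as)). \<kappa> (\<mu> ks) \<in> I"
    by (auto simp: exponents_def length_Suc_conv)
qed

text \<open>Every strict step of a chain contributes one more independent element. The common trace on the
  scalars guarantees that a coefficient that vanishes modulo a later ideal of the chain vanishes
  modulo the first one.\<close>

lemma independent_chain:
  assumes Q: "\<And>m. completely_prime (Q m)" "\<And>m. Q m \<subseteq> Q (Suc m)"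
    and scalars: "\<And>m s. \<kappa> s \<in> Q m \<longleftrightarrow> \<kappa> s \<in> Q 0"
    and a: "\<And>m. a m \<in> Q (Suc m) - Q m"
  shows "independent (Q m) n (map a [m..<m+d])"
proof (induction d arbitrary: m)
  case 0
  show ?case
    by (simp add: independent_def exponents_def conj_commute cong: conj_cong)
next
  case (Suc d)
  have "independent (Q m) n (a m # map a [Suc m..<Suc m+d])"
    using a[of m] scalars by (intro independent_Cons[OF Q(1) _ Q(2) _ _ _ Suc] completely_prime_two_sided[OF Q(1)]) auto
  moreover have "[m..<m + Suc d] = m # [Suc m..<Suc m + d]"
    using upt_conv_Cons[of m "m + Suc d"] by simp
  ultimately show ?case
    by (simp del: upt_Suc)
qed

end

section \<open>Words in the generators\<close>

text \<open>The defining relations are required only modulo \<open>I\<close>. The index set \<open>S\<close>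
  distinguishes the full Witt algebra from its positive part, and \<open>\<omega>\<close> is the
  central extension cocycle.\<close>

locale witt_relations = central_scalars \<kappa>
  for \<kappa> :: "'z::comm_ring_1 \<Rightarrow> 'a::ring_1" +
  fixes e :: "int \<Rightarrow> 'a" and \<omega> :: "int \<Rightarrow> int \<Rightarrow> 'z" and S :: "int set" and I :: "'a set"
  assumes I: "two_sided I"
    and S_add: "i \<in> S \<Longrightarrow> j \<in> S \<Longrightarrow> i + j \<in> S"
    and relation: "i \<in> S \<Longrightarrow> j \<in> S \<Longrightarrow>
      e i * e j - e j * e i - (of_int (j - i) * e (i + j) + \<kappa> (\<omega> i j)) \<in> I"
begin

definition word :: "int list \<Rightarrow> 'a"
  where "word xs = prod_list (map e xs)"

lemma word_Nil [simp]: "word [] = 1"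
  and word_Cons: "word (x # xs) = e x * word xs"
  and word_append: "word (xs @ ys) = word xs * word ys"
  by (simp_all add: word_def)

text \<open>Congruence modulo \<open>I\<close> to a combination of words with property \<open>G\<close>. All
  statements of the form "up to smaller words" are membership in such a set.\<close>

definition wspan :: "(int list \<Rightarrow> bool) \<Rightarrow> 'a set"
  where "wspan G = lspan I (word ` {xs. set xs \<subseteq> S \<and> G xs})"

lemma wspan_word: "set xs \<subseteq> S \<Longrightarrow> G xs \<Longrightarrow> word xs \<in> wspan G"
  unfolding wspan_def by (rule lspan_base1[OF I]) blast

lemma wspan_ideal: "x \<in> I \<Longrightarrow> x \<in> wspan G"
  unfolding wspan_def by (rule lspan.ideal)

lemmas wspan_zero = lspan_zero[OF I, of "word ` {xs. set xs \<subseteq> S \<and> G xs}" for G, folded wspan_def]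
  and wspan_add = lspan_add[OF I, where B = "word ` {xs. set xs \<subseteq> S \<and> G xs}" for G, folded wspan_def]
  and wspan_scale = lspan_scale[OF I, where B = "word ` {xs. set xs \<subseteq> S \<and> G xs}" for G, folded wspan_def]
  and wspan_diff = lspan_diff[OF I, where B = "word ` {xs. set xs \<subseteq> S \<and> G xs}" for G, folded wspan_def]
  and wspan_uminus = lspan_uminus[OF I, where B = "word ` {xs. set xs \<subseteq> S \<and> G xs}" for G, folded wspan_def]
  and wspan_sum = lspan_sum[OF I, where B = "word ` {xs. set xs \<subseteq> S \<and> G xs}" for G, folded wspan_def]
  and wspan_sum_list = lspan_sum_list[OF I, where B = "word ` {xs. set xs \<subseteq> S \<and> G xs}" for G, folded wspan_def]

lemma wspan_of_int: "x \<in> wspan G \<Longrightarrow> of_int n * x \<in> wspan G"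
  using wspan_scale[of x G "of_int n"] by (simp add: \<kappa>_of_int)

lemma wspan_mono:
  assumes "x \<in> wspan G" "\<And>xs. set xs \<subseteq> S \<Longrightarrow> G xs \<Longrightarrow> H xs"
  shows "x \<in> wspan H"
  using assms(1) unfolding wspan_def by (rule lspan_mono) (use assms(2) in auto)

lemma wspan_additive_image:
  assumes "x \<in> wspan G" "\<And>x. x \<in> I \<Longrightarrow> h x \<in> wspan H"
    and "\<And>x y. h (x + y) = h x + h y" "\<And>z x. h (\<kappa> z * x) = \<kappa> z * h x"
    and "\<And>xs. set xs \<subseteq> S \<Longrightarrow> G xs \<Longrightarrow> h (word xs) \<in> wspan H"
  shows "h x \<in> wspan H"
  using assms(1) unfolding wspan_def
  by (rule lspan_additive_image[OF I]) (use assms(2-) in \<open>auto simp: wspan_def\<close>)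

lemma wspan_mult:
  assumes "x \<in> wspan G" "y \<in> wspan H" and GH: "\<And>xs ys. set xs \<subseteq> S \<Longrightarrow> set ys \<subseteq> S \<Longrightarrow> G xs \<Longrightarrow> H ys \<Longrightarrow> K (xs @ ys)"
  shows "x * y \<in> wspan K"
  using assms(1,2) unfolding wspan_def
  by (rule lspan_mult[OF I]) ((auto intro!: lspan_base1[OF I] imageI GH simp flip: word_append), blast+)

lemma wspan_word_mult:
  assumes "x \<in> wspan G" "set us \<subseteq> S" and "\<And>xs. set xs \<subseteq> S \<Longrightarrow> G xs \<Longrightarrow> H (us @ xs)"
  shows "word us * x \<in> wspan H"
  by (rule wspan_mult[OF wspan_word[OF assms(2), of "\<lambda>xs. xs = us"] assms(1)]) (use assms(3) in auto)

lemma wspan_mult_word: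
  assumes "x \<in> wspan G" "set us \<subseteq> S" and "\<And>xs. set xs \<subseteq> S \<Longrightarrow> G xs \<Longrightarrow> H (xs @ us)"
  shows "x * word us \<in> wspan H"
  by (rule wspan_mult[OF assms(1) wspan_word[OF assms(2), of "\<lambda>xs. xs = us"]]) (use assms(3) in auto)

text \<open>The size function \<open>\<sigma>\<close> is left open because two of them occur: the absolute
  value, used to track the effect of commutators, and the modified size by which words are finally
  ordered. Both are subadditive, which is what reordering relies on.\<close>

definition shorter :: "(int \<Rightarrow> nat) \<Rightarrow> nat \<Rightarrow> nat \<Rightarrow> int list \<Rightarrow> bool"
  where "shorter \<sigma> l m zs \<longleftrightarrow> length zs < l \<and> (\<Sum>z\<leftarrow>zs. \<sigma> z) \<le> m"

text \<open>Exchanging two letters produces words with one or two letters fewer whose size, for a subadditive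
  \<open>\<sigma>\<close>, does not grow.\<close>

lemma commutator:
  assumes "i \<in> S" "j \<in> S" "\<And>i j. \<sigma> (i + j) \<le> \<sigma> i + \<sigma> j"
  shows "e i * e j - e j * e i \<in> wspan (shorter \<sigma> 2 (\<sigma> i + \<sigma> j))"
proof -
  have "e i * e j - e j * e i = (e i * e j - e j * e i - (of_int (j - i) * e (i + j) + \<kappa> (\<omega> i j)))
      + (of_int (j - i) * word [i + j] + \<kappa> (\<omega> i j) * word [])"
    by (simp add: word_Cons)
  also have "\<dots> \<in> wspan (shorter \<sigma> 2 (\<sigma> i + \<sigma> j))"
    using assms by (intro wspan_add wspan_ideal[OF relation] wspan_of_int wspan_scale wspan_word)
      (auto simp: shorter_def S_add)
  finally show ?thesis .
qed

lemma move_front: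
  assumes "set us \<subseteq> S" "set vs \<subseteq> S" "x \<in> S" "\<And>i j. \<sigma> (i + j) \<le> \<sigma> i + \<sigma> j"
  shows "word (us @ x # vs) - word (x # us @ vs) \<in>
    wspan (shorter \<sigma> (length (x # us @ vs)) (\<Sum>z\<leftarrow>x # us @ vs. \<sigma> z))"
  using assms(1)
proof (induction us)
  case Nil
  then show ?case
    by (simp add: wspan_zero)
next
  case (Cons u us)
  let ?G = "shorter \<sigma> (length (x # (u # us) @ vs)) (\<Sum>z\<leftarrow>x # (u # us) @ vs. \<sigma> z)"
  have "word ((u # us) @ x # vs) - word (x # (u # us) @ vs) =
      word [u] * (word (us @ x # vs) - word (x # us @ vs)) + (e u * e x - e x * e u) * word (us @ vs)"
    by (simp add: word_Cons algebra_simps)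
  also have "\<dots> \<in> wspan ?G"
  proof (rule wspan_add)
    show "word [u] * (word (us @ x # vs) - word (x # us @ vs)) \<in> wspan ?G"
      using Cons by (intro wspan_word_mult[OF Cons.IH]) (auto simp: shorter_def)
    show "(e u * e x - e x * e u) * word (us @ vs) \<in> wspan ?G"
      using Cons assms by (intro wspan_mult_word[OF commutator[of _ _ \<sigma>]]) (auto simp: shorter_def)
  qed
  finally show ?case .
qed

text \<open>The spanning half of the Poincare--Birkhoff--Witt theorem: up to shorter words, a word depends only
  on the multiset of its letters.\<close>

lemma reorder:
  assumes "mset xs = mset ys" "set xs \<subseteq> S" "\<And>i j. \<sigma> (i + j) \<le> \<sigma> i + \<sigma> j"
  shows "word xs - word ys \<in> wspan (shorter \<sigma> (length xs) (\<Sum>z\<leftarrow>xs. \<sigma> z))"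
  using assms(1,2)
proof (induction xs arbitrary: ys)
  case Nil
  then show ?case
    by (simp add: wspan_zero)
next
  case (Cons x xs)
  have "x \<in> set ys"
    using Cons.prems(1) by (metis list.set_intros(1) set_mset_mset)
  then obtain us vs where ys: "ys = us @ x # vs"
    by (meson split_list)
  have ms: "mset xs = mset (us @ vs)"
    using Cons.prems(1) ys by simp
  then have len: "length xs = length (us @ vs)" and set: "set xs = set (us @ vs)"
    by (metis size_mset, metis set_mset_mset)
  have sum: "(\<Sum>z\<leftarrow>xs. \<sigma> z) = (\<Sum>z\<leftarrow>us @ vs. \<sigma> z)"
    using ms by (metis mset_map sum_mset_sum_list)
  let ?G = "shorter \<sigma> (length (x # xs)) (\<Sum>z\<leftarrow>x # xs. \<sigma> z)"
  have "word (x # xs) - word ys =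
      word [x] * (word xs - word (us @ vs)) - (word (us @ x # vs) - word (x # us @ vs))"
    by (simp add: word_Cons ys algebra_simps)
  also have "\<dots> \<in> wspan ?G"
  proof (rule wspan_diff)
    have IH: "word xs - word (us @ vs) \<in> wspan (shorter \<sigma> (length xs) (\<Sum>z\<leftarrow>xs. \<sigma> z))"
      using Cons.IH[OF ms] Cons.prems(2) by simp
    show "word [x] * (word xs - word (us @ vs)) \<in> wspan ?G"
      using Cons.prems(2) by (intro wspan_word_mult[OF IH]) (auto simp: shorter_def)
    have "word (us @ x # vs) - word (x # us @ vs) \<in>
        wspan (shorter \<sigma> (length (x # us @ vs)) (\<Sum>z\<leftarrow>x # us @ vs. \<sigma> z))"
      using Cons.prems(2) set by (intro move_front assms(3)) auto
    then show "word (us @ x # vs) - word (x # us @ vs) \<in> wspan ?G"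
      using len sum by simp
  qed
  finally show ?case .
qed

end

section \<open>Iterated commutators\<close>

abbreviation weight :: "int list \<Rightarrow> nat"
  where "weight xs \<equiv> (\<Sum>x\<leftarrow>xs. nat \<bar>x\<bar>)"

abbreviation small_letters :: "int \<Rightarrow> int list \<Rightarrow> int list"
  where "small_letters R \<equiv> filter (\<lambda>x. \<bar>x\<bar> \<le> R)"

lemma weight_mset: "mset xs = mset ys \<Longrightarrow> weight xs = weight ys"
  by (metis mset_map sum_mset_sum_list)

lemma weight_map2_add: "length xs = length ys \<Longrightarrow> weight (map2 (+) xs ys) \<le> weight xs + weight ys"
  by (induction xs ys rule: list_induct2) auto

lemma weight_update:
  assumes "p < length xs"
  shows "weight (xs[p := xs ! p + n]) \<le> weight xs + nat \<bar>n\<bar>"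
  using assms by (induction xs arbitrary: p) (auto split: nat.split)

lemma filter_update:
  assumes "p < length xs"
  shows "length (filter P xs) \<le> Suc (length (filter P (xs[p := y])))"
  using assms by (induction xs arbitrary: p) (auto split: nat.split simp: le_SucI)

lemma sum_list_concat_map: "(\<Sum>x\<leftarrow>concat (map g L). F x) = (\<Sum>y\<leftarrow>L. \<Sum>x\<leftarrow>g y. F x)"
  by (induction L) auto

lemma sum_lessThan_add: "(\<Sum>p<a + b. f p) = (\<Sum>p<a. f p) + (\<Sum>p<b. f (a + p))"
  for f :: "nat \<Rightarrow> 'b::comm_monoid_add"
  by (induction b) (auto simp: add.assoc)

context witt_relations
begin

definition ad :: "int \<Rightarrow> 'a \<Rightarrow> 'a"
  where "ad n x = e n * x - x * e n"

lemma ad_add: "ad n (x + y) = ad n x + ad n y"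
  and ad_diff: "ad n (x - y) = ad n x - ad n y"
  and ad_zero: "ad n 0 = 0"
  by (simp_all add: ad_def algebra_simps)

lemma ad_scale: "ad n (\<kappa> z * x) = \<kappa> z * ad n x"
  by (simp add: ad_def right_diff_distrib \<kappa>_left mult.assoc)

lemma ad_of_int: "ad n (of_int z * x) = of_int z * ad n x"
  using ad_scale[of n "of_int z" x] by (simp add: \<kappa>_of_int)

lemma ad_sum_list: "ad n (\<Sum>x\<leftarrow>L. f x) = (\<Sum>x\<leftarrow>L. ad n (f x))"
  by (induction L) (simp_all add: ad_add ad_zero)

lemma ad_ideal: "x \<in> I \<Longrightarrow> ad n x \<in> I"
  unfolding ad_def by (simp add: two_sided_diff[OF I] two_sided_mult_left[OF I] two_sided_mult_right[OF I])

text \<open>The derivation \<open>[e\<^sub>n, _]\<close> shifts one letter at a time. The cocycle terms delete a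
  letter and therefore land among the shorter words.\<close>

lemma ad_word:
  assumes "n \<in> S" "set xs \<subseteq> S"
  shows "ad n (word xs) - (\<Sum>p<length xs. of_int (xs ! p - n) * word (xs[p := xs ! p + n]))
    \<in> wspan (shorter (\<lambda>i. nat \<bar>i\<bar>) (length xs) (weight xs + nat \<bar>n\<bar>))"
  using assms(2)
proof (induction xs)
  case Nil
  then show ?case
    by (simp add: ad_def wspan_zero)
next
  case (Cons x xs)
  let ?G = "shorter (\<lambda>i. nat \<bar>i\<bar>) (length (x # xs)) (weight (x # xs) + nat \<bar>n\<bar>)"
  let ?s = "\<Sum>p<length xs. of_int (xs ! p - n) * word (xs[p := xs ! p + n])"
  have "(\<Sum>p<length (x # xs). of_int ((x # xs) ! p - n) * word ((x # xs)[p := (x # xs) ! p + n])) =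
      of_int (x - n) * (e (n + x) * word xs) + e x * ?s"
    by (simp add: sum.lessThan_Suc_shift word_Cons sum_distrib_left add.commute mult.assoc[symmetric]
        mult_of_int_commute[of _ "e x"] del: sum.lessThan_Suc of_int_diff)
  moreover have "ad n (word (x # xs)) = (e n * e x - e x * e n) * word xs + e x * ad n (word xs)"
    by (simp add: ad_def word_Cons algebra_simps)
  ultimately have "ad n (word (x # xs)) -
      (\<Sum>p<length (x # xs). of_int ((x # xs) ! p - n) * word ((x # xs)[p := (x # xs) ! p + n])) =
      (e n * e x - e x * e n - (of_int (x - n) * e (n + x) + \<kappa> (\<omega> n x))) * word xs + \<kappa> (\<omega> n x) * word xs
      + word [x] * (ad n (word xs) - ?s)"
    by (simp add: word_Cons algebra_simps)
  also have "\<dots> \<in> wspan ?G"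
    using Cons assms(1)
    by (intro wspan_add wspan_ideal[OF two_sided_mult_right[OF I relation]] wspan_scale wspan_word
        wspan_word_mult[OF Cons.IH]) (auto simp: shorter_def)
  finally show ?case .
qed

text \<open>The error terms after \<open>j\<close> commutators with large indices. A word of full length
  \<open>k\<close> is expected to have \<open>k - j\<close> letters still in \<open>[-R, R]\<close>,
  one having been shifted by each commutator. Lagging words have more small letters than that,
  because some letter absorbed several shifts, or are shorter than \<open>k\<close>. One further
  commutator moves at most one letter out of \<open>[-R, R]\<close>, so lagging words stay lagging.\<close>

definition lagging :: "int \<Rightarrow> nat \<Rightarrow> nat \<Rightarrow> nat \<Rightarrow> int list \<Rightarrow> bool"
  where "lagging R k j m zs \<longleftrightarrow> weight zs \<le> m \<and>
    (length zs < k \<or> length zs = k \<and> k < j + length (small_letters R zs))"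

lemma ad_lagging:
  assumes x: "x \<in> wspan (lagging R k j m)" and n: "n \<in> S"
  shows "ad n x \<in> wspan (lagging R k (Suc j) (m + nat \<bar>n\<bar>))"
  using x
proof (rule wspan_additive_image)
  fix zs assume zs: "set zs \<subseteq> S" "lagging R k j m zs"
  have "ad n (word zs) = (ad n (word zs) - (\<Sum>p<length zs. of_int (zs ! p - n) * word (zs[p := zs ! p + n])))
      + (\<Sum>p<length zs. of_int (zs ! p - n) * word (zs[p := zs ! p + n]))"
    by simp
  also have "\<dots> \<in> wspan (lagging R k (Suc j) (m + nat \<bar>n\<bar>))"
  proof (intro wspan_add wspan_sum wspan_of_int wspan_word)
    show "ad n (word zs) - (\<Sum>p<length zs. of_int (zs ! p - n) * word (zs[p := zs ! p + n]))
        \<in> wspan (lagging R k (Suc j) (m + nat \<bar>n\<bar>))"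
      using zs(2) by (intro wspan_mono[OF ad_word[OF n zs(1)]]) (auto simp: shorter_def lagging_def)
    fix p assume p: "p \<in> {..<length zs}"
    have "zs ! p \<in> S"
      using p zs(1) by (auto dest: nth_mem)
    then show "set (zs[p := zs ! p + n]) \<subseteq> S"
      using zs(1) S_add[OF _ n] set_update_subset_insert[of zs p "zs ! p + n"] by blast
    show "lagging R k (Suc j) (m + nat \<bar>n\<bar>) (zs[p := zs ! p + n])"
      using zs(2) p weight_update[of p zs n] filter_update[of p zs "\<lambda>x. \<bar>x\<bar> \<le> R" "zs ! p + n"]
      by (auto simp: lagging_def)
  qed
  finally show "ad n (word zs) \<in> wspan (lagging R k (Suc j) (m + nat \<bar>n\<bar>))" .
qed (auto simp: ad_add ad_scale intro: wspan_ideal ad_ideal)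

lemma foldr_ad_lagging:
  assumes "x \<in> wspan (lagging R k j m)" "set ns \<subseteq> S"
  shows "foldr ad ns x \<in> wspan (lagging R k (length ns + j) (m + weight ns))"
  using assms(2)
proof (induction ns)
  case (Cons n ns)
  then show ?case
    using ad_lagging[of "foldr ad ns x" R k "length ns + j" "m + weight ns" n] by (simp add: ac_simps)
qed (use assms(1) in simp)

lemma map2_add_subset:
  "length ys = length ns \<Longrightarrow> set ys \<subseteq> S \<Longrightarrow> set ns \<subseteq> S \<Longrightarrow> set (map2 (+) ys ns) \<subseteq> S"
  by (induction ys ns rule: list_induct2) (auto simp: S_add)

text \<open>The coefficient with which the letters \<open>y\<^sub>i\<close> absorb the shifts
  \<open>n\<^sub>i\<close>, one each.\<close>

fun shift_coeff :: "int list \<Rightarrow> int list \<Rightarrow> int" where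
  "shift_coeff (y # ys) (n # ns) = (y - n) * shift_coeff ys ns"
| "shift_coeff _ _ = 1"

text \<open>One step of the expansion: \<open>us\<close> are the letters that have been shifted,
  \<open>rs\<close> the untouched ones. A shift of a letter in \<open>us\<close> leaves too many
  untouched letters and is lagging; a shift of a letter in \<open>rs\<close> moves that letter to
  the shifted part.\<close>

lemma ad_touched:
  fixes us rs :: "int list" and R :: int and n :: int
  defines "k \<equiv> length us + length rs"
  assumes us: "set us \<subseteq> S" and rs: "set rs \<subseteq> S" "\<forall>r\<in>set rs. \<bar>r\<bar> \<le> R" and n: "n \<in> S"
    and m: "weight (us @ rs) \<le> m"
  shows "ad n (word (us @ rs)) - (\<Sum>p\<leftarrow>[0..<length rs]. of_int (rs ! p - n) *
      word ((rs ! p + n) # us @ take p rs @ drop (Suc p) rs))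
    \<in> wspan (lagging R k (Suc (length us)) (m + nat \<bar>n\<bar>))" (is "_ \<in> wspan ?J")
proof -
  let ?w = "us @ rs"
  let ?f = "\<lambda>p. of_int (?w ! p - n) * word (?w[p := ?w ! p + n])"
  let ?g = "\<lambda>p. of_int (rs ! p - n) * word ((rs ! p + n) # us @ take p rs @ drop (Suc p) rs)"
  have "ad n (word ?w) - (\<Sum>p<length ?w. ?f p) \<in> wspan ?J"
    using us rs m by (intro wspan_mono[OF ad_word[OF n]]) (auto simp: shorter_def lagging_def k_def)
  moreover have "(\<Sum>p<length us. ?f p) \<in> wspan ?J"
  proof (intro wspan_sum wspan_of_int wspan_word)
    fix p assume p: "p \<in> {..<length us}"
    have "us ! p \<in> S"
      using p us by (auto dest: nth_mem)
    then show "set (?w[p := ?w ! p + n]) \<subseteq> S"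
      using p us rs(1) S_add[OF _ n] set_update_subset_insert[of us p "us ! p + n"]
      by (auto simp: list_update_append nth_append)
    have "small_letters R rs = rs"
      using rs(2) by simp
    then show "?J (?w[p := ?w ! p + n])"
      using p m weight_update[of p ?w n] by (auto simp: lagging_def k_def list_update_append)
  qed
  moreover have "(\<Sum>p<length rs. ?f (length us + p) - ?g p) \<in> wspan ?J"
  proof (rule wspan_sum)
    fix p assume "p \<in> {..<length rs}"
    then have p: "p < length rs"
      by simp
    let ?v = "?w[length us + p := ?w ! (length us + p) + n]"
    have split: "rs = take p rs @ rs ! p # drop (Suc p) rs"
      by (rule id_take_nth_drop[OF p])
    have v: "?v = us @ take p rs @ (rs ! p + n) # drop (Suc p) rs"
      using p by (simp add: list_update_append upd_conv_take_nth_drop)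
    have "rs ! p \<in> S" "set (take p rs) \<subseteq> S" "set (drop (Suc p) rs) \<subseteq> S"
      using p rs(1) by (auto dest: in_set_takeD in_set_dropD)
    then have vS: "set ?v \<subseteq> S"
      unfolding v using us S_add[OF _ n] by auto
    have "word ?v - word ((rs ! p + n) # us @ take p rs @ drop (Suc p) rs)
        \<in> wspan (shorter (\<lambda>i. nat \<bar>i\<bar>) (length ?v) (weight ?v))"
      using vS unfolding v by (intro reorder) auto
    then have "word ?v - word ((rs ! p + n) # us @ take p rs @ drop (Suc p) rs) \<in> wspan ?J"
      using weight_update[of "length us + p" ?w n] p m
      by (elim wspan_mono) (auto simp: shorter_def lagging_def k_def)
    then have "of_int (rs ! p - n) * (word ?v - word ((rs ! p + n) # us @ take p rs @ drop (Suc p) rs)) \<in> wspan ?J"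
      by (rule wspan_of_int)
    then show "?f (length us + p) - ?g p \<in> wspan ?J"
      by (simp add: right_diff_distrib del: of_int_diff)
  qed
  ultimately have "(ad n (word ?w) - (\<Sum>p<length ?w. ?f p)) + (\<Sum>p<length us. ?f p)
      + (\<Sum>p<length rs. ?f (length us + p) - ?g p) \<in> wspan ?J"
    by (intro wspan_add)
  moreover have "(\<Sum>p\<leftarrow>[0..<length rs]. ?g p) = (\<Sum>p<length rs. ?g p)"
    by (simp add: interv_sum_list_conv_sum_set_nat atLeast0LessThan)
  moreover have "(\<Sum>p<length ?w. ?f p) = (\<Sum>p<length us. ?f p) + (\<Sum>p<length rs. ?f (length us + p))"
    by (simp only: length_append sum_lessThan_add)
  ultimately show ?thesis
    by (simp only: sum_subtractf) (simp add: algebra_simps)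
qed

text \<open>The polarization of a word. In each pair of \<open>L\<close> the letters \<open>ys\<close> have
  absorbed the shifts \<open>ns\<close>, in this order, and \<open>rs\<close> is untouched. Repeated
  letters make \<open>ys\<close> occur several times; recording a list and only the set of its first
  components avoids computing the multiplicities, of which nothing but positivity will be used.\<close>

lemma iterated_ad_expansion:
  assumes xs: "set xs \<subseteq> S" "\<forall>x\<in>set xs. \<bar>x\<bar> \<le> R" and ns: "set ns \<subseteq> S" "length ns \<le> length xs"
  shows "\<exists>L. (\<forall>(ys, rs)\<in>set L. length ys = length ns \<and> mset (ys @ rs) = mset xs) \<and>
    (\<forall>ys. length ys = length ns \<longrightarrow> mset ys \<subseteq># mset xs \<longrightarrow> ys \<in> fst ` set L) \<and>
    foldr ad ns (word xs) - (\<Sum>(ys, rs)\<leftarrow>L. of_int (shift_coeff ys ns) * word (map2 (+) ys ns @ rs))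
      \<in> wspan (lagging R (length xs) (length ns) (weight xs + weight ns))"
  using ns
proof (induction ns)
  case Nil
  show ?case
    by (intro exI[of _ "[([], xs)]"]) (auto simp: wspan_zero)
next
  case (Cons n ns)
  let ?t = "\<lambda>ns (ys, rs). of_int (shift_coeff ys ns) * word (map2 (+) ys ns @ rs)"
  let ?J = "lagging R (length xs) (Suc (length ns)) (weight xs + weight (n # ns))"
  have "set ns \<subseteq> S" "length ns \<le> length xs"
    using Cons.prems by auto
  from Cons.IH[OF this] obtain L where L: "\<forall>(ys, rs)\<in>set L. length ys = length ns \<and> mset (ys @ rs) = mset xs"
    and L2: "\<forall>ys. length ys = length ns \<longrightarrow> mset ys \<subseteq># mset xs \<longrightarrow> ys \<in> fst ` set L"
    and L3: "foldr ad ns (word xs) - (\<Sum>x\<leftarrow>L. ?t ns x) \<in> wspan (lagging R (length xs) (length ns) (weight xs + weight ns))"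
    by (elim exE conjE)
  have L1: "length ys = length ns \<and> mset (ys @ rs) = mset xs" if "(ys, rs) \<in> set L" for ys rs
    using L that by blast
  define next_list where "next_list =
    (\<lambda>(ys :: int list, rs). map (\<lambda>p. (rs ! p # ys, take p rs @ drop (Suc p) rs)) [0..<length rs])"
  define L' where "L' = concat (map next_list L)"
  have mset_split: "mset (take p rs @ drop (Suc p) rs) + {#rs ! p#} = mset rs" if "p < length rs" for p and rs :: "int list"
    using id_take_nth_drop[OF that] by (metis add_mset_add_single mset_append mset.simps(2) union_mset_add_mset_right)
  have "length ys = length (n # ns) \<and> mset (ys @ rs) = mset xs" if yr: "(ys, rs) \<in> set L'" for ys rs
  proof -
    obtain ys' rs' p where *: "(ys', rs') \<in> set L" "p < length rs'" "ys = rs' ! p # ys'"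
      "rs = take p rs' @ drop (Suc p) rs'"
      using yr by (auto simp: L'_def next_list_def)
    show ?thesis
      using L1[OF *(1)] mset_split[OF *(2), symmetric] *(3,4) by (simp add: ac_simps)
  qed
  moreover have "ys \<in> fst ` set L'" if ys: "length ys = length (n # ns)" "mset ys \<subseteq># mset xs" for ys
  proof -
    obtain y ys' where y: "ys = y # ys'"
      using ys(1) by (cases ys) auto
    have "mset ys' \<subseteq># mset xs" "length ys' = length ns"
      using ys y by (auto dest: mset_subset_eq_insertD subset_mset.less_imp_le)
    then obtain rs where rs: "(ys', rs) \<in> set L"
      using L2 by fastforce
    have "mset xs = mset ys' + mset rs"
      using L1[OF rs] by simp
    then have "mset ys' + {#y#} \<subseteq># mset ys' + mset rs"
      using ys(2) y by simp
    then have "y \<in> set rs"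
      unfolding mset_subset_eq_mono_add_left_cancel by simp
    then obtain p where "p < length rs" "y = rs ! p"
      by (metis in_set_conv_nth)
    then have "(ys, take p rs @ drop (Suc p) rs) \<in> set L'"
      using rs y by (fastforce simp: L'_def next_list_def)
    then show ?thesis
      by force
  qed
  moreover have "foldr ad (n # ns) (word xs) - (\<Sum>x\<leftarrow>L'. ?t (n # ns) x) \<in> wspan ?J"
  proof -
    define d where "d = (\<lambda>(ys, rs). ad n (word (map2 (+) ys ns @ rs)) - (\<Sum>p\<leftarrow>[0..<length rs]. of_int (rs ! p - n) *
      word ((rs ! p + n) # map2 (+) ys ns @ take p rs @ drop (Suc p) rs)))"
    have "(\<Sum>x\<leftarrow>L'. ?t (n # ns) x) = (\<Sum>(ys, rs)\<leftarrow>L. of_int (shift_coeff ys ns) * (\<Sum>p\<leftarrow>[0..<length rs]. of_int (rs ! p - n) *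
      word ((rs ! p + n) # map2 (+) ys ns @ take p rs @ drop (Suc p) rs)))"
      unfolding L'_def sum_list_concat_map next_list_def
      by (simp add: case_prod_unfold o_def sum_list_const_mult[symmetric] mult.commute[of "_ - n :: int"]
          mult.assoc del: of_int_diff)
    then have "foldr ad (n # ns) (word xs) - (\<Sum>x\<leftarrow>L'. ?t (n # ns) x) =
        ad n (foldr ad ns (word xs) - (\<Sum>x\<leftarrow>L. ?t ns x)) + (\<Sum>(ys, rs)\<leftarrow>L. of_int (shift_coeff ys ns) * d (ys, rs))"
      by (simp add: ad_diff ad_sum_list case_prod_unfold ad_of_int d_def right_diff_distrib sum_list_subtractf del: of_int_diff)
    also have "\<dots> \<in> wspan ?J"
    proof (intro wspan_add wspan_sum_list)
      show "ad n (foldr ad ns (word xs) - (\<Sum>x\<leftarrow>L. ?t ns x)) \<in> wspan ?J"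
        using ad_lagging[OF L3, of n] Cons.prems by (simp add: ac_simps)
      fix x assume x: "x \<in> set L"
      obtain ys rs where yr: "x = (ys, rs)"
        by (cases x)
      have len: "length ys = length ns" and ms: "mset (ys @ rs) = mset xs"
        using L1 x yr by auto
      have set: "set ys \<union> set rs = set xs" and l: "length ys + length rs = length xs"
        using ms by (metis set_append set_mset_mset, metis length_append size_mset)
      have "set (map2 (+) ys ns) \<subseteq> S"
        using set xs(1) Cons.prems(1) by (intro map2_add_subset len) auto
      moreover have "weight (map2 (+) ys ns @ rs) \<le> weight xs + weight ns"
        using weight_map2_add[OF len] weight_mset[OF ms] by simp
      moreover have rs: "set rs \<subseteq> S" "\<forall>r\<in>set rs. \<bar>r\<bar> \<le> R"
        using set xs by auto
      ultimately have "d (ys, rs) \<in> wspan ?J"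
        unfolding d_def using ad_touched[of "map2 (+) ys ns" rs R n "weight xs + weight ns"] rs Cons.prems(1) l len
        by (simp add: add.assoc add.commute[of "weight ns"])
      then show "(case x of (ys, rs) \<Rightarrow> of_int (shift_coeff ys ns) * d (ys, rs)) \<in> wspan ?J"
        by (simp add: yr wspan_of_int)
    qed
    finally show ?thesis .
  qed
  ultimately show ?case
    by (intro exI[of _ L']) auto
qed

end

section \<open>A well-founded order on words\<close>

text \<open>Words are compared by length, then by size, then by crowding. A letter outside \<open>[-R,
  R]\<close> costs an extra \<open>bump\<close>, which exceeds \<open>2kR\<close>, the most by which
  the total absolute value of an error term can exceed that of the leading word; this puts lagging
  words of length \<open>k\<close> below the leading word. The \<open>bump\<close> charged to every
  letter keeps shorter error terms from outgrowing the leading word, and makes the size subadditive.\<close>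

definition bump :: "nat \<Rightarrow> int \<Rightarrow> nat"
  where "bump k R = 2 * k * nat R + 1"

definition letter_size :: "nat \<Rightarrow> int \<Rightarrow> int \<Rightarrow> nat"
  where "letter_size k R i = nat \<bar>i\<bar> + bump k R + (if \<bar>i\<bar> \<le> R then 0 else bump k R)"

abbreviation word_size :: "nat \<Rightarrow> int \<Rightarrow> int list \<Rightarrow> nat"
  where "word_size k R xs \<equiv> (\<Sum>x\<leftarrow>xs. letter_size k R x)"

text \<open>A numerical encoding of a lexicographic order that starts from the smallest letters: with base
  \<open>k + 1\<close>, a single letter outweighs \<open>k\<close> letters of larger absolute value,
  as long as these are at most \<open>H\<close>. Words of higher crowding count as lower.\<close>

definition crowding :: "nat \<Rightarrow> nat \<Rightarrow> int list \<Rightarrow> nat"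
  where "crowding k H xs = (\<Sum>x\<leftarrow>xs. (k + 1) ^ (H - nat \<bar>x\<bar>))"

text \<open>The size of a lower word never exceeds that of the word above it. Reductions thus stay within the
  words of bounded size, of which there are finitely many.\<close>

definition lower :: "nat \<Rightarrow> int \<Rightarrow> nat \<Rightarrow> int list \<Rightarrow> int list \<Rightarrow> bool"
  where "lower k R H xs ys \<longleftrightarrow> word_size k R xs \<le> word_size k R ys \<and>
    (length xs < length ys \<or> length xs = length ys \<and>
      (word_size k R xs < word_size k R ys \<or> crowding k H ys < crowding k H xs))"

lemma letter_size_add: "letter_size k R (i + j) \<le> letter_size k R i + letter_size k R j"
proof -
  have "nat \<bar>i + j\<bar> \<le> nat \<bar>i\<bar> + nat \<bar>j\<bar>"
    by arith
  then show ?thesis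
    by (simp add: letter_size_def)
qed

lemma length_le_word_size: "length zs \<le> word_size k R zs"
  by (induction zs) (auto simp: letter_size_def bump_def)

lemma word_size_eq:
  "word_size k R xs + bump k R * length (small_letters R xs) = weight xs + 2 * bump k R * length xs"
  by (induction xs) (auto simp: letter_size_def)

lemma word_size_large:
  assumes "\<forall>x\<in>set xs. R < \<bar>x\<bar>"
  shows "word_size k R xs = weight xs + 2 * bump k R * length xs"
proof -
  have "small_letters R xs = []"
    using assms by (auto simp: filter_empty_conv)
  with word_size_eq[of k R xs] show ?thesis
    by simp
qed

lemma lower_append: "lower k R H xs ys \<Longrightarrow> lower k R H (xs @ zs) (ys @ zs)"
  by (auto simp: lower_def crowding_def)

lemma weight_nonneg: "\<forall>x\<in>set xs. 0 \<le> x \<Longrightarrow> int (weight xs) = sum_list xs"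
  by (induction xs) auto

lemma weight_le_bound: "\<forall>x\<in>set xs. \<bar>x\<bar> \<le> R \<Longrightarrow> weight xs \<le> length xs * nat R"
  by (induction xs) auto

lemma weight_shift: "length xs = length ns \<Longrightarrow> weight ns \<le> weight (map2 (+) xs ns) + weight xs"
  by (induction xs ns rule: list_induct2) auto

lemma sum_list_map2_add: "length xs = length ns \<Longrightarrow> sum_list (map2 (+) xs ns) = sum_list xs + sum_list (ns :: int list)"
  by (induction xs ns rule: list_induct2) auto

text \<open>At the first position where \<open>ys\<close> and \<open>as\<close> differ, the shifted letter of
  \<open>ys\<close> is strictly smaller than that of \<open>as\<close>; since the shifted
  \<open>as\<close> is sorted, all its letters from there on, at most \<open>k\<close> in number,
  are larger than this one letter and together weigh less.\<close>

lemma crowding_lex: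
  assumes "length ys = length as" "length as = length ns" "ys < as"
    and "sorted (map2 (+) as ns)" "length as \<le> k"
    and "\<forall>m\<in>set (map2 (+) as ns). 0 < m \<and> nat m \<le> H" "\<forall>m\<in>set (map2 (+) ys ns). 0 \<le> m"
  shows "crowding k H (map2 (+) as ns) < crowding k H (map2 (+) ys ns)"
  using assms
proof (induction ys as ns rule: list_induct3)
  case (Cons y ys a as n ns)
  show ?case
  proof (cases "y < a")
    case True
    let ?W = "k + 1" and ?m = "a + n"
    have "crowding k H (map2 (+) (a # as) (n # ns)) \<le> (\<Sum>m\<leftarrow>map2 (+) (a # as) (n # ns). ?W ^ (H - nat ?m))"
      unfolding crowding_def
    proof (rule sum_list_mono)
      fix m assume "m \<in> set (map2 (+) (a # as) (n # ns))"
      then have "?m \<le> m"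
        using Cons.prems(2) by auto
      then show "?W ^ (H - nat \<bar>m\<bar>) \<le> ?W ^ (H - nat ?m)"
        by (intro power_increasing diff_le_mono2) auto
    qed
    also have "\<dots> = length (a # as) * ?W ^ (H - nat ?m)"
      using Cons.hyps by (simp add: sum_list_triv o_def)
    also have "\<dots> \<le> k * ?W ^ (H - nat ?m)"
      using Cons.prems(3) by (intro mult_right_mono) auto
    also have "\<dots> < ?W ^ Suc (H - nat ?m)"
      by simp
    also have "\<dots> \<le> ?W ^ (H - nat \<bar>y + n\<bar>)"
      using True Cons.prems(4,5) by (intro power_increasing) auto
    also have "\<dots> \<le> crowding k H (map2 (+) (y # ys) (n # ns))"
      by (simp add: crowding_def)
    finally show ?thesis .
  next
    case False
    then have "y = a" "ys < as"
      using Cons.prems(1) by auto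
    then show ?thesis
      using Cons.IH Cons.prems by (simp add: crowding_def)
  qed
qed simp

text \<open>The size constants pay off here: \<open>w\<close> and \<open>n\<close> are the total absolute values
  of the letters of a polarized word and of the shifts, and \<open>ms\<close> is the leading word.\<close>

lemma lagging_lower:
  assumes lagging: "weight zs \<le> w + n" "length zs < k \<or> length zs = k \<and> 0 < length (small_letters R zs)"
    and w: "w \<le> k * nat R" and n: "n \<le> weight ms + k * nat R"
    and ms: "length ms = k" "\<forall>m\<in>set ms. R < \<bar>m\<bar>"
  shows "lower k R H zs ms"
proof -
  let ?C = "bump k R" and ?s = "length (small_letters R zs)"
  have size_ms: "word_size k R ms = weight ms + 2 * ?C * k"
    using word_size_large[OF ms(2)] ms(1) by simp
  have size_zs: "word_size k R zs + ?C * ?s = weight zs + 2 * ?C * length zs"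
    by (rule word_size_eq)
  have zs: "weight zs \<le> weight ms + 2 * (k * nat R)"
    using lagging(1) w n by linarith
  have C: "2 * (k * nat R) < ?C"
    by (simp add: bump_def)
  from lagging(2) show ?thesis
  proof
    assume l: "length zs < k"
    then have "2 * ?C * length zs + 2 * ?C \<le> 2 * ?C * k"
      using mult_le_mono2[of "Suc (length zs)" k "2 * ?C"] by simp
    then show ?thesis
      using size_ms size_zs zs C l ms(1) unfolding lower_def by linarith
  next
    assume l: "length zs = k \<and> 0 < ?s"
    then have "length zs = k" "?C \<le> ?C * ?s"
      using mult_le_mono2[of 1 ?s ?C] l by (auto simp: Suc_le_eq)
    then have "word_size k R zs < word_size k R ms"
      using size_ms size_zs[unfolded \<open>length zs = k\<close>] zs C by linarith
    then show ?thesis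
      using l ms(1) by (simp add: lower_def)
  qed
qed

section \<open>Leading words\<close>

text \<open>Given a combination of words in \<open>I\<close> with coefficients outside \<open>I\<close>, every
  sorted word \<open>ms\<close> of \<open>k\<close> large positive letters is, up to a scalar
  outside \<open>I\<close>, congruent to a combination of lower words. Among all arrangements of the
  longest words choose \<open>A\<close> with maximal sum, and among those the lexicographically
  largest. Polarizing with the shifts \<open>ns = ms - A\<close> makes \<open>ms\<close> the leading
  word: lagging terms are lower by size or length, arrangements of smaller sum are lower by size,
  and the other arrangements of the same sum are lower by crowding.\<close>

lemma (in witt_relations) leading_word:
  fixes \<Gamma> :: "int list set" and z :: "int list \<Rightarrow> 'z"
  assumes prime: "completely_prime I" and char0: "\<And>i. of_int i \<in> I \<Longrightarrow> i = 0" and pos: "{1..} \<subseteq> S"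
    and \<Gamma>: "finite \<Gamma>" "inj_on mset \<Gamma>" "(\<Sum>w\<in>\<Gamma>. \<kappa> (z w) * word w) \<in> I"
    and letters: "\<And>w. w \<in> \<Gamma> \<Longrightarrow> set w \<subseteq> S \<and> length w \<le> k \<and> (\<forall>x\<in>set w. \<bar>x\<bar> \<le> R)"
    and coeffs: "\<And>w. w \<in> \<Gamma> \<Longrightarrow> \<kappa> (z w) \<notin> I"
    and top: "\<exists>w\<in>\<Gamma>. length w = k"
    and ms: "length ms = k" "sorted ms" "\<forall>m\<in>set ms. 3 * R + 1 \<le> m" "weight ms \<le> H" and R: "0 \<le> R"
  shows "\<exists>s. \<kappa> s \<notin> I \<and> \<kappa> s * word ms \<in> wspan (\<lambda>zs. lower k R H zs ms)"
proof -
  \<comment> \<open>All arrangements of the longest words.\<close>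
  define X where "X = {ys. \<exists>w\<in>\<Gamma>. length w = k \<and> mset ys = mset w}"
  have finX: "finite X"
  proof -
    have "X \<subseteq> {ys. set ys \<subseteq> (\<Union>w\<in>\<Gamma>. set w) \<and> length ys = k}"
      unfolding X_def by (auto dest: mset_eq_setD mset_eq_length)
    then show ?thesis
      by (rule finite_subset) (use \<Gamma>(1) in \<open>auto intro: finite_lists_length_eq\<close>)
  qed
  have X_ne: "X \<noteq> {}"
    using top unfolding X_def by blast
  define s where "s = Max (sum_list ` X)"
  define Y where "Y = {ys\<in>X. sum_list ys = s}"
  define A where "A = Max Y"
  have s_in: "s \<in> sum_list ` X"
    unfolding s_def using finX X_ne by (intro Max_in) auto
  have Y: "finite Y" "Y \<noteq> {}"
    using finX s_in unfolding Y_def by auto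
  then have "A \<in> Y"
    unfolding A_def by (rule Max_in)
  then have A: "A \<in> X" "sum_list A = s"
    by (auto simp: Y_def)
  have A_max: "sum_list ys < sum_list A \<or> sum_list ys = sum_list A \<and> ys < A" if "ys \<in> X" "ys \<noteq> A" for ys
  proof (cases "ys \<in> Y")
    case True
    then show ?thesis
      using Max_ge[OF Y(1) True, folded A_def] that(2) A(2) True by (auto simp: Y_def)
  next
    case False
    have "sum_list ys \<le> s"
      unfolding s_def using finX that(1) by simp
    then show ?thesis
      using False that(1) A(2) by (auto simp: Y_def)
  qed
  have X: "length ys = k \<and> set ys \<subseteq> S \<and> (\<forall>y\<in>set ys. \<bar>y\<bar> \<le> R)" if ys: "ys \<in> X" for ys
  proof -
    obtain w where w: "w \<in> \<Gamma>" "length w = k" "mset ys = mset w"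
      using ys unfolding X_def by blast
    then have "set ys = set w" "length ys = length w"
      by (auto dest: mset_eq_setD mset_eq_length)
    then show ?thesis
      using letters[OF w(1)] w(2) by simp
  qed
  obtain wA where wA: "wA \<in> \<Gamma>" "length wA = k" "mset A = mset wA"
    using A(1) unfolding X_def by blast
  \<comment> \<open>The bound \<open>3R + 1\<close> on the letters of \<open>ms\<close> makes every shift exceed
    \<open>2R\<close>, so that a letter that has absorbed one shift exceeds \<open>R\<close>.\<close>
  define ns where "ns = map2 (-) ms A"
  have ns: "length ns = k" "map2 (+) A ns = ms"
    using X[OF A(1)] ms(1) by (auto simp: ns_def list_eq_iff_nth_eq)
  have ns_large: "2 * R + 1 \<le> n" if n: "n \<in> set ns" for n
  proof -
    obtain m a where "m \<in> set ms" "a \<in> set A" "n = m - a"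
      using n by (auto simp: ns_def dest: set_zip_leftD set_zip_rightD)
    then show ?thesis
      using ms(3) X[OF A(1)] by fastforce
  qed
  have nsS: "set ns \<subseteq> S"
    using ns_large pos R by force
  have touched_large: "R < m" if ys: "ys \<in> X" and m: "m \<in> set (map2 (+) ys ns)" for ys m
  proof -
    obtain y n where "y \<in> set ys" "n \<in> set ns" "m = y + n"
      using m by (auto dest: set_zip_leftD set_zip_rightD)
    then show ?thesis
      using ns_large[of n] X[OF ys] by fastforce
  qed
  have ms_large: "\<forall>m\<in>set ms. R < \<bar>m\<bar>"
    using ms(3) R by auto
  have weight_ns: "weight ns \<le> weight ms + k * nat R"
    using weight_shift[of A ns] X[OF A(1)] ns weight_le_bound[of A R] by auto
  have lagging: "x \<in> wspan (\<lambda>zs. lower k R H zs ms)"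
    if "x \<in> wspan (lagging R k k (weight w + weight ns))" "w \<in> \<Gamma>" for x w
  proof -
    have "weight w \<le> length w * nat R" "length w \<le> k"
      using weight_le_bound[of w R] letters[OF that(2)] by auto
    then have "weight w \<le> k * nat R"
      by (meson le_trans mult_le_mono1)
    then have *: "lower k R H zs ms" if "lagging R k k (weight w + weight ns) zs" for zs
      using that by (intro lagging_lower[OF _ _ _ weight_ns ms(1) ms_large]) (auto simp: lagging_def)
    show ?thesis
      by (rule wspan_mono[OF that(1)]) (rule *)
  qed
  have main: "lower k R H (map2 (+) ys ns) ms" if ys: "ys \<in> X" "ys \<noteq> A" for ys
  proof -
    have len: "length ys = length ns" "length A = length ns"
      using X[OF ys(1)] X[OF A(1)] ns(1) by auto
    have large: "\<forall>m\<in>set (map2 (+) ys ns). R < m"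
      using touched_large[OF ys(1)] by blast
    then have nonneg: "\<forall>m\<in>set (map2 (+) ys ns). 0 \<le> m" and abs: "\<forall>m\<in>set (map2 (+) ys ns). R < \<bar>m\<bar>"
      using R by (meson less_imp_le order_trans, meson abs_ge_self less_le_trans)
    have ms_nonneg: "\<forall>m\<in>set ms. 0 \<le> m"
      using ms(3) R by auto
    have "int (weight (map2 (+) ys ns)) = sum_list ys + sum_list ns"
      using weight_nonneg[OF nonneg] sum_list_map2_add[OF len(1)] by simp
    moreover have "int (weight ms) = sum_list A + sum_list ns"
      using weight_nonneg[OF ms_nonneg] sum_list_map2_add[OF len(2)] unfolding ns(2) by simp
    moreover have "word_size k R (map2 (+) ys ns) = weight (map2 (+) ys ns) + 2 * bump k R * k"
      using word_size_large[OF abs] len ns(1) by simp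
    moreover have "word_size k R ms = weight ms + 2 * bump k R * k"
      using word_size_large[OF ms_large] ms(1) by simp
    moreover have "crowding k H ms < crowding k H (map2 (+) ys ns)" if "ys < A"
    proof -
      have "nat m \<le> H" if "m \<in> set ms" for m
        using member_le_sum_list[of "nat \<bar>m\<bar>" "map (\<lambda>x. nat \<bar>x\<bar>) ms"] that ms(4) by fastforce
      then have "\<forall>m\<in>set ms. 0 < m \<and> nat m \<le> H"
        using ms(3) R by auto
      then have "crowding k H (map2 (+) A ns) < crowding k H (map2 (+) ys ns)"
        using that len ns ms(2) nonneg by (intro crowding_lex) simp_all
      then show ?thesis
        by (simp add: ns(2))
    qed
    ultimately show ?thesis
      using A_max[OF ys] ms(1) len ns(1) unfolding lower_def by fastforce
  qed
  \<comment> \<open>Only the word with the letters of \<open>A\<close> contributes to the leading word, since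
    distinct words of \<open>\<Gamma>\<close> have distinct multisets of letters.\<close>
  have expand: "\<exists>c::int. foldr ad ns (word w) - of_int c * word ms \<in> wspan (\<lambda>zs. lower k R H zs ms) \<and>
      (c = 0 \<longleftrightarrow> w \<noteq> wA)" if w: "w \<in> \<Gamma>" for w
  proof (cases "length w = k")
    case False
    then have "length w < k"
      using letters[OF w] by auto
    then have "word w \<in> wspan (lagging R k 0 (weight w))"
      using letters[OF w] by (intro wspan_word) (auto simp: lagging_def)
    from foldr_ad_lagging[OF this nsS] have "foldr ad ns (word w) \<in> wspan (\<lambda>zs. lower k R H zs ms)"
      using lagging[OF _ w] ns(1) by simp
    then show ?thesis
      using False wA(2) by (intro exI[of _ 0]) auto
  next
    case True
    have "length ns \<le> length w"
      using ns(1) True by simp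
    from iterated_ad_expansion[OF _ _ nsS this, of R] obtain L where
      L: "\<forall>(ys, rs)\<in>set L. length ys = length ns \<and> mset (ys @ rs) = mset w"
      "\<forall>ys. length ys = length ns \<longrightarrow> mset ys \<subseteq># mset w \<longrightarrow> ys \<in> fst ` set L"
      "foldr ad ns (word w) - (\<Sum>(ys, rs)\<leftarrow>L. of_int (shift_coeff ys ns) * word (map2 (+) ys ns @ rs))
        \<in> wspan (lagging R (length w) (length ns) (weight w + weight ns))"
      using letters[OF w] by blast
    \<comment> \<open>Every occurrence of \<open>A\<close> contributes the same nonzero coefficient, so the
      contributions cannot cancel in characteristic zero.\<close>
    define c where "c = shift_coeff A ns * int (length (filter (\<lambda>(ys, rs). ys = A) L))"
    have L1: "rs = [] \<and> mset ys = mset w \<and> ys \<in> X" if "(ys, rs) \<in> set L" for ys rs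
    proof -
      have *: "length ys = length w" "mset (ys @ rs) = mset w"
        using L(1) that ns(1) True by auto
      then have "length (ys @ rs) = length w"
        by (metis size_mset)
      then have "rs = []"
        using *(1) by simp
      then show ?thesis
        using * w True unfolding X_def by auto
    qed
    have "(\<Sum>(ys, rs)\<leftarrow>L. of_int (shift_coeff ys ns) * word (map2 (+) ys ns @ rs)) - of_int c * word ms =
        (\<Sum>(ys, rs)\<leftarrow>L. of_int (shift_coeff ys ns) * word (map2 (+) ys ns @ rs) -
          (if ys = A then of_int (shift_coeff A ns) * word ms else 0))"
      unfolding c_def
      by (induction L) (auto simp: algebra_simps)
    also have "\<dots> \<in> wspan (\<lambda>zs. lower k R H zs ms)"
    proof (rule wspan_sum_list)
      fix x assume x: "x \<in> set L"
      obtain ys where ys: "x = (ys, [])" "ys \<in> X"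
        using L1 x by (metis surj_pair)
      show "(case x of (ys, rs) \<Rightarrow> of_int (shift_coeff ys ns) * word (map2 (+) ys ns @ rs) -
          (if ys = A then of_int (shift_coeff A ns) * word ms else 0)) \<in> wspan (\<lambda>zs. lower k R H zs ms)"
      proof (cases "ys = A")
        case True
        then show ?thesis
          by (simp add: ys(1) ns(2) wspan_zero)
      next
        case False
        have "set (map2 (+) ys ns) \<subseteq> S"
          using X[OF ys(2)] ns(1) nsS by (intro map2_add_subset) auto
        then show ?thesis
          using False main[OF ys(2) False] by (simp add: ys(1) wspan_of_int wspan_word)
      qed
    qed
    finally have "foldr ad ns (word w) - of_int c * word ms \<in> wspan (\<lambda>zs. lower k R H zs ms)"
      using wspan_add[OF lagging[OF _ w]] L(3) ns(1) True by fastforce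
    moreover have "shift_coeff A ns \<noteq> 0"
    proof -
      have "shift_coeff ys ls \<noteq> 0" if "length ys = length ls" "\<forall>y\<in>set ys. y \<le> R" "\<forall>l\<in>set ls. R < l" for ys ls
        using that by (induction ys ls rule: list_induct2) auto
      then show ?thesis
        using X[OF A(1)] ns ns_large R by force
    qed
    moreover have "filter (\<lambda>(ys, rs). ys = A) L = [] \<longleftrightarrow> w \<noteq> wA"
    proof
      assume "filter (\<lambda>(ys, rs). ys = A) L = []"
      then have "A \<notin> fst ` set L"
        by (auto simp: filter_empty_conv)
      then show "w \<noteq> wA"
        using L(2) X[OF A(1)] ns(1) wA(3) by auto
    next
      assume "w \<noteq> wA"
      then have "mset A \<noteq> mset w"
        using inj_onD[OF \<Gamma>(2)] w wA(1,3) by metis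
      then show "filter (\<lambda>(ys, rs). ys = A) L = []"
        using L1 by (auto simp: filter_empty_conv)
    qed
    ultimately show ?thesis
      by (intro exI[of _ c]) (auto simp: c_def)
  qed
  then obtain c where c: "\<And>w. w \<in> \<Gamma> \<Longrightarrow> foldr ad ns (word w) - of_int (c w) * word ms \<in> wspan (\<lambda>zs. lower k R H zs ms)"
    "\<And>w. w \<in> \<Gamma> \<Longrightarrow> c w = 0 \<longleftrightarrow> w \<noteq> wA"
    by metis
  have foldr_sum: "foldr ad ls (\<Sum>w\<in>\<Gamma>. \<kappa> (z w) * word w) = (\<Sum>w\<in>\<Gamma>. \<kappa> (z w) * foldr ad ls (word w))" for ls
  proof (induction ls)
    case (Cons l ls)
    have "ad l (sum f B) = (\<Sum>w\<in>B. ad l (f w))" for f and B :: "int list set"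
      by (induction B rule: infinite_finite_induct) (auto simp: ad_add ad_zero)
    with Cons show ?case
      by (simp add: ad_scale)
  qed simp
  have foldr_ideal: "foldr ad ls x \<in> I" if "x \<in> I" for ls x
    using that by (induction ls) (auto intro: ad_ideal)
  have "(\<Sum>w\<in>\<Gamma>. \<kappa> (z w) * (of_int (c w) * word ms)) =
      foldr ad ns (\<Sum>w\<in>\<Gamma>. \<kappa> (z w) * word w) - (\<Sum>w\<in>\<Gamma>. \<kappa> (z w) * (foldr ad ns (word w) - of_int (c w) * word ms))"
    unfolding foldr_sum by (simp add: sum_subtractf[symmetric] algebra_simps)
  also have "\<dots> \<in> wspan (\<lambda>zs. lower k R H zs ms)"
    by (intro wspan_diff wspan_ideal[OF foldr_ideal[OF \<Gamma>(3)]] wspan_sum wspan_scale c(1))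
  also have "(\<Sum>w\<in>\<Gamma>. \<kappa> (z w) * (of_int (c w) * word ms)) =
      (\<Sum>w\<in>\<Gamma>. if w = wA then \<kappa> (z w) * (of_int (c w) * word ms) else 0)"
  proof (intro sum.cong refl)
    fix w assume "w \<in> \<Gamma>"
    then show "\<kappa> (z w) * (of_int (c w) * word ms) = (if w = wA then \<kappa> (z w) * (of_int (c w) * word ms) else 0)"
      using c(2)[of w] by (cases "w = wA") auto
  qed
  also have "\<dots> = \<kappa> (z wA * of_int (c wA)) * word ms"
    using \<Gamma>(1) wA(1) by (subst sum.delta) (simp_all add: \<kappa>_mult \<kappa>_of_int mult.assoc)
  finally have "\<kappa> (z wA * of_int (c wA)) * word ms \<in> wspan (\<lambda>zs. lower k R H zs ms)" .
  moreover have "\<kappa> (z wA * of_int (c wA)) \<notin> I"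
    using completely_prime_mult_iff[OF prime] coeffs[OF wA(1)] char0 c(2)[OF wA(1)]
    by (auto simp: \<kappa>_mult \<kappa>_of_int)
  ultimately show ?thesis
    by blast
qed

section \<open>Reduction to normal words\<close>

lemma lower_mset_cong:
  assumes "mset ys = mset ys'"
  shows "lower k R H zs ys \<longleftrightarrow> lower k R H zs ys'"
proof -
  have "length ys = length ys'" "word_size k R ys = word_size k R ys'" "crowding k H ys = crowding k H ys'"
    using assms unfolding crowding_def by (metis size_mset, (metis mset_map sum_mset_sum_list)+)
  then show ?thesis
    by (simp add: lower_def)
qed

lemma lower_uminus: "lower k R H (map uminus zs) (map uminus ys) \<longleftrightarrow> lower k R H zs ys"
  by (simp add: lower_def crowding_def o_def letter_size_def)

text \<open>The order is well-founded below any size bound \<open>N\<close>, because there the crowding is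
  bounded. The same \<open>N\<close> serves as the exponent bound in the crowding.\<close>

lemma lower_induct [consumes 1, case_names lower]:
  assumes "word_size k R ys \<le> N"
    and step: "\<And>ys. word_size k R ys \<le> N \<Longrightarrow> (\<And>zs. lower k R N zs ys \<Longrightarrow> P zs) \<Longrightarrow> P ys"
  shows "P ys"
  using assms(1)
proof (induction ys rule: wf_induct[OF wf_measures[of "[length, word_size k R, \<lambda>zs. N * (k + 1) ^ N - crowding k N zs]"]])
  case (1 ys)
  show ?case
  proof (rule step[OF 1(2)])
    fix zs assume l: "lower k R N zs ys"
    then have size: "word_size k R zs \<le> N"
      using 1(2) by (simp add: lower_def)
    have "length zs \<le> word_size k R zs"
      by (rule length_le_word_size)
    then have "length zs * (k + 1) ^ N \<le> N * (k + 1) ^ N"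
      using size by (intro mult_right_mono) auto
    moreover have "crowding k N zs \<le> length zs * (k + 1) ^ N"
    proof -
      have "crowding k N zs \<le> (\<Sum>x\<leftarrow>zs. (k + 1) ^ N)"
        unfolding crowding_def by (intro sum_list_mono power_increasing) auto
      then show ?thesis
        by (simp add: sum_list_triv)
    qed
    ultimately have "crowding k N zs \<le> N * (k + 1) ^ N"
      by (rule order_trans[rotated])
    then have "(zs, ys) \<in> measures [length, word_size k R, \<lambda>zs. N * (k + 1) ^ N - crowding k N zs]"
      using l by (auto simp: lower_def intro: diff_less_mono2)
    then show "P zs"
      using 1(1) size by blast
  qed
qed

context witt_relations
begin

lemma shorter_lower: "shorter (letter_size k R) (length ys) (word_size k R ys) zs \<Longrightarrow> lower k R H zs ys"
  by (simp add: shorter_def lower_def)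

lemma reorder_lower:
  assumes "mset xs = mset ys" "set xs \<subseteq> S"
  shows "word xs - word ys \<in> wspan (\<lambda>zs. lower k R H zs xs)"
  by (rule wspan_mono[OF reorder[OF assms letter_size_add[of k R]]]) (rule shorter_lower)

lemma word_in_sorted_span:
  "set xs \<subseteq> S \<Longrightarrow> word xs \<in> wspan sorted"
proof (induction xs rule: length_induct)
  case (1 xs)
  have "word xs - word (sort xs) \<in> wspan (shorter (letter_size 0 0) (length xs) (word_size 0 0 xs))"
    using 1(2) by (intro reorder letter_size_add) auto
  then have "word xs - word (sort xs) \<in> wspan sorted"
    unfolding wspan_def
    by (rule lspan_bind[OF I]) (use 1(1) in \<open>auto simp: shorter_def wspan_def\<close>)
  moreover have "word (sort xs) \<in> wspan sorted"
    using 1(2) by (intro wspan_word) auto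
  ultimately show ?case
    using wspan_add by fastforce
qed

text \<open>Negative letters are handled by the symmetry \<open>e\<^sub>i \<mapsto> -e\<^sub>-\<^sub>i\<close>,
  which preserves the relations and turns the given combination of words into one of the same length
  and letter bound. It is available whenever a negative letter occurs at all, since then
  \<open>S\<close> is all of \<open>\<int>\<close>.\<close>

lemma reducible:
  fixes \<Gamma> :: "int list set" and z :: "int list \<Rightarrow> 'z"
  assumes prime: "completely_prime I" and char0: "\<And>i. of_int i \<in> I \<Longrightarrow> i = 0" and S: "S = UNIV \<or> S = {1..}"
    and \<Gamma>: "finite \<Gamma>" "inj_on mset \<Gamma>" "(\<Sum>w\<in>\<Gamma>. \<kappa> (z w) * word w) \<in> I"
    and letters: "\<And>w. w \<in> \<Gamma> \<Longrightarrow> set w \<subseteq> S \<and> length w \<le> k \<and> (\<forall>x\<in>set w. \<bar>x\<bar> \<le> R)"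
    and coeffs: "\<And>w. w \<in> \<Gamma> \<Longrightarrow> \<kappa> (z w) \<notin> I"
    and top: "\<exists>w\<in>\<Gamma>. length w = k" and R: "0 \<le> R"
    and us: "length us = k" "set us \<subseteq> S" "weight us \<le> H"
      "(\<forall>u\<in>set us. 3 * R + 1 \<le> u) \<or> (\<forall>u\<in>set us. u \<le> - (3 * R + 1))"
  shows "\<exists>s. \<kappa> s \<notin> I \<and> \<kappa> s * word us \<in> wspan (\<lambda>zs. lower k R H zs us)"
proof -
  have sort: "\<exists>s. \<kappa> s \<notin> I \<and> \<kappa> s * word us \<in> wspan (\<lambda>zs. lower k R H zs us)"
    if ms: "mset ms = mset us" and s: "\<kappa> s \<notin> I" "\<kappa> s * word ms \<in> wspan (\<lambda>zs. lower k R H zs ms)" for ms s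
  proof -
    have "\<kappa> s * (word us - word ms) + \<kappa> s * word ms \<in> wspan (\<lambda>zs. lower k R H zs us)"
      using s(2) unfolding lower_mset_cong[OF ms]
      by (rule wspan_add[OF wspan_scale[OF reorder_lower[OF ms[symmetric] us(2)]]])
    then have "\<kappa> s * word us \<in> wspan (\<lambda>zs. lower k R H zs us)"
      by (simp add: right_diff_distrib)
    then show ?thesis
      using s(1) by blast
  qed
  show ?thesis
  proof (cases "\<forall>u\<in>set us. 3 * R + 1 \<le> u")
    case True
    have "\<exists>s. \<kappa> s \<notin> I \<and> \<kappa> s * word (sort us) \<in> wspan (\<lambda>zs. lower k R H zs (sort us))"
      using True S us(1,3) weight_mset[of "sort us" us]
      by (intro leading_word[OF prime char0 _ \<Gamma> letters coeffs top _ _ _ _ R]) auto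
    then show ?thesis
      using sort[of "sort us"] by auto
  next
    case False
    then have neg: "\<forall>u\<in>set us. u \<le> - (3 * R + 1)" and "us \<noteq> []"
      using us(4) by auto
    then obtain u where "u \<in> S" "u < 0"
      using us(2) R by (cases us) auto
    then have S: "S = UNIV"
      using S by auto
    interpret N: witt_relations \<kappa> "\<lambda>i. - e (- i)" "\<lambda>i j. \<omega> (- i) (- j)" S I
    proof
      show "- e (- i) * - e (- j) - - e (- j) * - e (- i) - (of_int (j - i) * - e (- (i + j)) + \<kappa> (\<omega> (- i) (- j))) \<in> I" for i j
        using relation[of "- i" "- j"] S by (simp add: algebra_simps)
    qed (use I S in auto)
    have N_word: "N.word xs = (- 1) ^ length xs * word (map uminus xs)" for xs
    proof (induction xs)
      case (Cons x xs)
      then show ?case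
        by (cases "even (length xs)") (simp_all add: N.word_Cons word_Cons)
    qed simp
    have N_wspan: "x \<in> wspan G'" if "x \<in> N.wspan G" and G: "\<And>xs. G xs \<Longrightarrow> G' (map uminus xs)" for x G G'
      using that(1) unfolding N.wspan_def wspan_def
    proof (rule lspan_bind[OF I], clarsimp)
      fix xs assume "G xs"
      then have "word (map uminus xs) \<in> wspan G'"
        by (intro wspan_word G) (auto simp: S)
      then have "of_int ((- 1) ^ length xs) * word (map uminus xs) \<in> wspan G'"
        by (rule wspan_of_int)
      then show "N.word xs \<in> lspan I (word ` {xs. set xs \<subseteq> S \<and> G' xs})"
        by (simp add: N_word wspan_def)
    qed
    have inj: "inj_on (map uminus) \<Gamma>"
      by (rule inj_on_inverseI[of _ "map uminus"]) (simp add: o_def)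
    define ms where "ms = sort (map uminus us)"
    define z' where "z' w = (- 1) ^ length w * z (map uminus w)" for w
    have "\<exists>s. \<kappa> s \<notin> I \<and> \<kappa> s * N.word ms \<in> N.wspan (\<lambda>zs. lower k R H zs ms)"
    proof (rule N.leading_word[OF prime char0, where \<Gamma> = "map uminus ` \<Gamma>" and z = z'])
      show "inj_on mset (map uminus ` \<Gamma>)"
      proof (rule inj_onI, elim imageE, hypsubst)
        fix v w assume vw: "v \<in> \<Gamma>" "w \<in> \<Gamma>" and "mset (map uminus v) = mset (map uminus w)"
        then have eq: "image_mset uminus (mset v) = image_mset uminus (mset w)"
          by simp
        have "mset v = mset w"
          using arg_cong[OF eq, of "image_mset uminus"] by (simp add: multiset.map_comp o_def)
        then have "v = w"
          using inj_onD[OF \<Gamma>(2)] vw by blast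
        then show "map uminus v = map uminus w"
          by simp
      qed
      have "\<kappa> (z' (map uminus w)) * N.word (map uminus w) = \<kappa> (z w) * word w" for w
        by (cases "even (length w)") (simp_all add: z'_def N_word o_def \<kappa>_uminus)
      then show "(\<Sum>w\<in>map uminus ` \<Gamma>. \<kappa> (z' w) * N.word w) \<in> I"
        using \<Gamma>(3) by (simp add: sum.reindex[OF inj])
      show "\<kappa> (z' w) \<notin> I" if w: "w \<in> map uminus ` \<Gamma>" for w
      proof -
        obtain v where v: "v \<in> \<Gamma>" "w = map uminus v"
          using w by blast
        have "- x \<in> I \<longleftrightarrow> x \<in> I" for x
          using two_sided_uminus[OF I] by fastforce
        then show ?thesis
          using coeffs[OF v(1)] v(2) by (cases "even (length v)") (simp_all add: z'_def o_def \<kappa>_uminus)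
      qed
      show "weight ms \<le> H"
        using us(3) weight_mset[of ms "map uminus us"] by (simp add: ms_def o_def)
      show "\<exists>w\<in>map uminus ` \<Gamma>. length w = k"
        using top by auto
    qed (use \<Gamma>(1) letters us(1) neg R S in \<open>auto simp: ms_def\<close>)
    then obtain s where s: "\<kappa> s \<notin> I" "\<kappa> s * N.word ms \<in> N.wspan (\<lambda>zs. lower k R H zs ms)"
      by blast
    have "\<kappa> s * N.word ms \<in> wspan (\<lambda>zs. lower k R H zs (map uminus ms))"
      using s(2) by (rule N_wspan) (simp add: lower_uminus)
    then have "\<kappa> s * word (map uminus ms) \<in> wspan (\<lambda>zs. lower k R H zs (map uminus ms))"
      using wspan_uminus by (cases "even (length ms)") (fastforce simp: N_word)+
    moreover have "mset (map uminus ms) = mset us"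
      by (simp add: ms_def multiset.map_comp o_def)
    ultimately show ?thesis
      using sort[OF _ s(1)] by blast
  qed
qed

text \<open>The words to which no reduction applies, in sorted form and up to a given size.\<close>

definition normal_words :: "nat \<Rightarrow> int \<Rightarrow> nat \<Rightarrow> int list set"
  where "normal_words k R N = {w. set w \<subseteq> S \<and> sorted w \<and> word_size k R w \<le> N \<and>
    length (filter (\<lambda>x. 3 * R + 1 \<le> x) w) < k \<and> length (filter (\<lambda>x. x \<le> - (3 * R + 1)) w) < k}"

text \<open>A word that is not normal after sorting contains \<open>k\<close> large letters of one sign; moving
  these to the front and reducing them expresses a scalar multiple of it by lower words. The scalar
  factors accumulate, which is why the conclusion is about the torsion span.\<close>

lemma word_in_normal_tspan:
  assumes prime: "completely_prime I"
    and red: "\<And>us H. length us = k \<Longrightarrow> set us \<subseteq> S \<Longrightarrow> weight us \<le> H \<Longrightarrow>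
      (\<forall>u\<in>set us. 3 * R + 1 \<le> u) \<or> (\<forall>u\<in>set us. u \<le> - (3 * R + 1)) \<Longrightarrow>
      \<exists>s. \<kappa> s \<notin> I \<and> \<kappa> s * word us \<in> wspan (\<lambda>zs. lower k R H zs us)"
    and xs: "word_size k R xs \<le> N" "set xs \<subseteq> S"
  shows "word xs \<in> tspan I (word ` normal_words k R N)"
  using xs
proof (induction xs rule: lower_induct)
  case (lower ys)
  let ?T = "tspan I (word ` normal_words k R N)"
  have low: "x \<in> ?T" if "x \<in> wspan (\<lambda>zs. lower k R N zs ys)" for x
    using that unfolding wspan_def
    by (rule tspan_bind[OF prime]) (use lower.IH in auto)
  have perm: "word ys \<in> ?T" if "mset zs = mset ys" "word zs \<in> ?T" for zs
    using tspan_add[OF prime low[OF reorder_lower[of ys zs]] that(2)] that(1) lower.prems by simp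
  show ?case
  proof (cases "length (filter (\<lambda>x. 3 * R + 1 \<le> x) ys) < k \<and> length (filter (\<lambda>x. x \<le> - (3 * R + 1)) ys) < k")
    case True
    have "mset (filter P (sort ys)) = mset (filter P ys)" for P
      by simp
    then have "length (filter P (sort ys)) = length (filter P ys)" for P
      by (metis size_mset)
    moreover have "word_size k R (sort ys) = word_size k R ys"
      by (metis mset_map mset_sort sum_mset_sum_list)
    ultimately have "sort ys \<in> normal_words k R N"
      using True lower.hyps lower.prems by (simp add: normal_words_def)
    then have "word (sort ys) \<in> ?T"
      by (intro tspan_lspan[OF prime] lspan_base1[OF I]) blast
    then show ?thesis
      by (rule perm[rotated]) simp
  next
    case False
    then obtain P where P: "k \<le> length (filter P ys)"
      "P = (\<lambda>x. 3 * R + 1 \<le> x) \<or> P = (\<lambda>x. x \<le> - (3 * R + 1))"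
      by (metis not_less)
    define us where "us = take k (filter P ys)"
    define vs where "vs = drop k (filter P ys) @ filter (\<lambda>x. \<not> P x) ys"
    have "mset (us @ vs) = mset (filter P ys) + mset (filter (\<lambda>x. \<not> P x) ys)"
      unfolding us_def vs_def mset_append[symmetric] append_assoc[symmetric] append_take_drop_id ..
    then have ms: "mset (us @ vs) = mset ys"
      by (simp add: multiset_partition[symmetric])
    then have set: "set us \<union> set vs = set ys"
      by (metis set_append set_mset_mset)
    have "weight us \<le> weight (us @ vs)"
      by simp
    also have "\<dots> = weight ys"
      by (rule weight_mset[OF ms])
    also have "\<dots> \<le> word_size k R ys"
      by (intro sum_list_mono) (simp add: letter_size_def)
    finally have "weight us \<le> N"
      using lower.hyps by simp
    moreover have "length us = k" "\<forall>u\<in>set us. P u"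
      using P(1) by (auto simp: us_def dest: in_set_takeD)
    ultimately obtain s where s: "\<kappa> s \<notin> I" "\<kappa> s * word us \<in> wspan (\<lambda>zs. lower k R N zs us)"
      using red[of us N] P(2) set lower.prems by auto
    have "\<kappa> s * word us * word vs \<in> wspan (\<lambda>zs. lower k R N zs (us @ vs))"
      using set lower.prems by (intro wspan_mult_word[OF s(2)] lower_append) auto
    then have "\<kappa> s * word (us @ vs) \<in> wspan (\<lambda>zs. lower k R N zs ys)"
      by (simp add: word_append mult.assoc lower_mset_cong[OF ms])
    then have "word (us @ vs) \<in> ?T"
      using tspan_cancel[OF prime s(1) low] by blast
    then show ?thesis
      by (rule perm[OF ms])
  qed
qed

end

section \<open>Counting normal words\<close>

lemma letter_bound: "x \<in> set w \<Longrightarrow> nat \<bar>x\<bar> \<le> word_size k R w"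
proof -
  assume "x \<in> set w"
  then have "letter_size k R x \<le> word_size k R w"
    by (intro member_le_sum_list) auto
  then show ?thesis
    by (simp add: letter_size_def)
qed

text \<open>A normal word is determined by the multiplicities of its letters in \<open>[-3R - 1, 3R + 1]\<close>
  together with the sorted list of its large letters, of which there are fewer than
  \<open>2k\<close>.\<close>

lemma (in witt_relations) card_normal_words:
  assumes "0 \<le> R"
  shows "finite (normal_words k R N)"
    and "card (normal_words k R N) \<le> (2 * N + 1) ^ (length [- (3 * R + 1)..3 * R + 1] + 2 * k)"
proof -
  define B where "B = 3 * R + 1"
  have B: "1 \<le> B"
    using assms by (simp add: B_def)
  define big where "big x \<longleftrightarrow> B \<le> x \<or> x \<le> - B" for x :: int
  \<comment> \<open>Padding with \<open>0\<close>, which is not a large letter, gives all lists of large letters the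
    same length.\<close>
  define pad where "pad w = filter big w @ replicate (2 * k - length (filter big w)) 0" for w
  define F where "F w = (map (count (mset w)) [- B..B], pad w)" for w
  define C where "C = {cs. set cs \<subseteq> {..N} \<and> length cs = length [- B..B]}"
  define D where "D = {ds. set ds \<subseteq> {- int N..int N} \<and> length ds = 2 * k}"
  have fin: "finite C" "finite D"
    unfolding C_def D_def by (auto intro: finite_lists_length_eq)
  have inj: "inj_on F (normal_words k R N)"
  proof (rule inj_onI)
    fix v w assume vw: "v \<in> normal_words k R N" "w \<in> normal_words k R N" "F v = F w"
    have zero: "\<not> big 0"
      using B by (simp add: big_def)
    have "filter big (pad u) = filter big u" for u
      using zero by (simp add: pad_def)
    then have "filter big v = filter big w"
      using vw(3) unfolding F_def by (metis prod.inject)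
    then have bigs: "filter_mset big (mset v) = filter_mset big (mset w)"
      by (metis mset_filter)
    have "count (mset v) x = count (mset w) x" for x
    proof (cases "x \<in> {- B..B}")
      case True
      then show ?thesis
        using vw(3) unfolding F_def by auto
    next
      case False
      then have "big x"
        by (auto simp: big_def)
      then show ?thesis
        using arg_cong[OF bigs, of "\<lambda>M. count M x"] by simp
    qed
    then have "mset v = mset w"
      by (rule multiset_eqI)
    then show "v = w"
      using vw(1,2) properties_for_sort[of v w] sorted_sort_id[of w]
      unfolding normal_words_def by (metis (no_types, lifting) mem_Collect_eq)
  qed
  have sub: "F ` normal_words k R N \<subseteq> C \<times> D"
  proof (rule image_subsetI)
    fix w assume w: "w \<in> normal_words k R N"
    have size: "word_size k R w \<le> N"
      using w by (simp add: normal_words_def)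
    have "count (mset w) x \<le> N" for x
      using count_le_size[of "mset w" x] length_le_word_size[where zs = w and k = k and R = R] size by simp
    then have "map (count (mset w)) [- B..B] \<in> C"
      by (auto simp: C_def)
    moreover have "length (filter big w) \<le> length (filter (\<lambda>x. B \<le> x) w) + length (filter (\<lambda>x. x \<le> - B) w)"
      by (induction w) (auto simp: big_def)
    then have "length (filter big w) \<le> 2 * k"
      using w by (simp add: normal_words_def B_def)
    moreover have "set w \<subseteq> {- int N..int N}"
    proof
      fix x assume "x \<in> set w"
      then have "nat \<bar>x\<bar> \<le> N"
        using letter_bound[of x w k R] size by linarith
      then show "x \<in> {- int N..int N}"
        by auto
    qed
    ultimately show "F w \<in> C \<times> D"
      by (auto simp: F_def D_def pad_def)
  qed
  show "finite (normal_words k R N)"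
    using finite_imageD[OF finite_subset[OF sub] inj] fin by blast
  have "card (normal_words k R N) \<le> card (C \<times> D)"
    using card_image[OF inj] card_mono[OF _ sub] fin by simp
  also have "\<dots> = (N + 1) ^ length [- B..B] * (2 * N + 1) ^ (2 * k)"
  proof -
    have "card {- int N..int N} = 2 * N + 1"
      by simp
    then have "card D = (2 * N + 1) ^ (2 * k)"
      unfolding D_def by (subst card_lists_length_eq) auto
    moreover have "card C = (N + 1) ^ length [- B..B]"
      unfolding C_def by (subst card_lists_length_eq) auto
    ultimately show ?thesis
      by (simp add: card_cartesian_product)
  qed
  also have "\<dots> \<le> (2 * N + 1) ^ length [- B..B] * (2 * N + 1) ^ (2 * k)"
    by (intro mult_right_mono power_mono) auto
  finally show "card (normal_words k R N) \<le> (2 * N + 1) ^ (length [- (3 * R + 1)..3 * R + 1] + 2 * k)"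
    by (simp add: power_add B_def)
qed

section \<open>Chains of completely prime ideals\<close>

context witt_relations
begin

text \<open>Finitely many elements involve only words of bounded size; the bound for the chosen elements of the
  chain is what makes their monomials grow linearly in size.\<close>

lemma wspan_bounded:
  assumes "x \<in> wspan (\<lambda>_. True)"
  shows "\<exists>r. x \<in> wspan (\<lambda>xs. word_size k R xs \<le> r)"
  using assms unfolding wspan_def
proof induction
  case (ideal x)
  then show ?case
    by (auto intro: lspan.ideal)
next
  case (add x b z)
  then obtain r ys where r: "x \<in> wspan (\<lambda>xs. word_size k R xs \<le> r)" "b = word ys" "set ys \<subseteq> S"
    by (auto simp: wspan_def)
  have "x \<in> wspan (\<lambda>xs. word_size k R xs \<le> max r (word_size k R ys))"
    using r(1) by (rule wspan_mono) auto
  moreover have "word ys \<in> wspan (\<lambda>xs. word_size k R xs \<le> max r (word_size k R ys))"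
    using r(3) by (rule wspan_word) auto
  ultimately have "x + \<kappa> z * b \<in> wspan (\<lambda>xs. word_size k R xs \<le> max r (word_size k R ys))"
    unfolding r(2) by (intro wspan_add wspan_scale)
  then show ?case
    unfolding wspan_def by blast
qed

lemma monomial_bounded:
  assumes "\<forall>a\<in>set as. a \<in> wspan (\<lambda>xs. word_size k R xs \<le> r)" "ks \<in> exponents n (length as)"
  shows "monomial as ks \<in> wspan (\<lambda>xs. word_size k R xs \<le> r * (length as * n))"
  using assms
proof (induction as arbitrary: ks)
  case Nil
  show ?case
    using wspan_word[of "[]" "\<lambda>xs. word_size k R xs \<le> 0"] by simp
next
  case (Cons a as)
  then obtain j js where ks: "ks = j # js" "j < n" "js \<in> exponents n (length as)"
    by (auto simp: exponents_def length_Suc_conv)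
  have power: "a ^ j \<in> wspan (\<lambda>xs. word_size k R xs \<le> r * j)" for j
  proof (induction j)
    case 0
    show ?case
      using wspan_word[of "[]" "\<lambda>xs. word_size k R xs \<le> 0"] by simp
  next
    case (Suc j)
    have "a \<in> wspan (\<lambda>xs. word_size k R xs \<le> r)"
      using Cons.prems(1) by simp
    from wspan_mult[OF this Suc] show ?case
      by simp
  qed
  have "monomial as js \<in> wspan (\<lambda>xs. word_size k R xs \<le> r * (length as * n))"
    using Cons.IH ks(3) Cons.prems(1) by simp
  then have "monomial as js * a ^ j \<in> wspan (\<lambda>xs. word_size k R xs \<le> r * (length as * n) + r * j)"
    by (rule wspan_mult[OF _ power]) auto
  then have "monomial as js * a ^ j \<in> wspan (\<lambda>xs. word_size k R xs \<le> r * (length (a # as) * n))"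
  proof (rule wspan_mono)
    fix xs assume "word_size k R xs \<le> r * (length as * n) + r * j"
    also have "r * j \<le> r * n"
      using ks(2) by simp
    finally show "word_size k R xs \<le> r * (length (a # as) * n)"
      by (simp add: algebra_simps)
  qed
  then show ?case
    by (simp add: ks(1))
qed

end

text \<open>The count of normal words of size at most \<open>r d n\<close> is bounded by a polynomial of degree
  \<open>D\<close> in \<open>n\<close>, so it is overtaken by
  \<open>n\<^sup>D\<^sup>+\<^sup>1\<close>.\<close>

lemma polynomial_below_power:
  fixes r d D :: nat
  assumes "0 < r" "0 < d"
  defines "n \<equiv> (3 * r * d) ^ D + 1"
  shows "(2 * (r * (d * n)) + 1) ^ D < n ^ Suc D"
proof -
  have n: "0 < n"
    by (simp add: n_def)
  then have "2 * (r * (d * n)) + 1 \<le> 3 * r * d * n"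
    using assms(1,2) by simp
  then have "(2 * (r * (d * n)) + 1) ^ D \<le> (3 * r * d * n) ^ D"
    by (rule power_mono) simp
  also have "\<dots> = (3 * r * d) ^ D * n ^ D"
    by (rule power_mult_distrib)
  also have "\<dots> < n * n ^ D"
    using n by (intro mult_strict_right_mono) (simp_all add: n_def)
  finally show ?thesis
    by simp
qed

lemma strict_subchain:
  fixes Q :: "nat \<Rightarrow> 'b set"
  assumes mono: "\<And>n. Q n \<subseteq> Q (Suc n)" and not_const: "\<nexists>N. \<forall>n\<ge>N. Q n = Q N"
  shows "\<exists>h. h 0 = 0 \<and> (\<forall>m. Q (h m) \<subset> Q (h (Suc m)))"
proof -
  have "\<exists>n. Q N \<subset> Q n" for N
    using not_const lift_Suc_mono_le[of Q N, OF mono] by (metis psubsetI)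
  then obtain g where g: "\<And>N. Q N \<subset> Q (g N)"
    by metis
  show ?thesis
    using g by (intro exI[of _ "\<lambda>m. (g ^^ m) 0"]) auto
qed

context central_scalars
begin

text \<open>The step from \<open>Q 0\<close> to \<open>Q 1\<close> supplies the element that makes \<open>Q
  1\<close> reduce words; its degree and letter bound fix the growth exponent \<open>D\<close>. The
  next \<open>D + 1\<close> steps supply more independent monomials than that growth permits.\<close>

lemma no_strict_chain:
  fixes Q :: "nat \<Rightarrow> 'a set" and e :: "int \<Rightarrow> 'a" and \<omega> :: "int \<Rightarrow> int \<Rightarrow> 'z"
  assumes Q: "\<And>n. completely_prime (Q n)" "\<And>n. Q n \<subset> Q (Suc n)"
    and scalars: "\<And>n s. \<kappa> s \<in> Q n \<longleftrightarrow> \<kappa> s \<in> Q 0"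
    and char0: "\<And>i. of_int i \<in> Q 0 \<Longrightarrow> i = 0"
    and S: "S = UNIV \<or> S = {1..}"
    and relation: "\<And>i j. i \<in> S \<Longrightarrow> j \<in> S \<Longrightarrow>
      e i * e j - e j * e i - (of_int (j - i) * e (i + j) + \<kappa> (\<omega> i j)) \<in> Q 0"
    and generated: "\<And>X. Q 0 \<subseteq> X \<Longrightarrow> (\<And>s. \<kappa> s \<in> X) \<Longrightarrow> (\<And>i. i \<in> S \<Longrightarrow> e i \<in> X) \<Longrightarrow>
      (\<And>x y. x \<in> X \<Longrightarrow> y \<in> X \<Longrightarrow> x + y \<in> X) \<Longrightarrow> (\<And>x y. x \<in> X \<Longrightarrow> y \<in> X \<Longrightarrow> x * y \<in> X) \<Longrightarrow> X = UNIV"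
  shows False
proof -
  have Q_mono: "Q m \<subseteq> Q n" if "m \<le> n" for m n
    using Q(2) by (intro lift_Suc_mono_le[OF _ that]) blast
  have W: "witt_relations \<kappa> e \<omega> S (Q n)" for n
  proof (intro witt_relations.intro central_scalars_axioms witt_relations_axioms.intro)
    show "i + j \<in> S" if "i \<in> S" "j \<in> S" for i j
      using S that by auto
    show "e i * e j - e j * e i - (of_int (j - i) * e (i + j) + \<kappa> (\<omega> i j)) \<in> Q n"
      if "i \<in> S" "j \<in> S" for i j
      using relation[OF that] Q_mono[of 0 n] by blast
  qed (rule completely_prime_two_sided[OF Q(1)])
  interpret W0: witt_relations \<kappa> e \<omega> S "Q 0"
    by (rule W)
  interpret W1: witt_relations \<kappa> e \<omega> S "Q 1"
    by (rule W)
  note I0 = completely_prime_two_sided[OF Q(1)[of 0]] and I1 = completely_prime_two_sided[OF Q(1)[of 1]]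
  have span0: "W0.wspan (\<lambda>_. True) = UNIV"
  proof (rule generated)
    show "Q 0 \<subseteq> W0.wspan (\<lambda>_. True)"
      by (auto intro: W0.wspan_ideal)
    show "\<kappa> s \<in> W0.wspan (\<lambda>_. True)" for s
      using W0.wspan_scale[OF W0.wspan_word[of "[]"]] by simp
    show "e i \<in> W0.wspan (\<lambda>_. True)" if "i \<in> S" for i
      using W0.wspan_word[of "[i]"] that by (simp add: W0.word_Cons)
  qed (auto intro: W0.wspan_add W0.wspan_mult)
  have sorted0: "x \<in> W0.wspan sorted" for x
  proof -
    have "x \<in> W0.wspan (\<lambda>_. True)"
      by (simp add: span0)
    then show ?thesis
      unfolding W0.wspan_def
      by (rule lspan_bind[OF I0]) (use W0.word_in_sorted_span in \<open>auto simp: W0.wspan_def\<close>)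
  qed
  have "\<exists>x. x \<in> Q (Suc n) - Q n" for n
    using Q(2)[of n] by blast
  then obtain a where a: "\<And>n. a n \<in> Q (Suc n) - Q n"
    by metis
  obtain \<Delta> z where \<Delta>: "finite \<Delta>" "\<Delta> \<subseteq> {xs. set xs \<subseteq> S \<and> sorted xs}" "a 0 - (\<Sum>w\<in>\<Delta>. \<kappa> (z w) * W0.word w) \<in> Q 0"
    using lspan_finite_sum[OF I0 sorted0[of "a 0", unfolded W0.wspan_def]] by blast
  \<comment> \<open>Terms with coefficient in \<open>Q 1\<close> have it in \<open>Q 0\<close> too, since both
    ideals meet the scalars in the same set; they can be discarded, and not all terms disappear
    because \<open>a 0 \<notin> Q 0\<close>.\<close>
  define \<Gamma> where "\<Gamma> = {w\<in>\<Delta>. \<kappa> (z w) \<notin> Q 1}"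
  have \<Gamma>: "finite \<Gamma>" "\<Gamma> \<subseteq> \<Delta>"
    using \<Delta>(1) by (auto simp: \<Gamma>_def)
  have small: "(\<Sum>w\<in>\<Delta> - \<Gamma>. \<kappa> (z w) * W0.word w) \<in> Q 0"
    using scalars[of _ 1] by (intro two_sided_sum I0 two_sided_mult_right[OF I0]) (auto simp: \<Gamma>_def)
  have split: "(\<Sum>w\<in>\<Delta>. \<kappa> (z w) * W0.word w) = (\<Sum>w\<in>\<Delta> - \<Gamma>. \<kappa> (z w) * W0.word w) + (\<Sum>w\<in>\<Gamma>. \<kappa> (z w) * W0.word w)"
    using \<Delta>(1) \<Gamma>(2) by (rule sum.subset_diff[rotated])
  have a0: "a 0 - (\<Sum>w\<in>\<Gamma>. \<kappa> (z w) * W0.word w) \<in> Q 0"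
    using two_sided_add[OF I0 \<Delta>(3) small] unfolding split by (simp add: algebra_simps)
  have "\<Gamma> \<noteq> {}"
    using a0 a[of 0] by auto
  have "a 0 - (\<Sum>w\<in>\<Gamma>. \<kappa> (z w) * W0.word w) \<in> Q 1"
    using a0 Q_mono[of 0 1] by auto
  then have sum1: "(\<Sum>w\<in>\<Gamma>. \<kappa> (z w) * W1.word w) \<in> Q 1"
    using two_sided_cong[OF I1] a[of 0] by (auto simp: W1.word_def W0.word_def)
  define k where "k = Max (length ` \<Gamma>)"
  define R where "R = int (\<Sum>w\<in>\<Gamma>. weight w)"
  have top: "\<exists>w\<in>\<Gamma>. length w = k"
    using Max_in[of "length ` \<Gamma>"] \<Gamma>(1) \<open>\<Gamma> \<noteq> {}\<close> unfolding k_def by fastforce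
  have letters: "set w \<subseteq> S \<and> length w \<le> k \<and> (\<forall>x\<in>set w. \<bar>x\<bar> \<le> R)" if w: "w \<in> \<Gamma>" for w
  proof (intro conjI ballI)
    show "set w \<subseteq> S"
      using w \<Gamma>(2) \<Delta>(2) by blast
    show "length w \<le> k"
      unfolding k_def using \<Gamma>(1) w by simp
    fix x assume "x \<in> set w"
    then have "nat \<bar>x\<bar> \<le> weight w"
      by (intro member_le_sum_list) auto
    also have "\<dots> \<le> (\<Sum>w\<in>\<Gamma>. weight w)"
      using \<Gamma>(1) w by (intro member_le_sum) auto
    finally show "\<bar>x\<bar> \<le> R"
      unfolding R_def by linarith
  qed
  have inj: "inj_on mset \<Gamma>"
  proof (rule inj_onI)
    fix v w assume "v \<in> \<Gamma>" "w \<in> \<Gamma>" "mset v = mset w"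
    then show "v = w"
      using \<Gamma>(2) \<Delta>(2) properties_for_sort[of v w] sorted_sort_id[of w] by force
  qed
  have R: "0 \<le> R"
    unfolding R_def by (rule of_nat_0_le_iff)
  have char1: "i = 0" if "of_int i \<in> Q 1" for i
    using that char0 scalars[of "of_int i" 1] by (simp add: \<kappa>_of_int)
  have reduce: "W1.word xs \<in> tspan (Q 1) (W1.word ` W1.normal_words k R N)"
    if "word_size k R xs \<le> N" "set xs \<subseteq> S" for xs N
    using that
  proof (rule W1.word_in_normal_tspan[OF Q(1)[of 1], rotated])
    fix us H
    assume "length us = k" "set us \<subseteq> S" "weight us \<le> H"
      "(\<forall>u\<in>set us. 3 * R + 1 \<le> u) \<or> (\<forall>u\<in>set us. u \<le> - (3 * R + 1))"
    then show "\<exists>s. \<kappa> s \<notin> Q 1 \<and> \<kappa> s * W1.word us \<in> W1.wspan (\<lambda>zs. lower k R H zs us)"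
      by (intro W1.reducible[OF Q(1) char1 S \<Gamma>(1) inj sum1 letters _ top R]) (auto simp: \<Gamma>_def)
  qed
  define D where "D = length [- (3 * R + 1)..3 * R + 1] + 2 * k"
  define as where "as = map (\<lambda>m. a (Suc m)) [0..<Suc D]"
  have ind: "independent (Q 1) n as" for n
    using independent_chain[of "\<lambda>m. Q (Suc m)" "\<lambda>m. a (Suc m)" 0 n "Suc D"] Q a scalars
    unfolding as_def by (simp add: psubset_imp_subset del: upt_Suc) blast
  have "\<exists>r. x \<in> W1.wspan (\<lambda>xs. word_size k R xs \<le> r)" for x
  proof (rule W1.wspan_bounded)
    have "x \<in> W0.wspan (\<lambda>_. True)"
      by (simp add: span0)
    then show "x \<in> W1.wspan (\<lambda>_. True)"
      unfolding W0.wspan_def W1.wspan_def W0.word_def W1.word_def using Q_mono[of 0 1]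
      by (elim lspan_mono) auto
  qed
  then obtain \<rho> where \<rho>: "\<And>x. x \<in> W1.wspan (\<lambda>xs. word_size k R xs \<le> \<rho> x)"
    by metis
  define r where "r = Suc (\<Sum>x\<leftarrow>as. \<rho> x)"
  have bounded: "\<forall>x\<in>set as. x \<in> W1.wspan (\<lambda>xs. word_size k R xs \<le> r)"
  proof
    fix x assume "x \<in> set as"
    then have "\<rho> x \<le> r"
      using member_le_sum_list[of "\<rho> x" "map \<rho> as"] by (simp add: r_def)
    then show "x \<in> W1.wspan (\<lambda>xs. word_size k R xs \<le> r)"
      by (intro W1.wspan_mono[OF \<rho>[of x]]) auto
  qed
  define n where "n = (3 * r * Suc D) ^ D + 1"
  define N where "N = r * (Suc D * n)"
  have len: "length as = Suc D"
    by (simp add: as_def)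
  let ?B = "W1.word ` W1.normal_words k R N"
  have "card ?B \<le> (2 * N + 1) ^ D"
    using card_image_le[OF W1.card_normal_words(1)[OF R]] W1.card_normal_words(2)[OF R, of k N]
    unfolding D_def by (meson le_trans)
  also have "\<dots> < n ^ Suc D"
    unfolding N_def n_def by (rule polynomial_below_power) (simp_all add: r_def)
  also have "\<dots> = card (exponents n (length as))"
    by (simp add: card_exponents len)
  finally have "card ?B < card (exponents n (length as))" .
  moreover have "monomial as ks \<in> tspan (Q 1) ?B" if "ks \<in> exponents n (length as)" for ks
  proof -
    have "monomial as ks \<in> W1.wspan (\<lambda>xs. word_size k R xs \<le> N)"
      using W1.monomial_bounded[OF bounded that] by (simp add: N_def len)
    then show ?thesis
      unfolding W1.wspan_def by (rule tspan_bind[OF Q(1)]) (use reduce in auto)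
  qed
  moreover have "finite ?B"
    using W1.card_normal_words(1)[OF R] by blast
  ultimately obtain \<mu> where "\<exists>ks\<in>exponents n (length as). \<kappa> (\<mu> ks) \<notin> Q 1"
    "(\<Sum>ks\<in>exponents n (length as). \<kappa> (\<mu> ks) * monomial as ks) \<in> Q 1"
    using rank_bound[OF Q(1)[of 1] _ finite_exponents, of ?B n "length as" "monomial as"] by blast
  then show False
    using ind[of n] unfolding independent_def by blast
qed

text \<open>The hypothesis \<open>generated\<close> says that the ring is generated modulo \<open>Q 0\<close> by
  the scalars and the \<open>e\<^sub>i\<close>, in the form of an induction principle.\<close>

theorem chain_stabilizes:
  fixes Q :: "nat \<Rightarrow> 'a set" and e :: "int \<Rightarrow> 'a" and \<omega> :: "int \<Rightarrow> int \<Rightarrow> 'z"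
  assumes Q: "\<And>n. completely_prime (Q n)" "\<And>n. Q n \<subseteq> Q (Suc n)"
    and scalars: "\<And>n s. \<kappa> s \<in> Q n \<longleftrightarrow> \<kappa> s \<in> Q 0"
    and char0: "\<And>i. of_int i \<in> Q 0 \<Longrightarrow> i = 0"
    and S: "S = UNIV \<or> S = {1..}"
    and relation: "\<And>i j. i \<in> S \<Longrightarrow> j \<in> S \<Longrightarrow>
      e i * e j - e j * e i - (of_int (j - i) * e (i + j) + \<kappa> (\<omega> i j)) \<in> Q 0"
    and generated: "\<And>X. Q 0 \<subseteq> X \<Longrightarrow> (\<And>s. \<kappa> s \<in> X) \<Longrightarrow> (\<And>i. i \<in> S \<Longrightarrow> e i \<in> X) \<Longrightarrow>
      (\<And>x y. x \<in> X \<Longrightarrow> y \<in> X \<Longrightarrow> x + y \<in> X) \<Longrightarrow> (\<And>x y. x \<in> X \<Longrightarrow> y \<in> X \<Longrightarrow> x * y \<in> X) \<Longrightarrow> X = UNIV"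
  shows "\<exists>N. \<forall>n\<ge>N. Q n = Q N"
proof (rule ccontr)
  assume "\<nexists>N. \<forall>n\<ge>N. Q n = Q N"
  from strict_subchain[of Q, OF Q(2) this] obtain h
    where h: "h 0 = 0" "\<forall>m. Q (h m) \<subset> Q (h (Suc m))"
    by blast
  show False
    by (rule no_strict_chain[of "\<lambda>m. Q (h m)" S e \<omega>])
      (use Q(1) h scalars char0 S relation generated in auto)
qed

end

section \<open>Completely prime ideals of a quotient ring\<close>

lemma (in completely_prime_ideal) one_notin: "\<one> \<notin> P"
proof
  assume "\<one> \<in> P"
  then have "P +> \<one> = P"
    using a_coset_join2[OF _ a_subgroup] by simp
  then show False
    using noncomm_domain.one_not_zero[OF quotient_domain] by (simp add: FactRing_def)
qed

lemma (in completely_prime_ideal) mult_in_imp: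
  assumes "a \<otimes> b \<in> P" "a \<in> carrier R" "b \<in> carrier R"
  shows "a \<in> P \<or> b \<in> P"
proof -
  have "(P +> a) \<otimes>\<^bsub>R Quot P\<^esub> (P +> b) = P +> (a \<otimes> b)"
    using assms(2,3) by (simp add: FactRing_def rcoset_mult_add)
  also have "\<dots> = \<zero>\<^bsub>R Quot P\<^esub>"
    using a_coset_join2[OF _ a_subgroup assms(1)] assms(2,3) by (simp add: FactRing_def)
  finally have "P +> a = P \<or> P +> b = P"
    using noncomm_domain.integral[OF quotient_domain] assms(2,3) ring_hom_closed[OF rcos_ring_hom]
    by (auto simp: FactRing_def)
  then show ?thesis
    using a_coset_join1 a_subgroup assms(2,3) by blast
qed

text \<open>Completely prime ideals of \<open>R Quot I\<close> correspond to their unions, which are ideals of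
  \<open>R\<close> above \<open>I\<close>. For an enveloping algebra this replaces cosets by
  elements of the free algebra.\<close>

lemma (in ring) acc_completely_prime_quotient:
  assumes I: "ideal I R"
    and acc: "\<And>J :: nat \<Rightarrow> 'a set. (\<And>n. ideal (J n) R \<and> I \<subseteq> J n \<and> \<one> \<notin> J n \<and>
        (\<forall>a\<in>carrier R. \<forall>b\<in>carrier R. a \<otimes> b \<in> J n \<longrightarrow> a \<in> J n \<or> b \<in> J n)) \<Longrightarrow>
      (\<And>n. J n \<subseteq> J (Suc n)) \<Longrightarrow> \<exists>N. \<forall>n\<ge>N. J n = J N"
  shows "acc_completely_prime (R Quot I)"
  unfolding acc_completely_prime_def
proof (intro allI impI, elim conjE)
  fix P :: "nat \<Rightarrow> 'a set set"
  assume P: "\<forall>n. completely_prime_ideal (P n) (R Quot I)" and mono: "\<forall>n. P n \<subseteq> P (Suc n)"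
  \<comment> \<open>The preimage of \<open>P n\<close> under the projection.\<close>
  define J where "J n = \<Union> (P n)" for n
  have P_ideal: "ideal (P n) (R Quot I)" for n
    using P by (simp add: completely_prime_ideal_def)
  have sub: "P n \<subseteq> carrier (R Quot I)" for n
    using additive_subgroup.a_subset[OF ideal.axioms(1)[OF P_ideal]] .
  have J_iff: "a \<in> J n \<longleftrightarrow> I +> a \<in> P n" if "a \<in> carrier R" for a n
    unfolding J_def by (rule canonical_proj_vimage_mem_iff[OF I sub that])
  have hom: "(+>) I \<in> ring_hom R (R Quot I)"
    by (rule ideal.rcos_ring_hom[OF I])
  have "\<exists>N. \<forall>n\<ge>N. J n = J N"
  proof (rule acc)
    fix n
    interpret P: completely_prime_ideal "P n" "R Quot I"
      using P by blast
    show "ideal (J n) R \<and> I \<subseteq> J n \<and> \<one> \<notin> J n \<and>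
        (\<forall>a\<in>carrier R. \<forall>b\<in>carrier R. a \<otimes> b \<in> J n \<longrightarrow> a \<in> J n \<or> b \<in> J n)"
    proof (intro conjI ballI impI)
      show "ideal (J n) R"
        unfolding J_def by (rule quot_ideal_imp_ring_ideal[OF I P_ideal])
      show "I \<subseteq> J n"
        using additive_subgroup.zero_closed[OF ideal.axioms(1)[OF P_ideal]]
        unfolding J_def by (auto simp: FactRing_def)
      show "\<one> \<notin> J n"
        using P.one_notin J_iff[of \<one> n] ring_hom_one[OF hom] by auto
      show "a \<in> J n \<or> b \<in> J n" if "a \<in> carrier R" "b \<in> carrier R" "a \<otimes> b \<in> J n" for a b
        using that P.mult_in_imp[of "I +> a" "I +> b"] ring_hom_mult[OF hom that(1,2)]
          ring_hom_closed[OF hom] by (simp add: J_iff)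
    qed
    show "J n \<subseteq> J (Suc n)"
      using mono by (auto simp: J_def)
  qed
  moreover have "P n = (+>) I ` J n" for n
  proof -
    have "\<exists>a\<in>carrier R. p = I +> a" if "p \<in> P n" for p
      using that sub[of n] by (auto simp: FactRing_def A_RCOSETS_def')
    moreover have "J n \<subseteq> carrier R"
      unfolding J_def by (rule canonical_proj_vimage_in_carrier[OF I sub])
    ultimately show ?thesis
      using J_iff by blast
  qed
  ultimately show "\<exists>N. \<forall>n\<ge>N. P n = P N"
    by metis
qed

section \<open>Ascending chains of ideals of polynomials\<close>

text \<open>A nonzero polynomial of least degree in the union of the chain generates the union, and it already
  lies in some member of the chain.\<close>

lemma poly_ideal_chain_stabilizes:
  fixes J :: "nat \<Rightarrow> 'k::field poly set"
  assumes ideal: "\<And>n. 0 \<in> J n" "\<And>n p q. p \<in> J n \<Longrightarrow> q \<in> J n \<Longrightarrow> p + q \<in> J n" "\<And>n p q. p \<in> J n \<Longrightarrow> q * p \<in> J n"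
    and mono: "\<And>n. J n \<subseteq> J (Suc n)"
  shows "\<exists>N. \<forall>n\<ge>N. J n = J N"
proof (cases "\<forall>n. J n = {0}")
  case False
  then obtain p where "p \<noteq> 0 \<and> (\<exists>n. p \<in> J n)"
    using ideal(1) by blast
  from ex_has_least_nat[of "\<lambda>p. p \<noteq> 0 \<and> (\<exists>n. p \<in> J n)" _ degree, OF this]
  obtain g where g': "(g \<noteq> 0 \<and> (\<exists>n. g \<in> J n)) \<and>
      (\<forall>p. p \<noteq> 0 \<and> (\<exists>n. p \<in> J n) \<longrightarrow> degree g \<le> degree p)"
    by (rule exE)
  note g = conjunct1[OF g'] conjunct2[OF g']
  obtain N where N: "g \<in> J N"
    using g(1) by blast
  have J_mono: "J m \<subseteq> J n" if "m \<le> n" for m n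
    using mono by (rule lift_Suc_mono_le[OF _ that])
  have "J n = J N" if n: "N \<le> n" for n
  proof (rule equalityI[OF subsetI J_mono[OF n]])
    fix p assume p: "p \<in> J n"
    have "g \<in> J n"
      using J_mono[OF n] N by blast
    then have "p + (- (p div g)) * g \<in> J n"
      using ideal(2)[OF p ideal(3)] by blast
    moreover have "p + (- (p div g)) * g = p mod g"
      using minus_div_mult_eq_mod[of p g] by simp
    ultimately have "p mod g \<in> J n"
      by simp
    have "p mod g = 0"
      using g(2) degree_mod_less[of g p] g(1) \<open>p mod g \<in> J n\<close> by (meson not_le)
    then have "p = (p div g) * g"
      using div_mult_mod_eq[of p g] by simp
    moreover have "(p div g) * g \<in> J N"
      by (rule ideal(3)[OF N])
    ultimately show "p \<in> J N"
      by simp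
  qed
  then show ?thesis
    by blast
qed auto

section \<open>Evaluation of words over a polynomial ring\<close>

text \<open>Horner evaluation at a point of a noncommutative ring; the map \<open>s\<close> embeds the
  coefficients.\<close>

definition poly_at :: "'a::ring_1 \<Rightarrow> ('k::comm_ring_1 \<Rightarrow> 'a) \<Rightarrow> 'k poly \<Rightarrow> 'a"
  where "poly_at z s p = fold_coeffs (\<lambda>a x. s a + z * x) p 0"

lemma poly_at_0 [simp]: "poly_at z s 0 = 0"
  by (simp add: poly_at_def)

context central_scalars
begin

lemma poly_at_pCons: "poly_at z \<kappa> (pCons a p) = \<kappa> a + z * poly_at z \<kappa> p"
  by (cases "a = 0 \<and> p = 0") (auto simp: poly_at_def)

lemma poly_at_add: "poly_at z \<kappa> (p + q) = poly_at z \<kappa> p + poly_at z \<kappa> q"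
  by (induction p q rule: poly_induct2) (simp_all add: poly_at_pCons \<kappa>_add algebra_simps)

lemma poly_at_smult: "poly_at z \<kappa> (smult a p) = \<kappa> a * poly_at z \<kappa> p"
  by (induction p) (simp_all add: poly_at_pCons \<kappa>_mult distrib_left \<kappa>_left)

lemma poly_at_mult: "poly_at z \<kappa> (p * q) = poly_at z \<kappa> p * poly_at z \<kappa> q"
  by (induction p) (simp_all add: poly_at_pCons poly_at_add poly_at_smult distrib_right mult.assoc)

lemma poly_at_const: "poly_at z \<kappa> [:a:] = \<kappa> a"
  by (simp add: poly_at_pCons)

end

lemma central_scalars_single:
  "central_scalars (Poly_Mapping.single 0 :: 'k::comm_ring_1 \<Rightarrow> ('b::monoid_add \<Rightarrow>\<^sub>0 'k))"
proof
  show "Poly_Mapping.single 0 x * a = a * Poly_Mapping.single 0 x" for x :: 'k and a :: "'b \<Rightarrow>\<^sub>0 'k"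
    by (induction a rule: single_add_induct) (simp_all add: mult_single mult.commute algebra_simps)
qed (simp_all add: single_add mult_single)

lemma sum_singles: "(\<Sum>u\<in>Poly_Mapping.keys t. Poly_Mapping.single u (Poly_Mapping.lookup t u)) = t"
  by (rule poly_mapping_eqI) (auto simp: lookup_sum lookup_single when_def in_keys_iff)

lemma keys_superset_sum:
  assumes "finite A" "Poly_Mapping.keys t \<subseteq> A" "\<And>w. f w 0 = (0 :: 'b::comm_monoid_add)"
  shows "(\<Sum>w\<in>Poly_Mapping.keys t. f w (Poly_Mapping.lookup t w)) = (\<Sum>w\<in>A. f w (Poly_Mapping.lookup t w))"
  using assms by (intro sum.mono_neutral_left) (auto simp: in_keys_iff)

section \<open>Enveloping algebras of Lie algebras with Witt relations\<close>

text \<open>The common shape of the three Lie algebras: they are spanned by elements \<open>E i\<close> with the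
  Witt bracket up to multiples of one central element \<open>z\<close>. Taking \<open>z = 0\<close>
  gives the Witt algebra and its positive part.\<close>

locale witt_presentation = lie_algebra scale bracket
  for scale :: "'k::field_char_0 \<Rightarrow> 'l::ab_group_add \<Rightarrow> 'l" and bracket +
  fixes L :: "'l set" and S :: "int set" and E :: "int \<Rightarrow> 'l" and z :: 'l and w :: "int \<Rightarrow> int \<Rightarrow> 'k"
  assumes subalgebra: "lie_subalgebra L"
    and S: "S = UNIV \<or> S = {1..}"
    and E_in: "i \<in> S \<Longrightarrow> E i \<in> L" and z_in: "z \<in> L"
    and z_central: "x \<in> L \<Longrightarrow> bracket z x = 0"
    and bracket_E: "i \<in> S \<Longrightarrow> j \<in> S \<Longrightarrow>
      bracket (E i) (E j) = scale (of_int (j - i)) (E (i + j)) + scale (w i j) z"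
    and spans: "L \<subseteq> span (insert z (E ` S))"
begin

abbreviation scalar :: "'k \<Rightarrow> 'l free_monoid \<Rightarrow>\<^sub>0 'k"
  where "scalar \<equiv> Poly_Mapping.single 0"

abbreviation C :: "('l free_monoid \<Rightarrow>\<^sub>0 'k) set"
  where "C \<equiv> carrier (free_algebra L)"

lemma subspace_L: "subspace L"
  using subalgebra by (simp add: lie_subalgebra_def)

lemma C_zero: "0 \<in> C" and C_one: "1 \<in> C" and C_scalar: "scalar a \<in> C"
  by (auto simp: free_algebra_def)

lemma C_add: "p \<in> C \<Longrightarrow> q \<in> C \<Longrightarrow> p + q \<in> C"
  using ring.ring_simprules(1)[OF free_algebra_ring, of p L q] by (simp add: free_algebra_def)

lemma C_mult: "p \<in> C \<Longrightarrow> q \<in> C \<Longrightarrow> p * q \<in> C"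
  using ring.ring_simprules(5)[OF free_algebra_ring, of p L q] by (simp add: free_algebra_def)

lemma C_gen: "x \<in> L \<Longrightarrow> gen x \<in> C"
  by (rule gen_in_free_algebra)

lemma C_uminus: "p \<in> C \<Longrightarrow> - p \<in> C"
  by (auto simp: free_algebra_def in_keys_iff)

lemma C_sum: "(\<And>i. i \<in> A \<Longrightarrow> f i \<in> C) \<Longrightarrow> sum f A \<in> C"
  by (induction A rule: infinite_finite_induct) (auto intro: C_zero C_add)

text \<open>Every element of the free algebra on \<open>L\<close> is a polynomial in the generators from
  \<open>L\<close>.\<close>

lemma C_induct [consumes 1, case_names scalar gen add mult]:
  assumes "x \<in> C"
    and scalar: "\<And>a. P (scalar a)" and gen: "\<And>l. l \<in> L \<Longrightarrow> P (gen l)"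
    and add: "\<And>x y. x \<in> C \<Longrightarrow> y \<in> C \<Longrightarrow> P x \<Longrightarrow> P y \<Longrightarrow> P (x + y)"
    and mult: "\<And>x y. x \<in> C \<Longrightarrow> y \<in> C \<Longrightarrow> P x \<Longrightarrow> P y \<Longrightarrow> P (x * y)"
  shows "P x"
proof -
  have word: "P (Poly_Mapping.single (Word xs) a) \<and> Poly_Mapping.single (Word xs) a \<in> C" if "set xs \<subseteq> L" for xs a
    using that
  proof (induction xs)
    case Nil
    show ?case
      using scalar[of a] C_scalar[of a] by (simp add: zero_free_monoid_def)
  next
    case (Cons x xs)
    have "Poly_Mapping.single (Word (x # xs)) a = gen x * Poly_Mapping.single (Word xs) a"
      by (simp add: gen_def mult_single plus_free_monoid_def)
    then show ?case
      using Cons mult[OF C_gen] gen by (simp add: C_mult C_gen)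
  qed
  have "P (\<Sum>u\<in>A. Poly_Mapping.single u (Poly_Mapping.lookup x u)) \<and>
      (\<Sum>u\<in>A. Poly_Mapping.single u (Poly_Mapping.lookup x u)) \<in> C"
    if "finite A" "A \<subseteq> Poly_Mapping.keys x" for A
    using that
  proof (induction A)
    case empty
    show ?case
      using scalar[of 0] C_zero by simp
  next
    case (insert u A)
    have "set (letters u) \<subseteq> L"
      using assms(1) insert by (auto simp: free_algebra_def)
    then have "P (Poly_Mapping.single u (Poly_Mapping.lookup x u)) \<and> Poly_Mapping.single u (Poly_Mapping.lookup x u) \<in> C"
      using word[of "letters u"] by simp
    then show ?case
      using insert by (simp add: add C_add)
  qed
  from this[of "Poly_Mapping.keys x"] show ?thesis
    by (simp add: sum_singles)
qed

text \<open>Letters outside \<open>S\<close> are sent to the zero vector, whose generator vanishes in the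
  enveloping algebra. Words over all of \<open>\<int>\<close> can then serve for the positive Witt
  algebra as well.\<close>

definition E0 :: "int \<Rightarrow> 'l"
  where "E0 i = (if i \<in> S then E i else 0)"

definition eval_word :: "int list \<Rightarrow> 'l free_monoid \<Rightarrow>\<^sub>0 'k"
  where "eval_word xs = prod_list (map (\<lambda>i. gen (E0 i)) xs)"

text \<open>The free algebra over \<open>K[X]\<close> on letters \<open>i\<close>, where scalars are central on
  the nose, is mapped to the free algebra on \<open>L\<close> by sending \<open>X\<close> to
  \<open>z\<close> and the letters to the \<open>E i\<close>. Since \<open>z\<close> becomes central
  only in the enveloping algebra, \<open>\<psi>\<close> is additive but multiplicative only modulo
  the defining relations.\<close>

definition \<psi> :: "(int free_monoid \<Rightarrow>\<^sub>0 'k poly) \<Rightarrow> 'l free_monoid \<Rightarrow>\<^sub>0 'k"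
  where "\<psi> t = (\<Sum>u\<in>Poly_Mapping.keys t. poly_at (gen z) scalar (Poly_Mapping.lookup t u) * eval_word (letters u))"

sublocale scalars: central_scalars scalar
  by (rule central_scalars_single)

lemma \<psi>_single: "\<psi> (Poly_Mapping.single u p) = poly_at (gen z) scalar p * eval_word (letters u)"
  by (simp add: \<psi>_def)

lemma \<psi>_zero: "\<psi> 0 = 0"
  by (simp add: \<psi>_def)

lemma \<psi>_add: "\<psi> (s + t) = \<psi> s + \<psi> t"
proof -
  let ?A = "Poly_Mapping.keys s \<union> Poly_Mapping.keys t"
  have "\<psi> r = (\<Sum>u\<in>?A. poly_at (gen z) scalar (Poly_Mapping.lookup r u) * eval_word (letters u))"
    if "Poly_Mapping.keys r \<subseteq> ?A" for r
    unfolding \<psi>_def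
    using keys_superset_sum[of ?A r "\<lambda>u p. poly_at (gen z) scalar p * eval_word (letters u)"] that by simp
  then show ?thesis
    using keys_add[of s t] by (simp add: lookup_add scalars.poly_at_add distrib_right sum.distrib)
qed

lemma \<psi>_uminus: "\<psi> (- t) = - \<psi> t"
  using \<psi>_add[of t "- t"] by (simp add: \<psi>_zero eq_neg_iff_add_eq_0 add.commute)

lemma \<psi>_diff: "\<psi> (s - t) = \<psi> s - \<psi> t"
  using \<psi>_add[of s "- t"] by (simp add: \<psi>_uminus)

lemma E0_in: "E0 i \<in> L"
  using E_in subspace_0[OF subspace_L] by (simp add: E0_def)

lemma eval_word_C: "eval_word xs \<in> C"
  by (induction xs) (auto simp: eval_word_def intro: C_one C_mult C_gen E0_in)

lemma poly_at_C: "poly_at (gen z) scalar p \<in> C"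
  by (induction p) (auto simp: scalars.poly_at_pCons intro!: C_zero C_add C_mult C_gen C_scalar z_in)

lemma \<psi>_C: "\<psi> t \<in> C"
  unfolding \<psi>_def by (intro C_sum C_mult eval_word_C poly_at_C)

definition letter :: "int \<Rightarrow> int free_monoid \<Rightarrow>\<^sub>0 'k poly"
  where "letter i = Poly_Mapping.single (Word [i]) 1"

definition contains_relations :: "('l free_monoid \<Rightarrow>\<^sub>0 'k) set \<Rightarrow> bool"
  where "contains_relations J \<longleftrightarrow> ideal J (free_algebra L) \<and> enveloping_relations scale bracket L \<subseteq> J"

context
  fixes J :: "('l free_monoid \<Rightarrow>\<^sub>0 'k) set"
  assumes J: "contains_relations J"
begin

lemma J_zero: "0 \<in> J"
  using J additive_subgroup.zero_closed[OF ideal.axioms(1), of J "free_algebra L"]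
  unfolding contains_relations_def by (simp add: free_algebra_def)

lemma J_add: "x \<in> J \<Longrightarrow> y \<in> J \<Longrightarrow> x + y \<in> J"
  using J additive_subgroup.a_closed[OF ideal.axioms(1), of J "free_algebra L" x y]
  unfolding contains_relations_def by (simp add: free_algebra_def)

lemma J_left: "x \<in> J \<Longrightarrow> a \<in> C \<Longrightarrow> a * x \<in> J"
  using J ideal.I_l_closed[of J "free_algebra L" x a]
  unfolding contains_relations_def by (simp add: free_algebra_def)

lemma J_right: "x \<in> J \<Longrightarrow> a \<in> C \<Longrightarrow> x * a \<in> J"
  using J ideal.I_r_closed[of J "free_algebra L" x a]
  unfolding contains_relations_def by (simp add: free_algebra_def)

lemma J_uminus: "x \<in> J \<Longrightarrow> - x \<in> J"
  using J_left[of x "- 1"] C_uminus[OF C_one] by simp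

lemma J_diff: "x \<in> J \<Longrightarrow> y \<in> J \<Longrightarrow> x - y \<in> J"
  using J_add[of x "- y"] J_uminus by simp

lemma J_cong: "x - y \<in> J \<Longrightarrow> x \<in> J \<longleftrightarrow> y \<in> J"
  using J_add[of "x - y" y] J_diff[of x "x - y"] by auto

lemma gen_add: "gen (x + y) - (gen x + gen y) \<in> J" if "x \<in> L" "y \<in> L"
proof -
  have "gen (x + y) - (gen x + gen y) \<in> enveloping_relations scale bracket L"
    unfolding enveloping_relations_def using that
    by (intro UnI1 CollectI exI[of _ x] exI[of _ y]) simp
  then show ?thesis
    using J unfolding contains_relations_def by (elim conjE subsetD)
qed

lemma gen_scale: "gen (scale a x) - scalar a * gen x \<in> J" if "x \<in> L"
proof -
  have "gen (scale a x) - scalar a * gen x \<in> enveloping_relations scale bracket L"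
    unfolding enveloping_relations_def using that
    by (intro UnI1[OF UnI2] CollectI exI[of _ a] exI[of _ x]) simp
  then show ?thesis
    using J unfolding contains_relations_def by (elim conjE subsetD)
qed

lemma gen_bracket: "gen x * gen y - gen y * gen x - gen (bracket x y) \<in> J" if "x \<in> L" "y \<in> L"
proof -
  have "gen x * gen y - gen y * gen x - gen (bracket x y) \<in> enveloping_relations scale bracket L"
    unfolding enveloping_relations_def using that
    by (intro UnI2 CollectI exI[of _ x] exI[of _ y]) simp
  then show ?thesis
    using J unfolding contains_relations_def by (elim conjE subsetD)
qed

lemma gen_zero: "gen 0 \<in> J"
  using gen_scale[OF z_in, of 0] by simp

text \<open>The commutator with \<open>gen z\<close> is a derivation that sends all generators into
  \<open>J\<close>.\<close>

lemma gen_z_central: "y \<in> C \<Longrightarrow> gen z * y - y * gen z \<in> J"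
proof (induction y rule: C_induct)
  case (scalar a)
  then show ?case
    using scalars.\<kappa>_central[of a "gen z"] J_zero by simp
next
  case (gen l)
  then show ?case
    using J_add[OF gen_bracket[OF z_in gen] gen_zero] z_central by simp
next
  case (add x y)
  then show ?case
    using J_add[OF add(3,4)] by (simp add: algebra_simps)
next
  case (mult x y)
  have "gen z * (x * y) - x * y * gen z = (gen z * x - x * gen z) * y + x * (gen z * y - y * gen z)"
    by (simp add: algebra_simps)
  then show ?case
    using mult by (simp add: J_add J_left J_right)
qed

lemma poly_at_central: "y \<in> C \<Longrightarrow> y * poly_at (gen z) scalar p - poly_at (gen z) scalar p * y \<in> J"
proof (induction p)
  case 0
  then show ?case
    by (simp add: J_zero)
next
  case (pCons a p)
  let ?p = "poly_at (gen z) scalar p"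
  have "y * poly_at (gen z) scalar (pCons a p) - poly_at (gen z) scalar (pCons a p) * y =
      gen z * (y * ?p - ?p * y) - (gen z * y - y * gen z) * ?p"
    using scalars.\<kappa>_central[of a y] by (simp add: scalars.poly_at_pCons algebra_simps)
  then show ?case
    using pCons by (simp add: J_diff J_left J_right gen_z_central C_gen z_in poly_at_C)
qed

lemma \<psi>_mult: "\<psi> (s * t) - \<psi> s * \<psi> t \<in> J"
proof (induction s rule: single_add_induct)
  case (1 u p)
  show ?case
  proof (induction t rule: single_add_induct)
    case (1 v q)
    let ?p = "poly_at (gen z) scalar p" and ?q = "poly_at (gen z) scalar q"
    have "\<psi> (Poly_Mapping.single u p * Poly_Mapping.single v q) - \<psi> (Poly_Mapping.single u p) * \<psi> (Poly_Mapping.single v q) =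
       - (?p * (eval_word (letters u) * ?q - ?q * eval_word (letters u)) * eval_word (letters v))"
      by (simp add: mult_single \<psi>_single scalars.poly_at_mult eval_word_def algebra_simps)
    then show ?case
      by (simp add: J_uminus J_left J_right poly_at_central poly_at_C eval_word_C)
  next
    case (2 f g)
    then show ?case
      using J_add[OF 2] by (simp add: \<psi>_add algebra_simps)
  qed
next
  case (2 f g)
  then show ?case
    using J_add[OF 2] by (simp add: \<psi>_add algebra_simps)
qed

text \<open>It suffices to reach the generators from \<open>L\<close>. Those that are reached form a subspace,
  because \<open>gen\<close> is linear modulo \<open>J\<close>, and this subspace contains
  \<open>z\<close> and all \<open>E i\<close>.\<close>

lemma \<psi>_surj: "x \<in> C \<Longrightarrow> \<exists>t. x - \<psi> t \<in> J"
proof (induction x rule: C_induct)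
  case (scalar a)
  have "scalar a = \<psi> (Poly_Mapping.single 0 [:a:])"
    by (simp add: \<psi>_single scalars.poly_at_const eval_word_def)
  then show ?case
    using J_zero by (metis diff_self)
next
  case (gen l)
  let ?Y = "{l\<in>L. \<exists>t. gen l - \<psi> t \<in> J}"
  have "subspace ?Y"
  proof (rule subspaceI)
    show "0 \<in> ?Y"
      using gen_zero subspace_0[OF subspace_L] by (auto intro!: exI[of _ 0] simp: \<psi>_zero)
  next
    fix x y assume "x \<in> ?Y" "y \<in> ?Y"
    then obtain s t where st: "x \<in> L" "y \<in> L" "gen x - \<psi> s \<in> J" "gen y - \<psi> t \<in> J"
      by blast
    have "gen (x + y) - \<psi> (s + t) = gen (x + y) - (gen x + gen y) + ((gen x - \<psi> s) + (gen y - \<psi> t))"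
      by (simp add: \<psi>_add)
    also have "\<dots> \<in> J"
      by (rule J_add[OF gen_add[OF st(1,2)] J_add[OF st(3,4)]])
    finally show "x + y \<in> ?Y"
      using subspace_add[OF subspace_L st(1,2)] by blast
  next
    fix a x assume "x \<in> ?Y"
    then obtain s where s: "x \<in> L" "gen x - \<psi> s \<in> J"
      by blast
    have "\<psi> (Poly_Mapping.single 0 [:a:]) = scalar a"
      by (simp add: \<psi>_single scalars.poly_at_const eval_word_def)
    then have "gen (scale a x) - \<psi> (Poly_Mapping.single 0 [:a:] * s) =
      gen (scale a x) - scalar a * gen x + (scalar a * (gen x - \<psi> s) -
        (\<psi> (Poly_Mapping.single 0 [:a:] * s) - \<psi> (Poly_Mapping.single 0 [:a:]) * \<psi> s))"
      by (simp add: algebra_simps)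
    also have "\<dots> \<in> J"
      by (rule J_add[OF gen_scale[OF s(1)] J_diff[OF J_left[OF s(2) C_scalar] \<psi>_mult]])
    finally show "scale a x \<in> ?Y"
      using subspace_scale[OF subspace_L s(1)] by blast
  qed
  moreover have "insert z (E ` S) \<subseteq> ?Y"
  proof -
    have "gen z = \<psi> (Poly_Mapping.single 0 [:0, 1:])"
      by (simp add: \<psi>_single scalars.poly_at_pCons eval_word_def)
    then have "z \<in> ?Y"
      using z_in J_zero by (auto intro!: exI[of _ "Poly_Mapping.single 0 [:0, 1:]"])
    moreover have "gen (E i) = \<psi> (Poly_Mapping.single (Word [i]) 1)" if "i \<in> S" for i
      using that by (simp add: \<psi>_single one_pCons scalars.poly_at_const eval_word_def E0_def)
    then have "E i \<in> ?Y" if "i \<in> S" for i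
      using E_in[OF that] J_zero that by (auto intro!: exI[of _ "Poly_Mapping.single (Word [i]) 1"])
    ultimately show ?thesis
      by blast
  qed
  ultimately have "span (insert z (E ` S)) \<subseteq> ?Y"
    by (intro span_minimal)
  then show ?case
    using spans gen by blast
next
  case (add x y)
  then obtain s t where "x - \<psi> s \<in> J" "y - \<psi> t \<in> J"
    by blast
  then have "x + y - \<psi> (s + t) \<in> J"
    using J_add[of "x - \<psi> s" "y - \<psi> t"] by (simp add: \<psi>_add algebra_simps)
  then show ?case
    by blast
next
  case (mult x y)
  then obtain s t where st: "x - \<psi> s \<in> J" "y - \<psi> t \<in> J"
    by blast
  have "x * y - \<psi> (s * t) = (x - \<psi> s) * y + \<psi> s * (y - \<psi> t) - (\<psi> (s * t) - \<psi> s * \<psi> t)"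
    by (simp add: algebra_simps)
  also have "\<dots> \<in> J"
    by (rule J_diff[OF J_add[OF J_right[OF st(1) mult(2)] J_left[OF st(2) \<psi>_C]] \<psi>_mult])
  finally show ?case
    by blast
qed

lemma \<psi>_relation:
  assumes "i \<in> S" "j \<in> S"
  shows "\<psi> (letter i * letter j - letter j * letter i -
    (of_int (j - i) * letter (i + j) + Poly_Mapping.single 0 [:0, w i j:])) \<in> J"
proof -
  have S_add: "i + j \<in> S"
    using S assms by auto
  have gg: "\<psi> (letter i * letter j) = gen (E i) * gen (E j)" if "i \<in> S" "j \<in> S" for i j
    using that by (simp add: letter_def mult_single \<psi>_single one_pCons scalars.poly_at_const eval_word_def
        E0_def plus_free_monoid_def)
  have "of_int m * letter i = Poly_Mapping.single (Word [i]) [:of_int m:]" for m i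
    unfolding letter_def central_scalars.\<kappa>_of_int[OF central_scalars_single, symmetric]
    by (simp add: mult_single of_int_poly)
  then have "\<psi> (of_int (j - i) * letter (i + j)) = scalar (of_int (j - i)) * gen (E (i + j))"
    using S_add by (simp add: \<psi>_single scalars.poly_at_const eval_word_def E0_def del: of_int_diff)
  moreover have "\<psi> (Poly_Mapping.single 0 [:0, w i j:]) = scalar (w i j) * gen z"
    using scalars.\<kappa>_central[of "w i j" "gen z"] by (simp add: \<psi>_single scalars.poly_at_pCons eval_word_def)
  ultimately have "\<psi> (letter i * letter j - letter j * letter i - (of_int (j - i) * letter (i + j) + Poly_Mapping.single 0 [:0, w i j:])) =
    (gen (E i) * gen (E j) - gen (E j) * gen (E i) - gen (bracket (E i) (E j))) +
    (gen (scale (of_int (j - i)) (E (i + j)) + scale (w i j) z) -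
      (gen (scale (of_int (j - i)) (E (i + j))) + gen (scale (w i j) z))) +
    ((gen (scale (of_int (j - i)) (E (i + j))) - scalar (of_int (j - i)) * gen (E (i + j))) +
     (gen (scale (w i j) z) - scalar (w i j) * gen z))"
    by (simp only: \<psi>_add \<psi>_diff gg assms bracket_E) (simp add: algebra_simps)
  also have "\<dots> \<in> J"
    using assms S_add by (intro J_add gen_bracket gen_add gen_scale subspace_scale[OF subspace_L] E_in z_in)
  finally show ?thesis .
qed

end

text \<open>A chain of completely prime ideals is pulled back along \<open>\<psi>\<close> to the free
  \<open>K[X]\<close>-algebra on the letters. There its traces on \<open>K[X]\<close> stabilize at
  some stage \<open>N\<close>, and the abstract result applies to the chain from \<open>N\<close>
  on. Since \<open>\<psi>\<close> is surjective modulo the relations, the original ideals are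
  recovered from their preimages.\<close>

theorem acc_enveloping_algebra: "acc_completely_prime (enveloping_algebra scale bracket L)"
  unfolding enveloping_algebra_def
proof (rule ring.acc_completely_prime_quotient[OF free_algebra_ring])
  have sub: "enveloping_relations scale bracket L \<subseteq> C"
    by (rule enveloping_relations_subset[OF subalgebra])
  show "ideal (genideal (free_algebra L) (enveloping_relations scale bracket L)) (free_algebra L)"
    by (rule ring.genideal_ideal[OF free_algebra_ring sub])
  fix J :: "nat \<Rightarrow> ('l free_monoid \<Rightarrow>\<^sub>0 'k) set"
  assume J: "\<And>n. ideal (J n) (free_algebra L) \<and> genideal (free_algebra L) (enveloping_relations scale bracket L) \<subseteq> J n \<and>
      \<one>\<^bsub>free_algebra L\<^esub> \<notin> J n \<and> (\<forall>a\<in>C. \<forall>b\<in>C. a \<otimes>\<^bsub>free_algebra L\<^esub> b \<in> J n \<longrightarrow> a \<in> J n \<or> b \<in> J n)"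
    and mono: "\<And>n. J n \<subseteq> J (Suc n)"
  have rel: "contains_relations (J n)" for n
    using J[of n] subset_trans[OF ring.genideal_self[OF free_algebra_ring sub]]
    unfolding contains_relations_def by (elim conjE) (intro conjI)
  have one: "1 \<notin> J n" for n
    using J[of n] by (simp add: free_algebra_def)
  have prime: "a \<in> J n \<or> b \<in> J n" if "a * b \<in> J n" "a \<in> C" "b \<in> C" for a b n
    using J[of n] that by (simp add: free_algebra_def)
  interpret T: central_scalars "Poly_Mapping.single 0 :: 'k poly \<Rightarrow> int free_monoid \<Rightarrow>\<^sub>0 'k poly"
    by (rule central_scalars_single)
  define Q where "Q n = {t. \<psi> t \<in> J n}" for n
  have Q_prime: "completely_prime (Q n)" for n
  proof -
    note mult_iff = J_cong[OF rel[of n] \<psi>_mult[OF rel[of n]]]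
    have "\<psi> 1 = 1"
      unfolding single_one[symmetric] \<psi>_single by (simp add: one_pCons scalars.poly_at_const eval_word_def)
    then show ?thesis
      unfolding completely_prime_def two_sided_def Q_def Ball_def mem_Collect_eq
    proof (intro conjI ballI allI impI)
      show "\<psi> 0 \<in> J n"
        by (simp add: \<psi>_zero J_zero[OF rel])
      show "\<psi> (x + y) \<in> J n" if "\<psi> x \<in> J n" "\<psi> y \<in> J n" for x y
        unfolding \<psi>_add using that by (rule J_add[OF rel])
      show "\<psi> (a * x) \<in> J n" if "\<psi> x \<in> J n" for a x
        unfolding mult_iff using that by (rule J_left[OF rel _ \<psi>_C])
      show "\<psi> (x * a) \<in> J n" if "\<psi> x \<in> J n" for a x
        unfolding mult_iff using that by (rule J_right[OF rel _ \<psi>_C])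
      show "\<psi> 1 \<notin> J n"
        using one by (simp add: \<open>\<psi> 1 = 1\<close>)
      show "\<psi> x \<in> J n \<or> \<psi> y \<in> J n" if "\<psi> (x * y) \<in> J n" for x y
        using that unfolding mult_iff by (rule prime[OF _ \<psi>_C \<psi>_C])
    qed
  qed
  have Q_mono: "Q n \<subseteq> Q (Suc n)" for n
    using mono by (auto simp: Q_def)
  have "\<exists>N. \<forall>n\<ge>N. {p. Poly_Mapping.single 0 p \<in> Q n} = {p. Poly_Mapping.single 0 p \<in> Q N}"
  proof (rule poly_ideal_chain_stabilizes)
    note Q2 = completely_prime_two_sided[OF Q_prime]
    fix n and p q :: "'k poly"
    show "0 \<in> {p. Poly_Mapping.single 0 p \<in> Q n}"
      by (simp add: two_sided_zero[OF Q2])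
    show "p + q \<in> {p. Poly_Mapping.single 0 p \<in> Q n}"
      if "p \<in> {p. Poly_Mapping.single 0 p \<in> Q n}" "q \<in> {p. Poly_Mapping.single 0 p \<in> Q n}"
      using that unfolding mem_Collect_eq T.\<kappa>_add by (rule two_sided_add[OF Q2])
    show "q * p \<in> {p. Poly_Mapping.single 0 p \<in> Q n}" if "p \<in> {p. Poly_Mapping.single 0 p \<in> Q n}"
      using that unfolding mem_Collect_eq T.\<kappa>_mult by (rule two_sided_mult_left[OF Q2])
    show "{p. Poly_Mapping.single 0 p \<in> Q n} \<subseteq> {p. Poly_Mapping.single 0 p \<in> Q (Suc n)}"
      using Q_mono by blast
  qed
  then obtain N where N: "\<And>n p. N \<le> n \<Longrightarrow> Poly_Mapping.single 0 p \<in> Q n \<longleftrightarrow> Poly_Mapping.single 0 p \<in> Q N"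
    by blast
  have "\<exists>M. \<forall>n\<ge>M. Q (N + n) = Q (N + M)"
  proof (rule T.chain_stabilizes[where Q = "\<lambda>n. Q (N + n)" and S = S and e = letter and \<omega> = "\<lambda>i j. [:0, w i j:]"])
    show "i = 0" if "of_int i \<in> Q (N + 0)" for i
    proof (rule ccontr)
      assume i: "i \<noteq> 0"
      have "\<psi> (of_int i) = scalar (of_int i)"
        unfolding T.\<kappa>_of_int[symmetric] \<psi>_single by (simp add: of_int_poly scalars.poly_at_const eval_word_def)
      then have "scalar (of_int i) \<in> J N"
        using that by (simp add: Q_def)
      then have "scalar (1 / of_int i) * scalar (of_int i) \<in> J N"
        by (rule J_left[OF rel _ C_scalar])
      moreover have "scalar (1 / of_int i) * scalar (of_int i) = 1"
        unfolding mult_single using i by simp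
      ultimately show False
        using one[of N] by simp
    qed
    show "letter i * letter j - letter j * letter i -
        (of_int (j - i) * letter (i + j) + Poly_Mapping.single 0 [:0, w i j:]) \<in> Q (N + 0)"
      if "i \<in> S" "j \<in> S" for i j
      unfolding Q_def using \<psi>_relation[OF rel that] by blast
  next
    fix X
    assume X: "Q (N + 0) \<subseteq> X" "\<And>s. Poly_Mapping.single 0 s \<in> X" "\<And>i. i \<in> S \<Longrightarrow> letter i \<in> X"
      "\<And>x y. x \<in> X \<Longrightarrow> y \<in> X \<Longrightarrow> x + y \<in> X" "\<And>x y. x \<in> X \<Longrightarrow> y \<in> X \<Longrightarrow> x * y \<in> X"
    have letter: "letter i \<in> X" for i
    proof (cases "i \<in> S")
      case False
      then have "\<psi> (letter i) = gen 0"
        by (simp add: letter_def \<psi>_single one_pCons scalars.poly_at_const eval_word_def E0_def)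
      then have "letter i \<in> Q (N + 0)"
        using gen_zero[OF rel] by (simp add: Q_def)
      then show ?thesis
        using X(1) by blast
    qed (rule X(3))
    have word: "Poly_Mapping.single (Word xs) s \<in> X" for xs s
    proof (induction xs)
      case Nil
      show ?case
        using X(2)[of s] by (simp add: zero_free_monoid_def)
    next
      case (Cons x xs)
      have "Poly_Mapping.single (Word (x # xs)) s = letter x * Poly_Mapping.single (Word xs) s"
        by (simp add: letter_def mult_single plus_free_monoid_def)
      then show ?case
        using X(5)[OF letter Cons] by simp
    qed
    have "t \<in> X" for t
    proof (induction t rule: single_add_induct)
      case (1 u p)
      show ?case
        using word[of "letters u" p] by simp
    qed (rule X(4))
    then show "X = UNIV"
      by blast
  next
    show "completely_prime (Q (N + n))" "Q (N + n) \<subseteq> Q (N + Suc n)" for n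
      using Q_prime Q_mono by simp_all
    show "Poly_Mapping.single 0 s \<in> Q (N + n) \<longleftrightarrow> Poly_Mapping.single 0 s \<in> Q (N + 0)" for n s
      using N[of "N + n" s] by simp
  qed (rule S)
  then obtain M where M: "\<And>n. M \<le> n \<Longrightarrow> Q (N + n) = Q (N + M)"
    by blast
  have J_Q: "J n = {x\<in>C. \<exists>t. x - \<psi> t \<in> J 0 \<and> t \<in> Q n}" for n
  proof -
    have J0: "J 0 \<subseteq> J n"
      by (rule lift_Suc_mono_le[of J, OF mono]) simp
    have "J n \<subseteq> C"
      using J[of n] additive_subgroup.a_subset[OF ideal.axioms(1)] by blast
    moreover have "x \<in> J n \<longleftrightarrow> t \<in> Q n" if "x - \<psi> t \<in> J 0" for x t
      using J_cong[OF rel, of x "\<psi> t" n] that J0 by (auto simp: Q_def)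
    ultimately show ?thesis
      using \<psi>_surj[OF rel[of 0]] by blast
  qed
  have "J n = J (N + M)" if "N + M \<le> n" for n
    using M[of "n - N"] that J_Q[of n] J_Q[of "N + M"] by simp
  then show "\<exists>N. \<forall>n\<ge>N. J n = J N"
    by blast
qed

end

section \<open>The Witt algebra, its positive part and the Virasoro algebra\<close>

lemma scale_fun_sum_single:
  "f = (\<Sum>i\<in>Poly_Mapping.keys f. scale_fun (Poly_Mapping.lookup f i) (Poly_Mapping.single i 1))"
  by (simp add: sum_singles)

theorem proposition1p5:
  shows "acc_completely_prime
           (enveloping_algebra (scale_fun :: 'k::field_char_0 \<Rightarrow> _) witt_bracket UNIV)
       \<and> acc_completely_prime
           (enveloping_algebra (scale_fun :: 'k \<Rightarrow> _) witt_bracket positive_witt)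
       \<and> acc_completely_prime
           (enveloping_algebra (scale_fun :: 'k \<Rightarrow> _) virasoro_bracket UNIV)"
proof (intro conjI)
  let ?e = "\<lambda>i :: int. Poly_Mapping.single i (1 :: 'k)"
  interpret W: lie_algebra "scale_fun :: 'k \<Rightarrow> (int \<Rightarrow>\<^sub>0 'k) \<Rightarrow> _" witt_bracket
    by (rule lie_algebra_witt)
  interpret V: lie_algebra "scale_fun :: 'k \<Rightarrow> (virasoro_index \<Rightarrow>\<^sub>0 'k) \<Rightarrow> _" virasoro_bracket
    by (rule lie_algebra_virasoro)
  have zero_left: "witt_bracket 0 x = (0 :: int \<Rightarrow>\<^sub>0 'k)" for x
    by (simp add: witt_bracket_def bilinear_ext_def)
  have bracket_e: "witt_bracket (?e i) (?e j) = scale_fun (of_int (j - i)) (?e (i + j)) + scale_fun 0 0" for i j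
    by (simp add: witt_bracket_def bilinear_ext_single)
  have "witt_presentation (scale_fun :: 'k \<Rightarrow> _) witt_bracket UNIV UNIV ?e 0 (\<lambda>_ _. 0)"
  proof
    show "UNIV \<subseteq> W.span (insert 0 (range ?e))"
    proof
      fix f :: "int \<Rightarrow>\<^sub>0 'k"
      show "f \<in> W.span (insert 0 (range ?e))"
        by (subst scale_fun_sum_single) (intro W.span_sum W.span_scale W.span_base, blast)
    qed
  qed (auto simp: W.lie_subalgebra_def zero_left bracket_e)
  then show "acc_completely_prime (enveloping_algebra (scale_fun :: 'k \<Rightarrow> _) witt_bracket UNIV)"
    by (rule witt_presentation.acc_enveloping_algebra)
  have "witt_presentation (scale_fun :: 'k \<Rightarrow> _) witt_bracket positive_witt {1..} ?e 0 (\<lambda>_ _. 0)"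
  proof
    show "W.lie_subalgebra positive_witt"
      by (rule lie_subalgebra_positive_witt)
    show "positive_witt \<subseteq> W.span (insert 0 (?e ` {1..}))"
      unfolding positive_witt_def by (rule W.span_mono) auto
  qed (auto simp: positive_witt_iff zero_left bracket_e)
  then show "acc_completely_prime (enveloping_algebra (scale_fun :: 'k \<Rightarrow> _) witt_bracket positive_witt)"
    by (rule witt_presentation.acc_enveloping_algebra)
  let ?v = "\<lambda>i. Poly_Mapping.single (Vir_e i) (1 :: 'k)"
  let ?w = "\<lambda>i j :: int. if i + j = 0 then of_int (i ^ 3 - i) / 12 else (0 :: 'k)"
  have "witt_presentation (scale_fun :: 'k \<Rightarrow> _) virasoro_bracket UNIV UNIV ?v (Poly_Mapping.single Vir_c 1) ?w"
  proof
    show "UNIV \<subseteq> V.span (insert (Poly_Mapping.single Vir_c 1) (range ?v))"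
    proof
      fix f :: "virasoro_index \<Rightarrow>\<^sub>0 'k"
      have "Poly_Mapping.single i 1 \<in> insert (Poly_Mapping.single Vir_c 1) (range ?v)" for i
        by (cases i) auto
      then show "f \<in> V.span (insert (Poly_Mapping.single Vir_c 1) (range ?v))"
        by (subst scale_fun_sum_single) (intro V.span_sum V.span_scale V.span_base)
    qed
    show "virasoro_bracket (Poly_Mapping.single Vir_c 1) x = 0" for x :: "virasoro_index \<Rightarrow>\<^sub>0 'k"
      unfolding virasoro_bracket_def by (subst bilinear_ext_superset[of "{Vir_c}" _ "Poly_Mapping.keys x"]) auto
    show "virasoro_bracket (?v i) (?v j) =
        scale_fun (of_int (j - i)) (?v (i + j)) + scale_fun (?w i j) (Poly_Mapping.single Vir_c 1)" for i j
      unfolding virasoro_bracket_def by (auto simp: bilinear_ext_single V.scale_right_distrib)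
  qed (auto simp: V.lie_subalgebra_def)
  then show "acc_completely_prime (enveloping_algebra (scale_fun :: 'k \<Rightarrow> _) virasoro_bracket UNIV)"
    by (rule witt_presentation.acc_enveloping_algebra)
qed

end
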